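(* Let $\mathcal{SV}$ be the Schrödinger-Virasoro conformal algebra and let $\mathbb{C}$ be its one-dimensional trivial module (with $\partial$ acting as $0$). For $q\in\mathbb{Z}_+$, the dimension over $\mathbb{C}$ of the basic cohomology group $\tilde H^q(\mathcal{SV},\mathbb{C})$ is $$\dim \tilde H^q(\mathcal{SV},\mathbb{C})=\begin{cases}1 & \text{if } q=0,3,\\ 2 & \text{if } q=5,6,\\ 0 & \text{otherwise.}\end{cases}$$ In particular, $$\tilde H^q(\mathcal{SV},\mathbb{C})=\begin{cases}\mathbb{C} & \text{if } q=0,\\ \mathbb{C}\,\Phi & \text{if } q=3,\\ \mathbb{C}\,\Lambda\oplus\mathbb{C}\,\Psi & \text{if } q=5,\\ \mathbb{C}\,\Omega\oplus\mathbb{C}\,\Theta & \text{if } q=6,\\ 0 & \text{otherwise,}\end{cases}$$ where $\Phi,\Lambda,\Psi,\Omega,\Theta$ denote the classes of the cocycles determined by \begin{align*} \Phi_{\lambda_1,\lambda_2,\lambda_3}(L,L,L)&=(\lambda_1-\lambda_2)(\lambda_1-\lambda_3)(\lambda_2-\lambda_3),\\ \Lambda_{\lambda_1,\ldots,\lambda_5}(L,L,Y,Y,M)&=(\lambda_1-\lambda_2)(\lambda_3-\lambda_4)\lambda_5,\\ \Psi_{\lambda_1,\ldots,\lambda_5}(L,Y,Y,M,M)&=(\lambda_2-\lambda_3)(\lambda_4-\lambda_5),\\ \Omega_{\lambda_1,\ldots,\lambda_6}(L,L,L,Y,Y,M)&=(\lambda_1-\lambda_2)(\lambda_1-\lambda_3)(\lambda_2-\lambda_3)(\lambda_4-\lambda_5),\\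 \Theta_{\lambda_1,\ldots,\lambda_6}(L,L,Y,Y,M,M)&=(\lambda_1-\lambda_2)(\lambda_3-\lambda_4)(\lambda_5-\lambda_6), \end{align*} each of these cochains being zero on every tuple of generators from $\{L,Y,M\}$ that is not a permutation of the displayed tuple.
   Context: All vector spaces and tensor products are over $\mathbb{C}$; $\mathbb{Z}_+$ is the set of nonnegative integers. A Lie conformal algebra $\mathcal{A}$ is a $\mathbb{C}[\partial]$-module with a $\mathbb{C}$-bilinear map $\mathcal{A}\otimes\mathcal{A}\to\mathbb{C}[\lambda]\otimes\mathcal{A}$, $a\otimes b\mapsto[a_\lambda b]$, such that for all $a,b,c\in\mathcal{A}$: $[(\partial a)_\lambda b]=-\lambda[a_\lambda b]$, $[a_\lambda(\partial b)]=(\partial+\lambda)[a_\lambda b]$, $[a_\lambda b]=-[b_{-\lambda-\partial}a]$, and $[a_\lambda[b_\mu c]]=[[a_\lambda b]_{\lambda+\mu}c]+[b_\mu[a_\lambda c]]$. The Schrödinger-Virasoro conformal algebra is $\mathcal{SV}=\mathbb{C}[\partial]L\oplus\mathbb{C}[\partial]M\oplus\mathbb{C}[\partial]Y$ (free $\mathbb{C}[\partial]$-module of rank 3) with nontrivial $\lambda$-brackets of generators $$[L_\lambda L]=(\partial+2\lambda)L,\quad [L_\lambda Y]=(\partial+\tfrac32\lambda)Y,\quad [Y_\lambda L]=(\tfrac12\partial+\tfrac32\lambda)Y,$$ $$[Y_\lambda Y]=(\partial+2\lambda)M,\quad [L_\lambda M]=(\partial+\lambda)M,\quad [M_\lambda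 L]=\lambda M,$$ all other $\lambda$-brackets of generators being zero. The trivial module $\mathbb{C}$ is the one-dimensional vector space $\mathbb{C}$ with $\partial v=0$ and $a_\lambda v=0$ for all $a\in\mathcal{SV}$, $v\in\mathbb{C}$. Basic cohomology with coefficients in $\mathbb{C}$. For $n\in\mathbb{Z}_+$, $\tilde C^n(\mathcal{A},\mathbb{C})$ is the space of $n$-cochains: $\mathbb{C}$-linear maps $\gamma:\mathcal{A}^{\otimes n}\to\mathbb{C}[\lambda_1,\ldots,\lambda_n]$, $a_1\otimes\cdots\otimes a_n\mapsto\gamma_{\lambda_1,\ldots,\lambda_n}(a_1,\ldots,a_n)$, such that (1) $\gamma_{\lambda_1,\ldots,\lambda_n}(a_1,\ldots,\partial a_i,\ldots,a_n)=-\lambda_i\gamma_{\lambda_1,\ldots,\lambda_n}(a_1,\ldots,a_n)$ for each $i$; (2) $\gamma$ is skew-symmetric under simultaneous permutations of the $a_i$'s and $\lambda_i$'s. In particular $\tilde C^0(\mathcal{A},\mathbb{C})=\mathbb{C}$. A cochain on $\mathcal{SV}$ is determined by its values on tuples of generators $L,Y,M$, and by skew-symmetry by its values on tuples with all $L$'s first, then the $Y$'s, then the $M$'s. The differential $d=d_n:\tilde C^n\to\tilde C^{n+1}$ is $$(d\gamma)_{\lambda_1,\ldots,\lambda_{n+1}}(a_1,\ldots,a_{n+1})=\sum_{1\le i<j\le n+1}(-1)^{i+j}\gamma_{\lambda_i+\lambda_j,\lambda_1,\ldots,\widehat{\lambda_i},\ldots,\widehat{\lambda_j},\ldots,\lambda_{n+1}}([{a_i}_{\lambda_i}a_j],a_1,\ldots,\widehat{a_i},\ldots,\widehat{a_j},\ldots,a_{n+1}),$$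 where $\gamma$ is extended linearly over polynomials in the $\lambda_i$ (hats denote omission; $d_0=0$). One has $d^2=0$, and $\tilde H^q(\mathcal{A},\mathbb{C})=\ker d_q/\operatorname{im}d_{q-1}$ is the basic cohomology. *)

theory Defs
  imports
    "HOL-Library.Poly_Mapping"
    "HOL-Computational_Algebra.Polynomial"
    "HOL-Combinatorics.Permutations"
    "HOL-Algebra.AbelCoset"
    "Jordan_Normal_Form.VS_Connect"
begin

section \<open>Polynomials in the variables of a cochain\<close>

text \<open>Variables are numbered from 0: \<open>lvar i\<close> is the variable written
  $\lambda_{i+1}$ on paper, and the polynomial ring in $n$ variables is \<open>lpolys n\<close>.\<close>

type_synonym lpoly = "(nat \<Rightarrow>\<^sub>0 nat) \<Rightarrow>\<^sub>0 complex"

definition lconst :: "complex \<Rightarrow> lpoly" where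
  "lconst c = Poly_Mapping.single 0 c"

definition lvar :: "nat \<Rightarrow> lpoly" where
  "lvar i = Poly_Mapping.single (Poly_Mapping.single i 1) 1"

definition lpolys :: "nat \<Rightarrow> lpoly set" where
  "lpolys n = {p. \<forall>m \<in> Poly_Mapping.keys p. Poly_Mapping.keys m \<subseteq> {..<n}}"

definition lsubst :: "(nat \<Rightarrow> lpoly) \<Rightarrow> lpoly \<Rightarrow> lpoly" where
  "lsubst f p = (\<Sum>m \<in> Poly_Mapping.keys p.
     lconst (Poly_Mapping.lookup p m) *
     (\<Prod>i \<in> Poly_Mapping.keys m. f i ^ Poly_Mapping.lookup m i))"


section \<open>Quotient vector spaces\<close>

text \<open>Addition of cosets is addition of sets. The product of a scalar with a coset is written
  as a union of cosets so that it is again a coset when the scalar is 0. The fields \<open>mult\<close> and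
  \<open>one\<close> of the record play no role.\<close>

definition quotient_space :: "('k, 'v, 'm) module_scheme \<Rightarrow> 'v set \<Rightarrow> ('k, 'v set) module" where
  "quotient_space V W =
     \<lparr>carrier = a_rcosets\<^bsub>V\<^esub> W, mult = (\<lambda>_ _. W), one = W, zero = W, add = set_add V,
      smult = (\<lambda>c U. \<Union>u\<in>U. W +>\<^bsub>V\<^esub> (c \<odot>\<^bsub>V\<^esub> u))\<rparr>"


section \<open>Lie conformal algebras and their basic cohomology with trivial coefficients\<close>

text \<open>\<open>bracket a b :: 'a poly\<close> is the $\lambda$-bracket $[a_\lambda b]$, a polynomial in
  $\lambda$ with coefficients in the algebra; multiplication by $\lambda$ is \<open>pCons 0\<close> and
  $\partial$ acts by \<open>map_poly D\<close>. In the axiom \<open>skew\<close>, the right-hand side is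
  $-\sum_k (-\lambda-\partial)^k c_k$ where $[b_\lambda a] = \sum_k \lambda^k c_k$.
  The axiom \<open>jacobi\<close> compares the coefficients of $\lambda^m\mu^n$ in
  $[a_\lambda[b_\mu c]] = [[a_\lambda b]_{\lambda+\mu}c] + [b_\mu[a_\lambda c]]$.\<close>

locale lie_conformal_algebra = vector_space scale
  for scale :: "complex \<Rightarrow> 'a::ab_group_add \<Rightarrow> 'a" +
  fixes D :: "'a \<Rightarrow> 'a"
    and bracket :: "'a \<Rightarrow> 'a \<Rightarrow> 'a poly"
  assumes D_linear: "Vector_Spaces.linear scale scale D"
    and bracket_linear_left: "Vector_Spaces.linear scale scale (\<lambda>a. coeff (bracket a b) k)"
    and bracket_linear_right: "Vector_Spaces.linear scale scale (\<lambda>b. coeff (bracket a b) k)"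
    and sesquilinear_left: "bracket (D a) b = - pCons 0 (bracket a b)"
    and sesquilinear_right: "bracket a (D b) = map_poly D (bracket a b) + pCons 0 (bracket a b)"
    and skew: "bracket a b =
      - (\<Sum>k\<le>degree (bracket b a).
           ((\<lambda>v. - pCons 0 v - map_poly D v) ^^ k) [:coeff (bracket b a) k:])"
    and jacobi: "coeff (bracket a (coeff (bracket b c) n)) m =
      (\<Sum>k\<le>m. scale (of_nat ((m + n - k) choose n))
                 (coeff (bracket (coeff (bracket a b) k) c) (m + n - k))) +
      coeff (bracket b (coeff (bracket a c) m)) n"
begin

text \<open>An \<open>n\<close>-cochain is a $\mathbb{C}$-multilinear map on lists of length \<open>n\<close>, which is the same as
  a linear map on the \<open>n\<close>-th tensor power. On lists of other lengths it is 0 by convention, so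
  that equality of cochains is equality of functions.\<close>

definition cochains :: "nat \<Rightarrow> ('a list \<Rightarrow> lpoly) set" where
  "cochains n = {\<gamma>.
     (\<forall>as. length as \<noteq> n \<longrightarrow> \<gamma> as = 0) \<and>
     (\<forall>as. length as = n \<longrightarrow> \<gamma> as \<in> lpolys n) \<and>
     (\<forall>as i a b. length as = n \<and> i < n \<longrightarrow>
        \<gamma> (as[i := a + b]) = \<gamma> (as[i := a]) + \<gamma> (as[i := b])) \<and>
     (\<forall>as i c a. length as = n \<and> i < n \<longrightarrow>
        \<gamma> (as[i := scale c a]) = lconst c * \<gamma> (as[i := a])) \<and>
     (\<forall>as i. length as = n \<and> i < n \<longrightarrow>
        \<gamma> (as[i := D (as ! i)]) = - lvar i * \<gamma> as) \<and>
     (\<forall>as \<sigma>. length as = n \<and> \<sigma> permutes {..<n} \<longrightarrow>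
        lsubst (\<lambda>i. lvar (\<sigma> i)) (\<gamma> (permute_list \<sigma> as)) = of_int (sign \<sigma>) * \<gamma> as)}"

text \<open>With 0-based positions \<open>i < j\<close> the sign $(-1)^{i+j}$ is unchanged. \<open>ks\<close> lists the
  positions other than \<open>i\<close> and \<open>j\<close> in increasing order, and
  $\gamma$ is extended linearly over the powers of $\lambda_i$ occurring in $[{a_i}_{\lambda_i}a_j]$.\<close>

definition differential :: "nat \<Rightarrow> ('a list \<Rightarrow> lpoly) \<Rightarrow> 'a list \<Rightarrow> lpoly" where
  "differential n \<gamma> as = (if length as \<noteq> Suc n then 0 else
     (\<Sum>j\<le>n. \<Sum>i<j. (-1) ^ (i + j) *
        (let ks = filter (\<lambda>k. k \<noteq> i \<and> k \<noteq> j) [0..<Suc n];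
             br = bracket (as ! i) (as ! j)
         in \<Sum>p\<le>degree br. lvar i ^ p *
              lsubst (case_nat (lvar i + lvar j) (\<lambda>l. lvar (ks ! l)))
                (\<gamma> (coeff br p # map ((!) as) ks)))))"

definition cochain_space :: "nat \<Rightarrow> (complex, 'a list \<Rightarrow> lpoly) module" where
  "cochain_space n =
     \<lparr>carrier = cochains n, mult = (\<lambda>_ _ _. 0), one = (\<lambda>_. 0), zero = (\<lambda>_. 0),
      add = (\<lambda>\<gamma> \<delta> as. \<gamma> as + \<delta> as), smult = (\<lambda>c \<gamma> as. lconst c * \<gamma> as)\<rparr>"

definition cocycles :: "nat \<Rightarrow> ('a list \<Rightarrow> lpoly) set" where
  "cocycles n = {\<gamma> \<in> cochains n. differential n \<gamma> = (\<lambda>_. 0)}"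

definition coboundaries :: "nat \<Rightarrow> ('a list \<Rightarrow> lpoly) set" where
  "coboundaries n = (case n of 0 \<Rightarrow> {\<lambda>_. 0} | Suc m \<Rightarrow> differential m ` cochains m)"

definition cocycle_space :: "nat \<Rightarrow> (complex, 'a list \<Rightarrow> lpoly) module" where
  "cocycle_space n = (cochain_space n)\<lparr>carrier := cocycles n\<rparr>"

definition cohomology :: "nat \<Rightarrow> (complex, ('a list \<Rightarrow> lpoly) set) module" where
  "cohomology n = quotient_space (cocycle_space n) (coboundaries n)"

definition cohomology_class :: "nat \<Rightarrow> ('a list \<Rightarrow> lpoly) \<Rightarrow> ('a list \<Rightarrow> lpoly) set" where
  "cohomology_class n \<gamma> = coboundaries n +>\<^bsub>cocycle_space n\<^esub> \<gamma>"

end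


section \<open>The Schroedinger-Virasoro conformal algebra\<close>

datatype sv_gen = L | Y | M

text \<open>The free $\mathbb{C}[\partial]$-module on the three generators.\<close>

type_synonym sv = "sv_gen \<Rightarrow>\<^sub>0 complex poly"

definition sv_scale :: "complex \<Rightarrow> sv \<Rightarrow> sv" where
  "sv_scale c = Poly_Mapping.map (Polynomial.smult c)"

definition sv_D :: "sv \<Rightarrow> sv" where
  "sv_D = Poly_Mapping.map (pCons 0)"

definition gen :: "sv_gen \<Rightarrow> sv" where
  "gen g = Poly_Mapping.single g 1"

text \<open>Polynomials in $\lambda$: \<open>[:x, y:]\<close> stands for $x + \lambda y$.\<close>

fun sv_gen_bracket :: "sv_gen \<Rightarrow> sv_gen \<Rightarrow> sv poly" where
  "sv_gen_bracket L L = [:sv_D (gen L), sv_scale 2 (gen L):]"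
| "sv_gen_bracket L Y = [:sv_D (gen Y), sv_scale (3/2) (gen Y):]"
| "sv_gen_bracket Y L = [:sv_scale (1/2) (sv_D (gen Y)), sv_scale (3/2) (gen Y):]"
| "sv_gen_bracket Y Y = [:sv_D (gen M), sv_scale 2 (gen M):]"
| "sv_gen_bracket L M = [:sv_D (gen M), gen M:]"
| "sv_gen_bracket M L = [:0, gen M:]"
| "sv_gen_bracket _ _ = 0"

text \<open>\<open>sv_poly_act p T v\<close> is $p(T)v$ for an operator $T$ on $\mathbb{C}[\lambda]\otimes\mathcal{SV}$. The bracket is the
  sesquilinear extension
  $[p(\partial)g\,{}_\lambda\, q(\partial)h] = p(-\lambda)\,q(\partial+\lambda)\,[g_\lambda h]$ of the bracket of generators.\<close>

definition sv_poly_act :: "complex poly \<Rightarrow> (sv poly \<Rightarrow> sv poly) \<Rightarrow> sv poly \<Rightarrow> sv poly" where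
  "sv_poly_act p T v = (\<Sum>k\<le>degree p. map_poly (sv_scale (coeff p k)) ((T ^^ k) v))"

definition sv_bracket :: "sv \<Rightarrow> sv \<Rightarrow> sv poly" where
  "sv_bracket a b =
     (\<Sum>g\<in>{L, Y, M}. \<Sum>h\<in>{L, Y, M}.
        sv_poly_act (Poly_Mapping.lookup a g) (\<lambda>v. - pCons 0 v)
          (sv_poly_act (Poly_Mapping.lookup b h) (\<lambda>v. map_poly sv_D v + pCons 0 v)
            (sv_gen_bracket g h)))"

subsection \<open>It is a Lie conformal algebra\<close>

text \<open>Identities are verified after evaluating at complex values $x$ of $\lambda$ and $t$ of $\partial$.\<close>

definition sv_at :: "sv_gen \<Rightarrow> complex \<Rightarrow> sv \<Rightarrow> complex" where
  "sv_at g t a = poly (Poly_Mapping.lookup a g) t"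

definition sv_ev :: "sv_gen \<Rightarrow> complex \<Rightarrow> complex \<Rightarrow> sv poly \<Rightarrow> complex" where
  "sv_ev g t x v = poly (map_poly (sv_at g t) v) x"

lemma lookup_sv_scale [simp]:
  "Poly_Mapping.lookup (sv_scale c a) g = Polynomial.smult c (Poly_Mapping.lookup a g)"
  by (cases "Poly_Mapping.lookup a g = 0")
     (simp_all add: sv_scale_def Poly_Mapping.map.rep_eq)

lemma lookup_sv_D [simp]:
  "Poly_Mapping.lookup (sv_D a) g = pCons 0 (Poly_Mapping.lookup a g)"
  by (cases "Poly_Mapping.lookup a g = 0")
     (simp_all add: sv_D_def Poly_Mapping.map.rep_eq)

lemma sv_at_simps [simp]:
  "sv_at g t 0 = 0" "sv_at g t (a + b) = sv_at g t a + sv_at g t b"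
  "sv_at g t (- a) = - sv_at g t a" "sv_at g t (a - b) = sv_at g t a - sv_at g t b"
  "sv_at g t (sv_scale c a) = c * sv_at g t a" "sv_at g t (sv_D a) = t * sv_at g t a"
  "sv_at g t (gen h) = (if g = h then 1 else 0)"
  by (auto simp: sv_at_def lookup_add lookup_minus gen_def lookup_single when_def)

lemma sv_at_sum: "sv_at g t (sum f A) = (\<Sum>i\<in>A. sv_at g t (f i))"
  by (induction A rule: infinite_finite_induct) simp_all

lemma sv_at_eqI: "(\<And>g t. sv_at g t a = sv_at g t b) \<Longrightarrow> a = b"
  by (rule poly_mapping_eqI) (metis poly_eq_poly_eq_iff sv_at_def ext)

lemma sv_scale_0 [simp]: "sv_scale c 0 = 0" and sv_D_0 [simp]: "sv_D 0 = 0"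
  by (auto intro!: sv_at_eqI)

lemma sv_ev_simps [simp]:
  "sv_ev g t x 0 = 0"
  "sv_ev g t x (v + w) = sv_ev g t x v + sv_ev g t x w"
  "sv_ev g t x (- v) = - sv_ev g t x v"
  "sv_ev g t x (v - w) = sv_ev g t x v - sv_ev g t x w"
  "sv_ev g t x (pCons a v) = sv_at g t a + x * sv_ev g t x v"
  "sv_ev g t x (map_poly sv_D v) = t * sv_ev g t x v"
  "sv_ev g t x (map_poly (sv_scale c) v) = c * sv_ev g t x v"
proof -
  show "sv_ev g t x 0 = 0" by (simp add: sv_ev_def)
  have "map_poly (sv_at g t) (v + w) = map_poly (sv_at g t) v + map_poly (sv_at g t) w"
    by (rule poly_eqI) (simp add: coeff_map_poly)
  then show "sv_ev g t x (v + w) = sv_ev g t x v + sv_ev g t x w" by (simp add: sv_ev_def)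
  have "map_poly (sv_at g t) (- v) = - map_poly (sv_at g t) v"
    by (rule poly_eqI) (simp add: coeff_map_poly)
  then show "sv_ev g t x (- v) = - sv_ev g t x v" by (simp add: sv_ev_def)
  have "map_poly (sv_at g t) (v - w) = map_poly (sv_at g t) v - map_poly (sv_at g t) w"
    by (rule poly_eqI) (simp add: coeff_map_poly)
  then show "sv_ev g t x (v - w) = sv_ev g t x v - sv_ev g t x w" by (simp add: sv_ev_def)
  have "map_poly (sv_at g t) (pCons a v) = pCons (sv_at g t a) (map_poly (sv_at g t) v)"
    by (rule poly_eqI) (simp add: coeff_map_poly coeff_pCons split: nat.split)
  then show "sv_ev g t x (pCons a v) = sv_at g t a + x * sv_ev g t x v" by (simp add: sv_ev_def)
  have "map_poly (sv_at g t) (map_poly sv_D v) = Polynomial.smult t (map_poly (sv_at g t) v)"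
    by (rule poly_eqI) (simp add: coeff_map_poly)
  then show "sv_ev g t x (map_poly sv_D v) = t * sv_ev g t x v" by (simp add: sv_ev_def)
  have "map_poly (sv_at g t) (map_poly (sv_scale c) v) =
      Polynomial.smult c (map_poly (sv_at g t) v)"
    by (rule poly_eqI) (simp add: coeff_map_poly)
  then show "sv_ev g t x (map_poly (sv_scale c) v) = c * sv_ev g t x v" by (simp add: sv_ev_def)
qed

lemma sv_ev_sum: "sv_ev g t x (sum f A) = (\<Sum>i\<in>A. sv_ev g t x (f i))"
  by (induction A rule: infinite_finite_induct) simp_all

lemma sv_ev_eqI:
  assumes "\<And>g t x. sv_ev g t x v = sv_ev g t x w"
  shows "v = w"
proof (rule poly_eqI, rule sv_at_eqI)
  fix k g t
  have "map_poly (sv_at g t) v = map_poly (sv_at g t) w"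
    using assms by (simp add: sv_ev_def poly_eq_poly_eq_iff[symmetric] fun_eq_iff)
  then show "sv_at g t (coeff v k) = sv_at g t (coeff w k)"
    by (metis coeff_map_poly sv_at_simps(1))
qed

lemma sv_ev_bound:
  assumes "\<And>k. k > N \<Longrightarrow> coeff v k = 0"
  shows "sv_ev g t x v = (\<Sum>k\<le>N. x ^ k * sv_at g t (coeff v k))"
proof -
  let ?p = "map_poly (sv_at g t) v"
  have "sv_ev g t x v = (\<Sum>k\<le>degree ?p. coeff ?p k * x ^ k)"
    by (simp add: sv_ev_def poly_altdef)
  also have "\<dots> = (\<Sum>k\<le>N. coeff ?p k * x ^ k)"
    using assms
    by (intro sum.mono_neutral_left) (auto intro!: degree_le simp: coeff_map_poly coeff_eq_0)
  finally show ?thesis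
    by (simp add: coeff_map_poly mult.commute)
qed

lemma sv_ev_power:
  assumes "\<And>v. sv_ev g t x (T v) = z * sv_ev g t x v"
  shows "sv_ev g t x ((T ^^ k) v) = z ^ k * sv_ev g t x v"
  by (induction k) (simp_all add: assms)

lemma sv_ev_poly_act:
  assumes "\<And>v. sv_ev g t x (T v) = z * sv_ev g t x v"
  shows "sv_ev g t x (sv_poly_act p T v) = poly p z * sv_ev g t x v"
  by (simp add: sv_poly_act_def sv_ev_sum sv_ev_power[OF assms] poly_altdef sum_distrib_right
      mult.assoc)

lemma sv_ev_bracket:
  "sv_ev g t x (sv_bracket a b) =
     (\<Sum>h\<in>{L, Y, M}. \<Sum>h'\<in>{L, Y, M}.
        sv_at h (- x) a * sv_at h' (t + x) b * sv_ev g t x (sv_gen_bracket h h'))"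
proof -
  have 1: "sv_ev g t x (sv_poly_act p (\<lambda>v. - pCons 0 v) v) = poly p (- x) * sv_ev g t x v" for p v
    by (rule sv_ev_poly_act) simp
  have 2: "sv_ev g t x (sv_poly_act p (\<lambda>v. map_poly sv_D v + pCons 0 v) v) =
      poly p (t + x) * sv_ev g t x v" for p v
    by (rule sv_ev_poly_act) (simp add: algebra_simps)
  show ?thesis
    by (simp only: sv_bracket_def sv_ev_sum 1 2 sv_at_def mult.assoc)
qed

lemma sv_ev_bracket_components:
  "sv_ev L t x (sv_bracket a b) = sv_at L (- x) a * sv_at L (t + x) b * (t + 2 * x)"
  "sv_ev Y t x (sv_bracket a b) =
     sv_at L (- x) a * sv_at Y (t + x) b * (t + 3 / 2 * x) +
     sv_at Y (- x) a * sv_at L (t + x) b * (t / 2 + 3 / 2 * x)"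
  "sv_ev M t x (sv_bracket a b) =
     sv_at Y (- x) a * sv_at Y (t + x) b * (t + 2 * x) +
     sv_at L (- x) a * sv_at M (t + x) b * (t + x) +
     sv_at M (- x) a * sv_at L (t + x) b * x"
  by (simp_all add: sv_ev_bracket algebra_simps)

lemma vector_space_sv: "vector_space sv_scale"
  by unfold_locales (auto intro!: sv_at_eqI simp: algebra_simps)

lemma linear_svI:
  assumes "\<And>a b. f (a + b) = f a + f b" "\<And>c a. f (sv_scale c a) = sv_scale c (f a)"
  shows "Vector_Spaces.linear sv_scale sv_scale f"
  using assms vector_space_sv
  by (auto simp: Vector_Spaces.linear_def module_hom_def module_hom_axioms_def
      module_iff_vector_space)

lemma sv_bracket_linear:
  "sv_bracket (a + b) c = sv_bracket a c + sv_bracket b c"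
  "sv_bracket a (b + c) = sv_bracket a b + sv_bracket a c"
  "sv_bracket (sv_scale r a) b = map_poly (sv_scale r) (sv_bracket a b)"
  "sv_bracket a (sv_scale r b) = map_poly (sv_scale r) (sv_bracket a b)"
  "sv_bracket 0 b = 0" "sv_bracket a 0 = 0"
  by (rule sv_ev_eqI, simp add: sv_ev_bracket algebra_simps)+

lemma sv_sesquilinear:
  "sv_bracket (sv_D a) b = - pCons 0 (sv_bracket a b)"
  "sv_bracket a (sv_D b) = map_poly sv_D (sv_bracket a b) + pCons 0 (sv_bracket a b)"
  by (rule sv_ev_eqI, simp add: sv_ev_bracket algebra_simps)+

lemma sv_skew:
  "sv_bracket a b = - (\<Sum>k\<le>degree (sv_bracket b a).
     ((\<lambda>v. - pCons 0 v - map_poly sv_D v) ^^ k) [:coeff (sv_bracket b a) k:])"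
proof (rule sv_ev_eqI)
  fix g t x
  have 1: "sv_ev g t x (((\<lambda>v. - pCons 0 v - map_poly sv_D v) ^^ k) v) =
      (- x - t) ^ k * sv_ev g t x v" for k v
    by (rule sv_ev_power) (simp add: algebra_simps)
  have "sv_ev g t (- x - t) (sv_bracket b a) = (\<Sum>k\<le>degree (sv_bracket b a).
      (- x - t) ^ k * sv_at g t (coeff (sv_bracket b a) k))"
    by (rule sv_ev_bound) (simp add: coeff_eq_0)
  moreover have "sv_ev g t x (sv_bracket a b) = - sv_ev g t (- x - t) (sv_bracket b a)"
    by (cases g) (simp_all add: sv_ev_bracket_components field_simps)
  ultimately show "sv_ev g t x (sv_bracket a b) =
      sv_ev g t x (- (\<Sum>k\<le>degree (sv_bracket b a).
     ((\<lambda>v. - pCons 0 v - map_poly sv_D v) ^^ k) [:coeff (sv_bracket b a) k:]))"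
    by (simp only: sv_ev_simps(3) sv_ev_sum 1) simp
qed

lemma double_poly_zero:
  fixes w :: "nat \<Rightarrow> nat \<Rightarrow> complex"
  assumes "\<And>x y. (\<Sum>m\<le>N. \<Sum>n\<le>N. x ^ m * (y ^ n * w m n)) = 0" "m \<le> N" "n \<le> N"
  shows "w m n = 0"
proof -
  have "(\<Sum>n\<le>N. w m n * y ^ n) = 0" for y
  proof -
    have "\<forall>x. (\<Sum>m\<le>N. (\<Sum>n\<le>N. w m n * y ^ n) * x ^ m) = 0"
      using assms(1)[of _ y] by (simp add: sum_distrib_left sum_distrib_right mult_ac)
    then show ?thesis using polyfun_eq_0[of "\<lambda>m. \<Sum>n\<le>N. w m n * y ^ n" N] assms(2) by blast
  qed
  then show ?thesis using polyfun_eq_0[of "w m" N] assms(3) by blast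
qed

lemma double_sum_shift:
  fixes u :: "nat \<Rightarrow> nat \<Rightarrow> complex"
  assumes u: "\<And>k l. k > K \<or> l > K \<Longrightarrow> u k l = 0" and N: "2 * K \<le> N"
  shows "(\<Sum>m\<le>N. \<Sum>n\<le>N. x ^ m * (y ^ n *
            (\<Sum>k\<le>m. of_nat ((m + n - k) choose n) * u k (m + n - k)))) =
         (\<Sum>k\<le>K. x ^ k * (\<Sum>l\<le>K. (x + y) ^ l * u k l))"
proof -
  define F where "F = (\<lambda>(m, n, k). x ^ m * y ^ n * of_nat ((m + n - k) choose n) * u k (m + n - k))"
  define G where "G = (\<lambda>(k, l, n). x ^ (k + (l - n)) * y ^ n * of_nat (l choose n) * u k l)"
  let ?S = "SIGMA m:{..N}. SIGMA n:{..N}. {..m}" and ?T = "SIGMA k:{..K}. SIGMA l:{..K}. {..l}"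
  have "(\<Sum>m\<le>N. \<Sum>n\<le>N. x ^ m * (y ^ n *
            (\<Sum>k\<le>m. of_nat ((m + n - k) choose n) * u k (m + n - k)))) =
      (\<Sum>m\<le>N. \<Sum>n\<le>N. \<Sum>k\<le>m. F (m, n, k))"
    by (simp add: F_def sum_distrib_left mult_ac)
  also have "\<dots> = sum F ?S"
    by (simp add: sum.Sigma)
  also have "\<dots> = sum G ?T"
  proof (rule sum.reindex_bij_witness_not_neutral
      [where S' = "{p \<in> ?S. F p = 0}" and T' = "{p \<in> ?T. G p = 0}"
        and i = "\<lambda>(k, l, n). (k + l - n, n, k)" and j = "\<lambda>(m, n, k). (k, m + n - k, n)"])
    have FG: "F (k + l - n, n, k) = G (k, l, n)" if "n \<le> l" for k l n
      using that by (simp add: F_def G_def)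
    show "finite {p \<in> ?S. F p = 0}" "finite {p \<in> ?T. G p = 0}" by auto
    show "(case (case p of (k, l, n) \<Rightarrow> (k + l - n, n, k)) of (m, n, k) \<Rightarrow> (k, m + n - k, n)) = p"
      if "p \<in> ?T - {p \<in> ?T. G p = 0}" for p
      using that by auto
    show "(case p of (k, l, n) \<Rightarrow> (k + l - n, n, k)) \<in> ?S - {p \<in> ?S. F p = 0}"
      if "p \<in> ?T - {p \<in> ?T. G p = 0}" for p
      using that N by (auto simp: FG)
    show "G (case p of (m, n, k) \<Rightarrow> (k, m + n - k, n)) = F p" if p: "p \<in> ?S" for p
    proof -
      obtain m n k where pe: "p = (m, n, k)" by (cases p)
      with p have "k \<le> m" by auto
      then show ?thesis using FG[of n "m + n - k" k] by (simp add: pe)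
    qed
    show "(case (case p of (m, n, k) \<Rightarrow> (k, m + n - k, n)) of (k, l, n) \<Rightarrow> (k + l - n, n, k)) = p"
      if "p \<in> ?S - {p \<in> ?S. F p = 0}" for p
      using that by auto
    show "(case p of (m, n, k) \<Rightarrow> (k, m + n - k, n)) \<in> ?T - {p \<in> ?T. G p = 0}"
      if p: "p \<in> ?S - {p \<in> ?S. F p = 0}" for p
    proof -
      obtain m n k where pe: "p = (m, n, k)" by (cases p)
      from p have le: "k \<le> m" and nz: "F (m, n, k) \<noteq> 0" by (auto simp: pe)
      then have "u k (m + n - k) \<noteq> 0" by (auto simp: F_def)
      with u have "k \<le> K" "m + n - k \<le> K" by (meson not_le)+
      then show ?thesis using FG[of n "m + n - k" k] le nz by (simp add: pe)
    qed
  qed auto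
  also have "\<dots> = (\<Sum>k\<le>K. \<Sum>l\<le>K. \<Sum>n\<le>l. G (k, l, n))"
    by (simp add: sum.Sigma)
  also have "\<dots> = (\<Sum>k\<le>K. x ^ k * (\<Sum>l\<le>K. (x + y) ^ l * u k l))"
    by (simp add: G_def add.commute[of x y] binomial_ring sum_distrib_left sum_distrib_right
        power_add mult_ac)
  finally show ?thesis .
qed

lemma double_bound:
  fixes f :: "sv \<Rightarrow> sv poly"
  assumes "f 0 = 0"
  obtains N where "\<And>m n. m > N \<or> n > N \<Longrightarrow> coeff (f (coeff v n)) m = 0"
proof
  fix m n
  let ?N = "degree v + (\<Sum>n\<le>degree v. degree (f (coeff v n)))"
  assume *: "m > ?N \<or> n > ?N"
  show "coeff (f (coeff v n)) m = 0"
  proof (cases "n \<le> degree v")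
    case True
    then have "degree (f (coeff v n)) \<le> (\<Sum>n\<le>degree v. degree (f (coeff v n)))"
      by (intro member_le_sum) auto
    with * True show ?thesis by (intro coeff_eq_0) linarith
  next
    case False
    then show ?thesis using assms by (simp add: coeff_eq_0)
  qed
qed

lemma sv_ev_bracket_right:
  assumes "\<forall>n>N. coeff v n = 0"
  shows "(\<Sum>n\<le>N. y ^ n * sv_ev g t x (sv_bracket a (coeff v n))) =
     (\<Sum>h\<in>{L, Y, M}. \<Sum>h'\<in>{L, Y, M}.
        sv_at h (- x) a * sv_ev h' (t + x) y v * sv_ev g t x (sv_gen_bracket h h'))"
proof -
  have e: "sv_ev h s y v = (\<Sum>n\<le>N. y ^ n * sv_at h s (coeff v n))" for h s
    by (rule sv_ev_bound) (use assms in simp)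
  show ?thesis
    by (simp only: sv_ev_bracket e sum_distrib_left sum_distrib_right,
        subst sum.swap, rule sum.cong[OF refl], subst sum.swap, simp only: mult_ac)
qed

lemma sv_ev_bracket_left:
  assumes "\<forall>n>N. coeff v n = 0"
  shows "(\<Sum>n\<le>N. y ^ n * sv_ev g t x (sv_bracket (coeff v n) b)) =
     (\<Sum>h\<in>{L, Y, M}. \<Sum>h'\<in>{L, Y, M}.
        sv_ev h (- x) y v * sv_at h' (t + x) b * sv_ev g t x (sv_gen_bracket h h'))"
proof -
  have e: "sv_ev h s y v = (\<Sum>n\<le>N. y ^ n * sv_at h s (coeff v n))" for h s
    by (rule sv_ev_bound) (use assms in simp)
  show ?thesis
    by (simp only: sv_ev_bracket e sum_distrib_left sum_distrib_right,
        subst sum.swap, rule sum.cong[OF refl], subst sum.swap, simp only: mult_ac)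
qed

lemma sv_jacobi_ev:
  "(\<Sum>h\<in>{L, Y, M}. \<Sum>h'\<in>{L, Y, M}.
      sv_at h (- x) a * sv_ev h' (t + x) y (sv_bracket b c) * sv_ev g t x (sv_gen_bracket h h')) =
   (\<Sum>h\<in>{L, Y, M}. \<Sum>h'\<in>{L, Y, M}.
      sv_ev h (- (x + y)) x (sv_bracket a b) * sv_at h' (t + (x + y)) c *
        sv_ev g t (x + y) (sv_gen_bracket h h')) +
   (\<Sum>h\<in>{L, Y, M}. \<Sum>h'\<in>{L, Y, M}.
      sv_at h (- y) b * sv_ev h' (t + y) x (sv_bracket a c) * sv_ev g t y (sv_gen_bracket h h'))"
proof -
  have *: "t + x + y = t + (x + y)" "t + y + x = t + (x + y)" "- (x + y) + x = - y"
    by simp_all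
  show ?thesis
    by (cases g) (simp_all add: sv_ev_bracket_components * del: minus_add_distrib add.assoc,
      simp_all add: field_simps)
qed

lemma sv_jacobi:
  "coeff (sv_bracket a (coeff (sv_bracket b c) n)) m =
     (\<Sum>k\<le>m. sv_scale (of_nat ((m + n - k) choose n))
                (coeff (sv_bracket (coeff (sv_bracket a b) k) c) (m + n - k))) +
     coeff (sv_bracket b (coeff (sv_bracket a c) m)) n"
proof (rule sv_at_eqI)
  fix g t
  define u1 where "u1 m n = sv_at g t (coeff (sv_bracket a (coeff (sv_bracket b c) n)) m)" for m n
  define u2 where "u2 k l = sv_at g t (coeff (sv_bracket (coeff (sv_bracket a b) k) c) l)" for k l
  define u3 where "u3 m n = sv_at g t (coeff (sv_bracket b (coeff (sv_bracket a c) m)) n)" for m n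
  obtain N1 where N1: "\<And>m n. m > N1 \<or> n > N1 \<Longrightarrow>
      coeff (sv_bracket a (coeff (sv_bracket b c) n)) m = 0"
    using double_bound[of "sv_bracket a"] sv_bracket_linear(6) by metis
  obtain N2 where N2: "\<And>l k. l > N2 \<or> k > N2 \<Longrightarrow>
      coeff (sv_bracket (coeff (sv_bracket a b) k) c) l = 0"
    using double_bound[of "\<lambda>v. sv_bracket v c"] sv_bracket_linear(5) by metis
  obtain N3 where N3: "\<And>n m. n > N3 \<or> m > N3 \<Longrightarrow>
      coeff (sv_bracket b (coeff (sv_bracket a c) m)) n = 0"
    using double_bound[of "sv_bracket b"] sv_bracket_linear(6) by metis
  define K where "K = N1 + N2 + N3 + degree (sv_bracket a b) + degree (sv_bracket b c) +
    degree (sv_bracket a c)"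
  define N where "N = 2 * K + m + n"
  have deg: "degree (sv_bracket a b) \<le> K" "degree (sv_bracket b c) \<le> K"
    "degree (sv_bracket a c) \<le> K" "K \<le> N"
    by (simp_all add: K_def N_def)
  define w where "w m n = u1 m n -
    (\<Sum>k\<le>m. of_nat ((m + n - k) choose n) * u2 k (m + n - k)) - u3 m n" for m n
  have "w m n = 0"
  proof (rule double_poly_zero)
    fix x y
    have "(\<Sum>m\<le>N. \<Sum>n\<le>N. x ^ m * (y ^ n * u1 m n)) =
        (\<Sum>n\<le>N. y ^ n * (\<Sum>m\<le>N. x ^ m * u1 m n))"
      by (subst sum.swap) (simp add: sum_distrib_left mult_ac)
    also have "\<dots> = (\<Sum>n\<le>N. y ^ n * sv_ev g t x (sv_bracket a (coeff (sv_bracket b c) n)))"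
      unfolding u1_def using N1
      by (intro sum.cong refl arg_cong2[of _ _ _ _ "(*)"] sv_ev_bound[symmetric])
        (simp add: N_def K_def)
    finally have 1: "(\<Sum>m\<le>N. \<Sum>n\<le>N. x ^ m * (y ^ n * u1 m n)) = \<dots>" .
    have "(\<Sum>m\<le>N. \<Sum>n\<le>N. x ^ m * (y ^ n * u3 m n)) =
        (\<Sum>m\<le>N. x ^ m * (\<Sum>n\<le>N. y ^ n * u3 m n))"
      by (simp add: sum_distrib_left mult_ac)
    also have "\<dots> = (\<Sum>m\<le>N. x ^ m * sv_ev g t y (sv_bracket b (coeff (sv_bracket a c) m)))"
      unfolding u3_def using N3
      by (intro sum.cong refl arg_cong2[of _ _ _ _ "(*)"] sv_ev_bound[symmetric])
        (simp add: N_def K_def)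
    finally have 3: "(\<Sum>m\<le>N. \<Sum>n\<le>N. x ^ m * (y ^ n * u3 m n)) = \<dots>" .
    have "(\<Sum>m\<le>N. \<Sum>n\<le>N. x ^ m * (y ^ n *
            (\<Sum>k\<le>m. of_nat ((m + n - k) choose n) * u2 k (m + n - k)))) =
        (\<Sum>k\<le>K. x ^ k * (\<Sum>l\<le>K. (x + y) ^ l * u2 k l))"
      using N2 by (intro double_sum_shift) (auto simp: u2_def K_def N_def)
    also have "\<dots> = (\<Sum>k\<le>K. x ^ k *
        sv_ev g t (x + y) (sv_bracket (coeff (sv_bracket a b) k) c))"
      unfolding u2_def using N2
      by (intro sum.cong refl arg_cong2[of _ _ _ _ "(*)"] sv_ev_bound[symmetric])
        (simp add: K_def)
    finally have 2: "(\<Sum>m\<le>N. \<Sum>n\<le>N. x ^ m * (y ^ n *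
            (\<Sum>k\<le>m. of_nat ((m + n - k) choose n) * u2 k (m + n - k)))) = \<dots>" .
    have z: "\<forall>i>N. coeff (sv_bracket b c) i = 0" "\<forall>i>N. coeff (sv_bracket a c) i = 0"
      and z': "\<forall>i>K. coeff (sv_bracket a b) i = 0"
      using deg by (simp_all add: coeff_eq_0)
    note r1 = sv_ev_bracket_right[OF z(1)] and r3 = sv_ev_bracket_right[OF z(2)]
      and r2 = sv_ev_bracket_left[OF z']
    have "(\<Sum>m\<le>N. \<Sum>n\<le>N. x ^ m * (y ^ n * w m n)) =
        (\<Sum>m\<le>N. \<Sum>n\<le>N. x ^ m * (y ^ n * u1 m n)) -
        (\<Sum>m\<le>N. \<Sum>n\<le>N. x ^ m * (y ^ n *
            (\<Sum>k\<le>m. of_nat ((m + n - k) choose n) * u2 k (m + n - k)))) -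
        (\<Sum>m\<le>N. \<Sum>n\<le>N. x ^ m * (y ^ n * u3 m n))"
      by (simp add: w_def right_diff_distrib sum_subtractf)
    also have "\<dots> = 0"
      unfolding 1 2 3 r1 r2 r3
        sv_jacobi_ev[where x = x and y = y and t = t and g = g and a = a and b = b and c = c] by simp
    finally show "(\<Sum>m\<le>N. \<Sum>n\<le>N. x ^ m * (y ^ n * w m n)) = 0" .
  qed (simp_all add: N_def)
  then show "sv_at g t (coeff (sv_bracket a (coeff (sv_bracket b c) n)) m) =
    sv_at g t ((\<Sum>k\<le>m. sv_scale (of_nat ((m + n - k) choose n))
                (coeff (sv_bracket (coeff (sv_bracket a b) k) c) (m + n - k))) +
     coeff (sv_bracket b (coeff (sv_bracket a c) m)) n)"
    by (simp add: w_def u1_def u2_def u3_def sv_at_sum diff_eq_eq add.commute)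
qed

interpretation SV: lie_conformal_algebra sv_scale sv_D sv_bracket
proof -
  show "lie_conformal_algebra sv_scale sv_D sv_bracket"
  proof (rule lie_conformal_algebra.intro[OF vector_space_sv], rule lie_conformal_algebra_axioms.intro)
    fix a b c :: sv and k m n :: nat
    show "Vector_Spaces.linear sv_scale sv_scale sv_D"
      by (rule linear_svI) (auto intro!: sv_at_eqI simp: algebra_simps)
    show "Vector_Spaces.linear sv_scale sv_scale (\<lambda>a. coeff (sv_bracket a b) k)"
      "Vector_Spaces.linear sv_scale sv_scale (\<lambda>b. coeff (sv_bracket a b) k)"
      by (rule linear_svI; simp add: sv_bracket_linear coeff_map_poly)+
  qed (rule sv_sesquilinear sv_skew sv_jacobi)+
qed


subsection \<open>Cochains given by their values on generators\<close>

text \<open>\<open>is_cochain_given_by gs p \<gamma>\<close>: \<open>\<gamma>\<close> is the unique cochain with value \<open>p\<close> on the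
  tuple of generators \<open>gs\<close> that vanishes on every tuple of generators of the same length which is not a
  permutation of \<open>gs\<close>.\<close>

definition is_cochain_given_by :: "sv_gen list \<Rightarrow> lpoly \<Rightarrow> (sv list \<Rightarrow> lpoly) \<Rightarrow> bool" where
  "is_cochain_given_by gs p \<gamma> \<longleftrightarrow>
     (let P = (\<lambda>\<delta>. \<delta> \<in> SV.cochains (length gs) \<and> \<delta> (map gen gs) = p \<and>
            (\<forall>hs. length hs = length gs \<and> mset hs \<noteq> mset gs \<longrightarrow> \<delta> (map gen hs) = 0))
      in P \<gamma> \<and> (\<forall>\<delta>. P \<delta> \<longrightarrow> \<delta> = \<gamma>))"

end

theory Submission
  imports Defs "HOL-Library.Sublist"
begin

text \<open>Expanding a cochain in powers of the $\lambda_i$ identifies the basic complex with the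
  complex of finitely supported alternating cochains of the annihilation Lie algebra, which has the
  basis $L_m$ ($m \ge -1$), $Y_r$ ($r \ge -1/2$), $M_m$ ($m \ge 0$) and brackets
  $[L_m, L_n] = (m - n)L_{m+n}$, $[L_m, Y_r] = (m/2 - r)Y_{m+r}$, $[L_m, M_n] = -nM_{m+n}$,
  $[Y_r, Y_s] = (r - s)M_{r+s}$. The Lie derivative along $L_0$ is homotopic to 0 and acts as
  multiplication by the weight, so only cochains of weight 0 contribute. Since $L_{-1}$ and
  $Y_{-1/2}$ are the only basis vectors of negative weight, the weight 0 complex has a basis of 28
  exterior monomials, and there the cohomology is elementary linear algebra.\<close>

section \<open>The annihilation algebra\<close>

text \<open>The two descriptions of the complex serve different purposes. On functions of mode
  lists, Cartan's recursion turns d^2 = 0, invariance and the homotopy into inductions on lists. The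
  differential of the \<lambda>-complex is never squared, and its skew-symmetry is never checked
  directly: a multilinear map with polynomial values is determined by its coefficients, and those of
  the differential are \<open>cd\<close> of the coefficients of the cochain, which is alternating.
  The two sides meet in one coefficient comparison. Inside the differential \<partial> becomes
  -(\<lambda>_i + \<lambda>_j), so a bracket of generators becomes a linear form a \<lambda>_i + b
  \<lambda>_j, and substituting into a power of the first variable produces binomial coefficients.
  With coefficients scaled by factorials the binomials disappear and the structure constant a k + b
  l remains. Finite support, the counterpart of polynomial values, has to survive the homotopy:
  dividing by eigenvalues and contracting with L_0 both keep the bound on the indices.\<close>

text \<open>The pair \<open>(g, k)\<close> is the mode of $g$ dual to $\lambda^k/k!$. For $k = 0, 1, \ldots$ the modes
  \<open>(L, k)\<close>, \<open>(Y, k)\<close>, \<open>(M, k)\<close> are $L_{k-1}$, $Y_{k-1/2}$, $M_k$. The bracket of the modes \<open>x\<close> and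
  \<open>y\<close> is \<open>mcoef x y\<close> times \<open>mprod x y\<close>; the truncated subtraction in \<open>mprod\<close> is harmless because the
  coefficient vanishes when both indices are 0.\<close>

type_synonym mode = "sv_gen \<times> nat"

fun gprod :: "sv_gen \<Rightarrow> sv_gen \<Rightarrow> sv_gen" where
  "gprod L g = g"
| "gprod g L = g"
| "gprod _ _ = M"

text \<open>\<open>lcoef\<close> and \<open>rcoef\<close> are the coefficients a and b of the linear
  form a \<lambda>_i + b \<lambda>_j obtained from a bracket of generators by putting -(\<lambda>_i
  + \<lambda>_j) for \<partial> and \<lambda>_i for \<lambda>. For L and Y, \<partial> + 3/2
  \<lambda> becomes 1/2 \<lambda>_i - \<lambda>_j.\<close>

fun lcoef :: "sv_gen \<Rightarrow> sv_gen \<Rightarrow> complex" where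
  "lcoef L L = 1"
| "lcoef L Y = 1/2"
| "lcoef Y L = 1"
| "lcoef Y Y = 1"
| "lcoef M L = 1"
| "lcoef _ _ = 0"

fun rcoef :: "sv_gen \<Rightarrow> sv_gen \<Rightarrow> complex" where
  "rcoef L L = -1"
| "rcoef L Y = -1"
| "rcoef Y L = -1/2"
| "rcoef Y Y = -1"
| "rcoef L M = -1"
| "rcoef _ _ = 0"

definition mprod :: "mode \<Rightarrow> mode \<Rightarrow> mode" where
  "mprod x y = (gprod (fst x) (fst y), snd x + snd y - 1)"

definition mcoef :: "mode \<Rightarrow> mode \<Rightarrow> complex" where
  "mcoef x y = lcoef (fst x) (fst y) * of_nat (snd x) + rcoef (fst x) (fst y) * of_nat (snd y)"

lemma mprod_commute: "mprod x y = mprod y x"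
  by (cases "fst x"; cases "fst y") (simp_all add: mprod_def add.commute)

lemma mcoef_antisym: "mcoef x y = - mcoef y x"
  by (cases "fst x"; cases "fst y") (simp_all add: mcoef_def)

text \<open>The three iterated products have the same generator, and the same index k + l + m - 2
  wherever their coefficients are nonzero; elsewhere truncation can separate them. Pairing with an
  arbitrary \<open>F\<close> keeps the Jacobi identity valid in both situations.\<close>

lemma mode_jacobi:
  "mcoef y z * mcoef x (mprod y z) * F (mprod x (mprod y z)) -
   mcoef x z * mcoef y (mprod x z) * F (mprod y (mprod x z)) =
   mcoef x y * mcoef (mprod x y) z * F (mprod (mprod x y) z)"
proof -
  obtain g k h l i m where xyz: "x = (g, k)" "y = (h, l)" "z = (i, m)"
    by (cases x; cases y; cases z)
  have a: "a + Suc b - 1 = a + b" "Suc a + b - 1 = a + b" for a b by simp_all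
  show ?thesis
    unfolding xyz
    by (cases g; cases h; cases i; cases k; cases l; cases m)
      (simp_all add: mprod_def mcoef_def a, simp_all add: field_simps)
qed


section \<open>Cochains of the annihilation algebra\<close>

text \<open>A cochain is a function on lists of modes. The recursion for \<open>cd\<close> is Cartan's formula: the
  contraction of \<open>cd f\<close> with \<open>x\<close> is the Lie derivative of \<open>f\<close> along \<open>x\<close> minus the differential of
  the contraction of \<open>f\<close>.\<close>

fun theta :: "mode \<Rightarrow> (mode list \<Rightarrow> complex) \<Rightarrow> mode list \<Rightarrow> complex" where
  "theta x f [] = 0"
| "theta x f (y # ys) = theta x (\<lambda>zs. f (y # zs)) ys - mcoef x y * f (mprod x y # ys)"

fun cd :: "(mode list \<Rightarrow> complex) \<Rightarrow> mode list \<Rightarrow> complex" where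
  "cd f [] = 0"
| "cd f (x # xs) = theta x f xs - cd (\<lambda>ys. f (x # ys)) xs"

section \<open>Cartan calculus\<close>

lemma theta_lincomb:
  "theta x (\<lambda>zs. a * f zs + b * g zs) ys = a * theta x f ys + b * theta x g ys"
  by (induction ys arbitrary: f g) (simp_all add: algebra_simps)

lemma theta_linear:
  "theta x (\<lambda>zs. f zs + g zs) ys = theta x f ys + theta x g ys"
  "theta x (\<lambda>zs. f zs - g zs) ys = theta x f ys - theta x g ys"
  "theta x (\<lambda>zs. a * f zs) ys = a * theta x f ys"
  "theta x (\<lambda>zs. - f zs) ys = - theta x f ys"
  "theta x (\<lambda>zs. 0) ys = 0"
  using theta_lincomb[of x 1 f 1 g ys] theta_lincomb[of x 1 f "-1" g ys]
    theta_lincomb[of x a f 0 f ys] theta_lincomb[of x "-1" f 0 f ys] theta_lincomb[of x 0 f 0 f ys]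
  by simp_all

lemma cd_lincomb:
  "cd (\<lambda>zs. a * f zs + b * g zs) ys = a * cd f ys + b * cd g ys"
  by (induction ys arbitrary: f g) (simp_all add: theta_lincomb algebra_simps)

lemma cd_linear:
  "cd (\<lambda>zs. f zs + g zs) ys = cd f ys + cd g ys"
  "cd (\<lambda>zs. f zs - g zs) ys = cd f ys - cd g ys"
  "cd (\<lambda>zs. a * f zs) ys = a * cd f ys"
  "cd (\<lambda>zs. - f zs) ys = - cd f ys"
  "cd (\<lambda>zs. 0) ys = 0"
  using cd_lincomb[of 1 f 1 g ys] cd_lincomb[of 1 f "-1" g ys]
    cd_lincomb[of a f 0 f ys] cd_lincomb[of "-1" f 0 f ys] cd_lincomb[of 0 f 0 f ys]
  by simp_all

text \<open>At the head of the list this is the Jacobi identity of the modes, on the tail it is the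
  induction hypothesis for the contraction with the head; the mixed terms cancel.\<close>

lemma theta_bracket:
  "theta x (theta y f) zs - theta y (theta x f) zs = mcoef x y * theta (mprod x y) f zs"
proof (induction zs arbitrary: f)
  case (Cons z zs)
  show ?case
    using Cons[of "\<lambda>zs. f (z # zs)"] mode_jacobi[of y z x "\<lambda>u. f (u # zs)"]
    by (simp add: theta_linear algebra_simps)
qed simp

text \<open>Contracting with the head y and applying Cartan's formula leaves the commutator of
  \<theta>_x and \<theta>_y against \<theta> of [x, y], because \<theta>_x commutes with contraction
  by y up to contraction by [x, y].\<close>

lemma theta_cd: "theta x (cd f) ys = cd (theta x f) ys"
proof (induction ys arbitrary: f)
  case (Cons y ys)
  show ?case
    using Cons[of "\<lambda>zs. f (y # zs)"] theta_bracket[of x y f ys]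
    by (simp add: theta_linear cd_linear algebra_simps)
qed simp

text \<open>The contraction of d d f with x is \<theta>_x d f - d \<theta>_x f plus d d of the
  contracted f. The first two terms cancel by \<open>theta_cd\<close>; the last is evaluated on a
  shorter list.\<close>

lemma cd_cd: "cd (cd f) xs = 0"
proof (induction xs arbitrary: f)
  case (Cons x xs)
  show ?case
    using Cons[of "\<lambda>zs. f (x # zs)"] theta_cd[of x f xs]
    by (simp add: cd_linear)
qed simp

section \<open>Alternating functions\<close>

definition alternating :: "(mode list \<Rightarrow> complex) \<Rightarrow> bool" where
  "alternating f \<longleftrightarrow> (\<forall>us x y vs. f (us @ x # y # vs) = - f (us @ y # x # vs))"

lemma alternatingD: "alternating f \<Longrightarrow> f (us @ x # y # vs) = - f (us @ y # x # vs)"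
  unfolding alternating_def by blast

lemma alternating_contract: "alternating f \<Longrightarrow> alternating (\<lambda>xs. f (x # xs))"
  unfolding alternating_def by (metis append_Cons)

lemma alternating_lincomb:
  assumes "alternating f" and "alternating g"
  shows "alternating (\<lambda>xs. a * f xs + b * g xs)"
  unfolding alternating_def
proof (intro allI)
  fix us x y vs
  show "a * f (us @ x # y # vs) + b * g (us @ x # y # vs) =
      - (a * f (us @ y # x # vs) + b * g (us @ y # x # vs))"
    using assms[THEN alternatingD, of us x y vs] by simp
qed

lemma theta_swap:
  assumes "alternating f"
  shows "theta x f (us @ a # b # vs) = - theta x f (us @ b # a # vs)"
  using assms
proof (induction us arbitrary: f)
  case Nil
  have sw: "f (u # v # ws) = - f (v # u # ws)" for u v ws
    using alternatingD[OF Nil, of "[]" u v ws] by simp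
  have "(\<lambda>zs. f (a # b # zs)) = (\<lambda>zs. - f (b # a # zs))"
    by (rule ext) (rule sw)
  then have "theta x (\<lambda>zs. f (a # b # zs)) vs = - theta x (\<lambda>zs. f (b # a # zs)) vs"
    by (simp add: theta_linear)
  then show ?case
    using sw[of "mprod x a" b vs] sw[of "mprod x b" a vs] by (simp add: theta_linear)
next
  case (Cons u us)
  have "f (v # us @ a # b # vs) = - f (v # us @ b # a # vs)" for v
    using alternatingD[OF Cons.prems, of "v # us" a b vs] by simp
  then show ?case
    using Cons.IH[OF alternating_contract[OF Cons.prems]] by simp
qed

text \<open>Two steps of the recursion give \<theta>_a of the contraction with b, minus \<theta>_b
  of the contraction with a, a bracket term and a double contraction. Exchanging a and b exchanges
  the first two with opposite signs; the other two change sign by antisymmetry of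
  \<open>mcoef\<close> and of f.\<close>

lemma cd_swap:
  assumes "alternating f"
  shows "cd f (us @ a # b # vs) = - cd f (us @ b # a # vs)"
  using assms
proof (induction us arbitrary: f)
  case Nil
  have sw: "f (u # v # ws) = - f (v # u # ws)" for u v ws
    using alternatingD[OF Nil, of "[]" u v ws] by simp
  have "(\<lambda>zs. f (a # b # zs)) = (\<lambda>zs. - f (b # a # zs))"
    by (rule ext) (rule sw)
  then have "cd (\<lambda>zs. f (a # b # zs)) vs = - cd (\<lambda>zs. f (b # a # zs)) vs"
    by (simp add: cd_linear)
  then show ?case
    by (simp add: cd_linear mprod_commute[of b a] mcoef_antisym[of b a])
next
  case (Cons u us)
  show ?case
    using Cons.IH[OF alternating_contract[OF Cons.prems]] theta_swap[OF Cons.prems, of u us a b vs] by simp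
qed

lemma alternating_cd: "alternating f \<Longrightarrow> alternating (cd f)"
  unfolding alternating_def[of "cd f"] using cd_swap by blast

lemma alternating_move:
  assumes "alternating f"
  shows "f (z # us @ vs) = (-1) ^ length us * f (us @ z # vs)"
  using assms
proof (induction us arbitrary: f)
  case (Cons u us)
  show ?case
    using alternatingD[OF Cons.prems, of "[]" z u "us @ vs"]
      Cons.IH[OF alternating_contract[OF Cons.prems]] by simp
qed simp

lemma theta_sum:
  "theta x f ys = - (\<Sum>j<length ys. mcoef x (ys ! j) * f (ys[j := mprod x (ys ! j)]))"
  by (induction ys arbitrary: f) (simp_all add: sum.lessThan_Suc_shift del: sum.lessThan_Suc)

lemma map_nth_filter_neq:
  assumes "j < length xs"
  shows "map ((!) xs) (filter (\<lambda>k. k \<noteq> j) [0..<length xs]) = take j xs @ drop (Suc j) xs"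
proof -
  have "[0..<length xs] = [0..<j] @ j # [Suc j..<length xs]"
    using assms upt_add_eq_append[of 0 j "length xs - j"] by (simp add: upt_conv_Cons)
  moreover have "filter (\<lambda>k. k \<noteq> j) [0..<j] = [0..<j]"
    "filter (\<lambda>k. k \<noteq> j) [Suc j..<length xs] = [Suc j..<length xs]"
    by (simp_all add: filter_id_conv)
  moreover have "map ((!) xs) [0..<j] = take j xs"
    by (rule nth_equalityI) (use assms in simp_all)
  moreover have "map ((!) xs) [Suc j..<length xs] = drop (Suc j) xs"
    by (rule nth_equalityI) (use assms in simp_all)
  ultimately show ?thesis
    by simp
qed

text \<open>The terms with i = 0 form the Lie derivative along the first argument: moving the
  bracket from the front to position j costs (-1)^j. The terms with i > 0 are the formula for the
  contraction, and moving the first argument past the bracket gives the minus sign of the recursion.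
  In this closed form \<open>cd\<close> can be compared with the differential of the
  \<lambda>-complex.\<close>

lemma cd_sum:
  assumes "alternating f"
  shows "cd f xs = (\<Sum>j<length xs. \<Sum>i<j. (-1) ^ (i + j) * (mcoef (xs ! i) (xs ! j) *
     f (mprod (xs ! i) (xs ! j) #
        map ((!) xs) (filter (\<lambda>k. k \<noteq> i \<and> k \<noteq> j) [0..<length xs]))))"
  using assms
proof (induction xs arbitrary: f)
  case (Cons x xs)
  let ?n = "length xs"
  have upt: "[0..<Suc ?n] = 0 # map Suc [0..<?n]"
    by (simp add: map_Suc_upt upt_conv_Cons del: upt_Suc)
  have f0: "map ((!) (x # xs)) (filter (\<lambda>k. k \<noteq> 0 \<and> k \<noteq> Suc j) [0..<Suc ?n]) =
      take j xs @ drop (Suc j) xs" if "j < ?n" for j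
    using map_nth_filter_neq[OF that] unfolding upt by (simp add: filter_map o_def)
  have fS: "map ((!) (x # xs)) (filter (\<lambda>k. k \<noteq> Suc i \<and> k \<noteq> Suc j) [0..<Suc ?n]) =
      x # map ((!) xs) (filter (\<lambda>k. k \<noteq> i \<and> k \<noteq> j) [0..<?n])" for i j
    unfolding upt by (simp add: filter_map o_def)
  have move: "f (z # take j xs @ drop (Suc j) xs) = (-1) ^ j * f (xs[j := z])" if "j < ?n" for z j
    using alternating_move[OF Cons.prems, of z "take j xs" "drop (Suc j) xs"] that
    by (simp add: upd_conv_take_nth_drop)
  have sw: "f (u # v # ws) = - f (v # u # ws)" for u v ws
    using alternatingD[OF Cons.prems, of "[]" u v ws] by simp
  define t where "t i j = (-1) ^ (i + j) * (mcoef ((x # xs) ! i) ((x # xs) ! j) *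
     f (mprod ((x # xs) ! i) ((x # xs) ! j) #
        map ((!) (x # xs)) (filter (\<lambda>k. k \<noteq> i \<and> k \<noteq> j) [0..<Suc ?n])))" for i j
  have t0: "t 0 (Suc j) = - (mcoef x (xs ! j) * f (xs[j := mprod x (xs ! j)]))" if "j < ?n" for j
  proof -
    have "(-1) ^ Suc j * (c * ((-1) ^ j * v)) = - ((-1) ^ j * (-1) ^ j) * (c * v)" for c v :: complex
      by (simp only: power_Suc mult_ac mult_minus_left mult_minus_right mult_1_left)
    then have sgn: "(-1) ^ Suc j * (c * ((-1) ^ j * v)) = - (c * v)" for c v :: complex
      by (simp only: minus_one_mult_self mult_minus_left mult_1_left)
    show ?thesis
      unfolding t_def f0[OF that] nth_Cons_Suc nth_Cons_0 move[OF that] add_0 sgn ..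
  qed
  have tS: "t (Suc i) (Suc j) = - ((-1) ^ (i + j) * (mcoef (xs ! i) (xs ! j) *
      f (x # mprod (xs ! i) (xs ! j) # map ((!) xs) (filter (\<lambda>k. k \<noteq> i \<and> k \<noteq> j) [0..<?n]))))"
    for i j
    unfolding t_def fS nth_Cons_Suc
    by (subst sw) (simp only: add_Suc add_Suc_right power_Suc mult_minus_left mult_minus_right mult_1_left minus_minus)
  have "(\<Sum>j<Suc ?n. \<Sum>i<j. t i j) =
    (\<Sum>j<?n. t 0 (Suc j) + (\<Sum>i<j. t (Suc i) (Suc j)))"
    unfolding sum.lessThan_Suc_shift by simp
  also have "\<dots> = cd f (x # xs)"
    by (simp add: t0 tS theta_sum sum_subtractf sum_negf
        Cons.IH[OF alternating_contract[OF Cons.prems]])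
  finally show ?case by (simp add: t_def del: upt_Suc)
qed simp

section \<open>Grading by weight, and finitely supported cochains\<close>

fun weight :: "mode \<Rightarrow> int" where
  "weight (L, k) = 2 * int k - 2"
| "weight (Y, k) = 2 * int k - 1"
| "weight (M, k) = 2 * int k"

text \<open>The mode \<open>(L, 1)\<close> is L_0. Here \<open>mprod (L, 1) x\<close> is x and
  \<open>mcoef (L, 1) x\<close> is minus half of \<open>weight x\<close>, so the Lie derivative is
  diagonal.\<close>

lemma theta_L0: "theta (L, 1) f xs = of_int (sum_list (map weight xs)) / 2 * f xs"
proof (induction xs arbitrary: f)
  case (Cons x xs)
  obtain g k where x: "x = (g, k)" by (cases x)
  show ?case
    using Cons[of "\<lambda>zs. f (x # zs)"] unfolding x
    by (cases g) (simp_all add: mcoef_def mprod_def field_simps)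
qed simp

text \<open>As the length is fixed and there are three generators, the index bound \<open>N\<close>
  amounts to finite support; it is the counterpart of polynomial values.\<close>

definition mcochains :: "nat \<Rightarrow> (mode list \<Rightarrow> complex) set" where
  "mcochains n = {f. alternating f \<and>
     (\<exists>N. \<forall>xs. f xs \<noteq> 0 \<longrightarrow> length xs = n \<and> (\<forall>x\<in>set xs. snd x \<le> N))}"

lemma mcochainsD:
  assumes "f \<in> mcochains n"
  shows "alternating f" and "length xs \<noteq> n \<Longrightarrow> f xs = 0"
  using assms by (auto simp: mcochains_def)

lemma mcochains_lincomb:
  assumes "f \<in> mcochains n" and "g \<in> mcochains n"
  shows "(\<lambda>xs. a * f xs + b * g xs) \<in> mcochains n"
proof -
  obtain N1 N2 where
    "\<forall>xs. f xs \<noteq> 0 \<longrightarrow> length xs = n \<and> (\<forall>x\<in>set xs. snd x \<le> N1)"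
    "\<forall>xs. g xs \<noteq> 0 \<longrightarrow> length xs = n \<and> (\<forall>x\<in>set xs. snd x \<le> N2)"
    using assms by (auto simp: mcochains_def)
  then have "\<forall>xs. a * f xs + b * g xs \<noteq> 0 \<longrightarrow>
      length xs = n \<and> (\<forall>x\<in>set xs. snd x \<le> max N1 N2)"
    by (metis add.right_neutral le_max_iff_disj mult_zero_right)
  then show ?thesis
    using assms alternating_lincomb unfolding mcochains_def by blast
qed

lemma mcochains_zero: "(\<lambda>xs. 0) \<in> mcochains n"
  by (simp add: mcochains_def alternating_def)

lemma mcochains_sum:
  "(\<And>i. i \<in> A \<Longrightarrow> h i \<in> mcochains n) \<Longrightarrow> (\<lambda>xs. \<Sum>i\<in>A. c i * h i xs) \<in> mcochains n"
proof (induction A rule: infinite_finite_induct)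
  case (insert i A)
  then show ?case
    using mcochains_lincomb[of "h i" n "\<lambda>xs. \<Sum>i\<in>A. c i * h i xs" "c i" 1] by simp
qed (simp_all add: mcochains_zero)

lemma mcochains_contract:
  assumes "f \<in> mcochains (Suc n)"
  shows "(\<lambda>xs. f (x # xs)) \<in> mcochains n"
proof -
  obtain N where N: "\<forall>xs. f xs \<noteq> 0 \<longrightarrow> length xs = Suc n \<and> (\<forall>x\<in>set xs. snd x \<le> N)"
    using assms by (auto simp: mcochains_def)
  then have "\<forall>xs. f (x # xs) \<noteq> 0 \<longrightarrow> length xs = n \<and> (\<forall>x\<in>set xs. snd x \<le> N)"
    by fastforce
  then show ?thesis
    using assms alternating_contract unfolding mcochains_def by blast
qed

lemma mcochains_cd:
  assumes "f \<in> mcochains n"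
  shows "cd f \<in> mcochains (Suc n)"
proof -
  obtain N where N: "\<And>xs. f xs \<noteq> 0 \<Longrightarrow> length xs = n \<and> (\<forall>x\<in>set xs. snd x \<le> N)"
    using assms by (auto simp: mcochains_def)
  have alt: "alternating f"
    using assms by (rule mcochainsD)
  \<comment> \<open>The bracket of modes with indices k and l has index k + l - 1, so a bound
    \<open>N\<close> for the bracket allows \<open>Suc N\<close> for its arguments.\<close>
  have "length xs = Suc n \<and> (\<forall>x\<in>set xs. snd x \<le> Suc N)" if nz: "cd f xs \<noteq> 0" for xs
  proof -
    let ?r = "\<lambda>i j. filter (\<lambda>k. k \<noteq> i \<and> k \<noteq> j) [0..<length xs]"
    have "\<exists>i j. i < j \<and> j < length xs \<and>
        f (mprod (xs ! i) (xs ! j) # map ((!) xs) (?r i j)) \<noteq> 0"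
    proof (rule ccontr)
      assume "\<not> ?thesis"
      then have "cd f xs = 0"
        unfolding cd_sum[OF alt] by (intro sum.neutral ballI) auto
      with nz show False by contradiction
    qed
    then obtain i j where ij: "i < j" "j < length xs"
      and *: "f (mprod (xs ! i) (xs ! j) # map ((!) xs) (?r i j)) \<noteq> 0"
      by blast
    note * = N[OF *]
    have "card (set (?r i j)) = card ({..<length xs} - {i, j})"
      by (rule arg_cong[of _ _ card]) auto
    also have "\<dots> = length xs - 2"
      using ij by (subst card_Diff_subset) auto
    finally have len: "length (?r i j) = length xs - 2"
      by (metis distinct_card distinct_filter distinct_upt)
    have "snd (xs ! k) \<le> Suc N" if k: "k < length xs" for k
    proof (cases "k = i \<or> k = j")
      case True
      then show ?thesis using * by (auto simp: mprod_def)
    next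
      case False
      then have "xs ! k \<in> set (map ((!) xs) (?r i j))" using k by auto
      then have "snd (xs ! k) \<le> N" using * by (meson list.set_intros(2))
      then show ?thesis by simp
    qed
    then have "\<forall>x\<in>set xs. snd x \<le> Suc N"
      by (metis in_set_conv_nth)
    moreover have "length xs = Suc n"
      using * len ij by auto
    ultimately show ?thesis by blast
  qed
  then show ?thesis
    using alternating_cd[OF alt] unfolding mcochains_def by blast
qed

text \<open>The sign of the permutation can stay undetermined because only vanishing of values is
  deduced from this.\<close>

lemma alternating_mset_eq:
  assumes "alternating f" and "mset xs = mset ys"
  shows "f xs = f ys \<or> f xs = - f ys"
  using assms
proof (induction xs arbitrary: f ys)
  case (Cons x xs)
  obtain us vs where ys: "ys = us @ x # vs"
    using Cons.prems(2) by (metis split_list union_single_eq_member mset.simps(2) set_mset_mset)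
  then have "mset xs = mset (us @ vs)"
    using Cons.prems(2) by simp
  then have "f (x # xs) = f (x # us @ vs) \<or> f (x # xs) = - f (x # us @ vs)"
    using Cons.IH[OF alternating_contract[OF Cons.prems(1)]] by blast
  moreover have "(-1 :: complex) ^ length us = 1 \<or> (-1 :: complex) ^ length us = -1"
    by (metis minus_one_power_iff)
  ultimately show ?case
    unfolding ys alternating_move[OF Cons.prems(1)] by auto
qed simp

lemma alternating_not_distinct:
  assumes "alternating f" and "\<not> distinct xs"
  shows "f xs = 0"
proof -
  obtain us vs ws x where xs: "xs = us @ [x] @ vs @ [x] @ ws"
    using not_distinct_decomp[OF assms(2)] by blast
  have "f (x # x # us @ vs @ ws) = 0"
    using alternatingD[OF assms(1), of "[]" x x "us @ vs @ ws"] by simp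
  then show ?thesis
    using alternating_mset_eq[OF assms(1), of xs "x # x # us @ vs @ ws"] by (auto simp: xs)
qed


section \<open>Reduction to weight 0\<close>

definition weight0 :: "(mode list \<Rightarrow> complex) \<Rightarrow> bool" where
  "weight0 f \<longleftrightarrow> (\<forall>xs. f xs \<noteq> 0 \<longrightarrow> sum_list (map weight xs) = 0)"

text \<open>Weight 0 means being annihilated by the Lie derivative along L_0, and this commutes with
  \<open>cd\<close>.\<close>

lemma weight0_cd:
  assumes "weight0 f"
  shows "weight0 (cd f)"
proof -
  have "theta (L, 1) f = (\<lambda>xs. 0)"
    using assms unfolding theta_L0 weight0_def by (intro ext) auto
  then have "theta (L, 1) (cd f) xs = 0" for xs
    unfolding theta_cd by (simp only: cd_linear)
  then show ?thesis
    unfolding theta_L0 weight0_def by auto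
qed

lemma weight0_lincomb:
  "weight0 f \<Longrightarrow> weight0 g \<Longrightarrow> weight0 (\<lambda>xs. a * f xs + b * g xs)"
  unfolding weight0_def by (metis add_0 mult_zero_right)

lemma sum_list_weight_mset: "mset xs = mset ys \<Longrightarrow> sum_list (map weight xs) = sum_list (map weight ys)"
  by (metis mset_map sum_mset_sum_list)

text \<open>Off weight 0, contraction with $L_0$ divided by the eigenvalue of its Lie derivative is a
  contracting homotopy.\<close>

lemma cocycle_weight0:
  assumes f: "f \<in> mcochains n" and closed: "cd f = (\<lambda>_. 0)"
  obtains f0 where "f0 \<in> mcochains n" "weight0 f0" "cd f0 = (\<lambda>_. 0)" "n = 0 \<Longrightarrow> f = f0"
    "\<And>m. n = Suc m \<Longrightarrow> \<exists>h\<in>mcochains m. f = (\<lambda>xs. f0 xs + cd h xs)"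
proof
  define w where "w xs = (of_int (sum_list (map weight xs)) / 2 :: complex)" for xs
  have w_mset: "w xs = w ys" if "mset xs = mset ys" for xs ys
    unfolding w_def using sum_list_weight_mset[OF that] by simp
  define f0 where "f0 xs = (if w xs = 0 then f xs else 0)" for xs
  \<comment> \<open>\<open>g\<close> solves \<open>theta (L, 1) g = f - f0\<close> and vanishes in
    weight 0.\<close>
  define g where "g xs = (if w xs = 0 then 0 else f xs / w xs)" for xs
  obtain N where N: "\<forall>xs. f xs \<noteq> 0 \<longrightarrow> length xs = n \<and> (\<forall>x\<in>set xs. snd x \<le> N)"
    using f by (auto simp: mcochains_def)
  have wsw: "w (us @ x # y # vs) = w (us @ y # x # vs)" for us x y vs
    by (rule w_mset) simp
  have fsw: "f (us @ x # y # vs) = - f (us @ y # x # vs)" for us x y vs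
    by (rule alternatingD[OF mcochainsD(1)[OF f]])
  have "alternating f0"
    unfolding alternating_def
  proof (intro allI)
    show "f0 (us @ x # y # vs) = - f0 (us @ y # x # vs)" for us x y vs
      using wsw[of us x y vs] fsw[of us x y vs] by (simp add: f0_def)
  qed
  with N show f0: "f0 \<in> mcochains n"
    unfolding mcochains_def by (auto simp: f0_def)
  have "alternating g"
    unfolding alternating_def
  proof (intro allI)
    show "g (us @ x # y # vs) = - g (us @ y # x # vs)" for us x y vs
      using wsw[of us x y vs] fsw[of us x y vs] by (simp add: g_def)
  qed
  with N have g: "g \<in> mcochains n"
    unfolding mcochains_def by (auto simp: g_def)
  show "weight0 f0"
    by (auto simp: weight0_def f0_def w_def)
  have th: "theta (L, 1) h xs = w xs * h xs" for h xs
    unfolding theta_L0 w_def ..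
  have fg: "f = (\<lambda>xs. f0 xs + theta (L, 1) g xs)"
    unfolding th by (auto simp: f0_def g_def)
  have tg: "theta (L, 1) g = (\<lambda>xs. f xs - f0 xs)"
    unfolding th by (auto simp: f0_def g_def)
  \<comment> \<open>The left side vanishes on lists of weight 0 and the right side on all others. So
    \<open>cd f0\<close> is 0, and \<open>cd g\<close> is 0 off weight 0.\<close>
  have 1: "w xs * cd g xs = - cd f0 xs" for xs
    unfolding th[symmetric] theta_cd tg cd_linear closed by simp
  have 2: "cd f0 xs \<noteq> 0 \<Longrightarrow> w xs = 0" for xs
    using weight0_cd[OF \<open>weight0 f0\<close>] by (simp add: weight0_def w_def)
  have 3: "cd f0 xs = 0" for xs
  proof (cases "w xs = 0")
    case True
    then show ?thesis using 1[of xs] by simp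
  next
    case False
    then show ?thesis using 2[of xs] by blast
  qed
  then show "cd f0 = (\<lambda>_. 0)" by blast
  \<comment> \<open>In weight 0 the equation above says nothing about \<open>cd g\<close>. Dividing
    by the eigenvalue once more makes g, and hence \<open>cd g\<close>, a Lie derivative along L_0,
    which has no weight 0 part.\<close>
  define g' where "g' xs = (if w xs = 0 then 0 else g xs / w xs)" for xs
  have "theta (L, 1) g' = g"
    unfolding th by (auto simp: g'_def g_def)
  then have "cd g xs = w xs * cd g' xs" for xs
    unfolding th[symmetric] theta_cd by simp
  then have cdg: "cd g xs = 0" for xs
    using 1[of xs] 3[of xs] by (cases "w xs = 0") simp_all
  show "f = f0" if "n = 0"
  proof
    fix xs
    show "f xs = f0 xs"
      using that f by (cases xs) (auto simp: f0_def w_def mcochainsD)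
  qed
  show "\<exists>h\<in>mcochains m. f = (\<lambda>xs. f0 xs + cd h xs)" if "n = Suc m" for m
  proof
    show "(\<lambda>xs. g ((L, 1) # xs)) \<in> mcochains m"
      using g that by (intro mcochains_contract) simp
    \<comment> \<open>Cartan's formula, in which the contraction of \<open>cd g\<close> drops
      out.\<close>
    have "theta (L, 1) g = cd (\<lambda>ys. g ((L, 1) # ys))"
      using cdg[of "(L, 1) # _"] unfolding cd.simps by (intro ext) simp
    with fg show "f = (\<lambda>xs. f0 xs + cd (\<lambda>xs. g ((L, 1) # xs)) xs)"
      by (simp only:)
  qed
qed

section \<open>The weight 0 complex\<close>

definition low_modes :: "mode list" where
  "low_modes = [(L, 0), (L, 1), (L, 2), (Y, 0), (Y, 1), (Y, 2), (M, 0), (M, 1)]"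

lemma weight_le_3_low_modes:
  assumes "weight x \<le> 3"
  shows "x \<in> set low_modes"
proof -
  obtain g k where x: "x = (g, k)" by (cases x)
  have "k \<le> 2" "g = M \<Longrightarrow> k \<le> 1"
    using assms unfolding x by (cases g; simp)+
  then have "k = 0 \<or> k = 1 \<or> k = 2" "g = M \<Longrightarrow> k = 0 \<or> k = 1"
    by auto
  then show ?thesis
    unfolding x low_modes_def by (cases g) auto
qed

text \<open>A subsequence of the duplicate-free list \<open>low_modes\<close> is a set of modes in a
  fixed order, so each exterior monomial of weight 0 has exactly one representative.\<close>

definition zlists :: "mode list list" where
  "zlists = filter (\<lambda>xs. sum_list (map weight xs) = 0) (subseqs low_modes)"

lemma zlists_eq: "zlists =
   [[(L, 0), (L, 1), (L, 2), (Y, 0), (Y, 1), (M, 0)],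
    [(L, 0), (L, 1), (L, 2), (Y, 0), (Y, 1)],
    [(L, 0), (L, 1), (L, 2), (M, 0)],
    [(L, 0), (L, 1), (L, 2)],
    [(L, 0), (L, 1), (Y, 0), (Y, 1), (M, 0), (M, 1)],
    [(L, 0), (L, 1), (Y, 0), (Y, 1), (M, 1)],
    [(L, 0), (L, 1), (Y, 0), (Y, 2), (M, 0)],
    [(L, 0), (L, 1), (Y, 0), (Y, 2)],
    [(L, 0), (L, 1), (M, 0), (M, 1)],
    [(L, 0), (L, 1), (M, 1)],
    [(L, 0), (L, 2), (Y, 0), (Y, 1), (M, 0)],
    [(L, 0), (L, 2), (Y, 0), (Y, 1)],
    [(L, 0), (L, 2), (M, 0)],
    [(L, 0), (L, 2)],
    [(L, 0), (Y, 0), (Y, 1), (M, 0), (M, 1)],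
    [(L, 0), (Y, 0), (Y, 1), (M, 1)],
    [(L, 0), (Y, 0), (Y, 2), (M, 0)],
    [(L, 0), (Y, 0), (Y, 2)],
    [(L, 0), (M, 0), (M, 1)],
    [(L, 0), (M, 1)],
    [(L, 1), (Y, 0), (Y, 1), (M, 0)],
    [(L, 1), (Y, 0), (Y, 1)],
    [(L, 1), (M, 0)],
    [(L, 1)],
    [(Y, 0), (Y, 1), (M, 0)],
    [(Y, 0), (Y, 1)],
    [(M, 0)],
    []]"
  by code_simp

lemma distinct_low_modes: "distinct low_modes"
  by code_simp

lemma zlists_distinct: "ys \<in> set zlists \<Longrightarrow> distinct ys"
  unfolding zlists_def using subseqs_distinctD[OF _ distinct_low_modes] by auto

lemma zlists_weight: "ys \<in> set zlists \<Longrightarrow> sum_list (map weight ys) = 0"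
  by (simp add: zlists_def)

lemma zlists_inj:
  assumes "ys \<in> set zlists" "zs \<in> set zlists" "mset ys = mset zs"
  shows "ys = zs"
proof -
  have "inj_on set (set (subseqs low_modes))"
    using distinct_set_subseqs[OF distinct_low_modes] by (simp add: distinct_map)
  then show ?thesis
    using assms(1,2) mset_eq_setD[OF assms(3)] unfolding zlists_def
    by (auto simp del: in_set_subseqs dest: inj_onD)
qed

text \<open>The modes of negative weight are $L_{-1}$ and $Y_{-1/2}$, so a set of modes of total weight 0
  contains no mode of weight above $3/2$ (\<open>weight\<close> takes twice the $L_0$-weight).\<close>

lemma zlists_complete:
  assumes "distinct xs" and "sum_list (map weight xs) = 0"
  shows "\<exists>ys\<in>set zlists. mset ys = mset xs"
proof -
  let ?neg = "{(L, 0), (Y, 0)}"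
  have nonneg: "0 \<le> weight x" if "x \<notin> ?neg" for x
    using that by (cases x; cases "fst x"; cases "snd x") auto
  have sum: "sum weight (set xs) = 0"
    using assms by (simp add: sum_list_distinct_conv_sum_set)
  have low: "x \<in> set low_modes" if x: "x \<in> set xs" for x
  proof (rule ccontr)
    assume nlow: "x \<notin> set low_modes"
    have "\<not> weight x \<le> 3"
      using weight_le_3_low_modes nlow by blast
    moreover have "x \<notin> ?neg"
      using nlow by (auto simp: low_modes_def)
    ultimately have w: "weight x > 3" "x \<notin> ?neg"
      by simp_all
    have "weight x \<le> sum weight (set xs - ?neg)"
      using x w nonneg by (intro member_le_sum) auto
    moreover have "sum weight (set xs) = sum weight (set xs - ?neg) + sum weight (set xs \<inter> ?neg)"
      by (metis List.finite_set add.commute sum.Int_Diff)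
    \<comment> \<open>All of \<open>?neg\<close> has weight -2 - 1 = -3, and leaving out members
      only raises the sum.\<close>
    moreover have "sum weight (set xs \<inter> ?neg) \<ge> -3"
    proof -
      have "sum weight ?neg = sum weight (?neg - set xs) + sum weight (?neg \<inter> set xs)"
        by (metis add.commute finite.emptyI finite.insertI sum.Int_Diff)
      moreover have "sum weight (?neg - set xs) \<le> 0"
        by (rule sum_nonpos) auto
      ultimately show ?thesis by (simp add: Int_commute)
    qed
    ultimately show False
      using sum w by linarith
  qed
  let ?ys = "filter (\<lambda>y. y \<in> set xs) low_modes"
  have "set ?ys = set xs" "distinct ?ys"
    using low distinct_low_modes by auto
  then have mset: "mset ?ys = mset xs"
    using assms(1) set_eq_iff_mset_eq_distinct by blast
  then have "sum_list (map weight ?ys) = 0"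
    using sum_list_weight_mset[OF mset] assms(2) by simp
  then have "?ys \<in> set zlists"
    unfolding zlists_def by simp
  with mset show ?thesis by blast
qed

text \<open>A nonzero value of the difference would occur on a duplicate-free list of weight 0. That
  list is a rearrangement of a member of \<open>zlists\<close>, where the difference vanishes, and
  rearranging changes at most the sign.\<close>

lemma weight0_eqI:
  assumes f: "f \<in> mcochains n" "weight0 f" and g: "g \<in> mcochains n" "weight0 g"
    and eq: "\<And>ys. ys \<in> set zlists \<Longrightarrow> length ys = n \<Longrightarrow> f ys = g ys"
  shows "f = g"
proof
  fix xs
  define h where "h xs = 1 * f xs + (-1) * g xs" for xs
  have h: "h \<in> mcochains n" "weight0 h"
    unfolding h_def using f g by (simp_all only: mcochains_lincomb weight0_lincomb)
  have "h xs = 0"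
  proof (rule ccontr)
    assume nz: "h xs \<noteq> 0"
    have alt: "alternating h" using mcochainsD(1)[OF h(1)] .
    have "distinct xs" "length xs = n"
      using nz alternating_not_distinct[OF alt, of xs] mcochainsD(2)[OF h(1), of xs] by auto
    moreover have "sum_list (map weight xs) = 0"
      using nz h(2) by (simp add: weight0_def)
    ultimately obtain ys where ys: "ys \<in> set zlists" "mset ys = mset xs"
      using zlists_complete by blast
    then have "length ys = n"
      using \<open>length xs = n\<close> by (metis size_mset)
    then have "h ys = 0"
      using eq[OF ys(1)] by (simp add: h_def)
    then show False
      using nz alternating_mset_eq[OF alt ys(2)] by simp
  qed
  then show "f xs = g xs" by (simp add: h_def)
qed

text \<open>\<open>dwedge y f\<close> is the exterior product of the dual vector of \<open>y\<close> with \<open>f\<close>.\<close>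

fun dwedge :: "mode \<Rightarrow> (mode list \<Rightarrow> complex) \<Rightarrow> mode list \<Rightarrow> complex" where
  "dwedge y f [] = 0"
| "dwedge y f (x # xs) = (if x = y then f xs else 0) - dwedge y (\<lambda>zs. f (x # zs)) xs"

fun dual :: "mode list \<Rightarrow> mode list \<Rightarrow> complex" where
  "dual [] = (\<lambda>xs. if xs = [] then 1 else 0)"
| "dual (y # ys) = dwedge y (dual ys)"

lemma dwedge_uminus: "dwedge y (\<lambda>zs. - f zs) xs = - dwedge y f xs"
  by (induction xs arbitrary: f) auto

lemma dwedge_swap:
  assumes "alternating f"
  shows "dwedge y f (us @ a # b # vs) = - dwedge y f (us @ b # a # vs)"
  using assms
proof (induction us arbitrary: f)
  case Nil
  have "(\<lambda>zs. f (a # b # zs)) = (\<lambda>zs. - f (b # a # zs))"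
  proof
    show "f (a # b # zs) = - f (b # a # zs)" for zs
      using alternatingD[OF Nil, of "[]" a b zs] by simp
  qed
  then have "dwedge y (\<lambda>zs. f (a # b # zs)) vs = - dwedge y (\<lambda>zs. f (b # a # zs)) vs"
    by (simp only: dwedge_uminus)
  then show ?case by simp
next
  case (Cons u us)
  show ?case
    using Cons.IH[OF alternating_contract[OF Cons.prems]] alternatingD[OF Cons.prems, of us a b vs]
    by simp
qed

lemma dwedge_support:
  assumes "\<And>zs. f zs \<noteq> 0 \<Longrightarrow> mset zs = A" and "dwedge y f xs \<noteq> 0"
  shows "mset xs = add_mset y A"
  using assms
proof (induction xs arbitrary: f A)
  case (Cons x xs)
  consider "x = y" "f xs \<noteq> 0" | "dwedge y (\<lambda>zs. f (x # zs)) xs \<noteq> 0"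
    using Cons.prems(2) by (cases "x = y"; cases "f xs = 0") auto
  then show ?case
  proof cases
    case 1
    then show ?thesis using Cons.prems(1) by auto
  next
    case 2
    have "x \<in># A"
    proof (rule ccontr)
      assume "x \<notin># A"
      \<comment> \<open>This contraction is identically 0. Written as equality with its own
        negative, the fact lets \<open>dwedge_uminus\<close> show that its \<open>dwedge\<close> is
        its own negative, hence 0.\<close>
      then have "(\<lambda>zs. f (x # zs)) = (\<lambda>zs. - f (x # zs))"
        using Cons.prems(1) by (intro ext) (metis minus_zero list.set_intros(1) set_mset_mset)
      then have "dwedge y (\<lambda>zs. f (x # zs)) xs = - dwedge y (\<lambda>zs. f (x # zs)) xs"
        by (metis (no_types) dwedge_uminus)
      with 2 show False by simp
    qed
    moreover have "mset xs = add_mset y (A - {#x#})"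
      using Cons.prems(1)[of "x # _"] by (intro Cons.IH[OF _ 2]) fastforce
    ultimately show ?thesis by simp
  qed
qed simp

lemma dual_support: "dual ys xs \<noteq> 0 \<Longrightarrow> mset xs = mset ys"
proof (induction ys arbitrary: xs)
  case (Cons y ys)
  have "mset xs = add_mset y (mset ys)"
    by (rule dwedge_support[of "dual ys"]) (use Cons in simp_all)
  then show ?case by simp
qed (simp split: if_splits)

lemma dual_self:
  assumes "distinct ys"
  shows "dual ys ys = 1"
  using assms
proof (induction ys)
  case (Cons y ys)
  have "(\<lambda>zs. dual ys (y # zs)) = (\<lambda>zs. - dual ys (y # zs))"
  proof
    fix zs
    have "dual ys (y # zs) = 0"
      using dual_support[of ys "y # zs"] Cons.prems
      by (metis distinct.simps(2) list.set_intros(1) mset_eq_setD)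
    then show "dual ys (y # zs) = - dual ys (y # zs)" by simp
  qed
  then have "dwedge y (\<lambda>zs. dual ys (y # zs)) ys = - dwedge y (\<lambda>zs. dual ys (y # zs)) ys"
    by (metis (no_types) dwedge_uminus)
  with Cons show ?case by simp
qed simp

lemma alternating_dual: "alternating (dual ys)"
proof (induction ys)
  case Nil
  show ?case by (simp add: alternating_def)
next
  case (Cons y ys)
  then show ?case
    unfolding dual.simps alternating_def[of "dwedge y (dual ys)"] using dwedge_swap by blast
qed

lemma dual_mcochains: "dual ys \<in> mcochains (length ys)"
proof -
  have "length xs = length ys \<and> (\<forall>x\<in>set xs. snd x \<le> Max (snd ` set ys))" if "dual ys xs \<noteq> 0" for xs
    using dual_support[OF that] by (metis List.finite_set Max_ge finite_imageI image_eqI mset_eq_setD size_mset)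
  then show ?thesis
    unfolding mcochains_def using alternating_dual by blast
qed

lemma weight0_dual: "sum_list (map weight ys) = 0 \<Longrightarrow> weight0 (dual ys)"
  unfolding weight0_def
proof (intro allI impI)
  show "sum_list (map weight xs) = 0" if "sum_list (map weight ys) = 0" "dual ys xs \<noteq> 0" for xs
    using sum_list_weight_mset[OF dual_support[OF that(2)]] that(1) by simp
qed

lemma dual_zlists:
  assumes "ys \<in> set zlists" and "zs \<in> set zlists"
  shows "dual ys zs = (if ys = zs then 1 else 0)"
proof (cases "ys = zs")
  case True
  then show ?thesis using dual_self[OF zlists_distinct[OF assms(1)]] by simp
next
  case False
  then have "mset zs \<noteq> mset ys"
    using zlists_inj[OF assms] by metis
  then have "dual ys zs = 0"
    using dual_support[of ys zs] by blast
  then show ?thesis using False by simp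
qed

text \<open>Interpolation with the dual vectors. Together with \<open>weight0_eqI\<close> it makes
  the values on \<open>zlists\<close> free coordinates of the weight 0 complex, so a primitive can
  be given by a table of values.\<close>

lemma obtain_weight0_mcochain:
  obtains h where "h \<in> mcochains n" "weight0 h"
    "\<And>ys. ys \<in> set zlists \<Longrightarrow> length ys = n \<Longrightarrow> h ys = g ys"
proof
  let ?A = "{ys \<in> set zlists. length ys = n}"
  let ?h = "\<lambda>xs. \<Sum>ys\<in>?A. g ys * dual ys xs"
  show "?h \<in> mcochains n"
    by (rule mcochains_sum) (use dual_mcochains in auto)
  show "weight0 ?h"
    unfolding weight0_def
  proof (intro allI impI)
    fix xs
    assume "?h xs \<noteq> 0"
    then obtain ys where ys: "ys \<in> ?A" "g ys * dual ys xs \<noteq> 0"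
      by (rule sum.not_neutral_contains_not_neutral)
    then have "mset xs = mset ys"
      by (intro dual_support) simp
    from sum_list_weight_mset[OF this] show "sum_list (map weight xs) = 0"
      using zlists_weight[of ys] ys by simp
  qed
  fix zs
  assume zs: "zs \<in> set zlists" "length zs = n"
  have "?h zs = (\<Sum>ys\<in>?A. if ys = zs then g zs else 0)"
  proof (rule sum.cong)
    show "g ys * dual ys zs = (if ys = zs then g zs else 0)" if "ys \<in> ?A" for ys
      using dual_zlists[of ys zs] that zs by simp
  qed simp
  then show "?h zs = g zs"
    using zs by simp
qed

section \<open>The matrix of the weight 0 differential and its cohomology\<close>

fun mode_key :: "mode \<Rightarrow> nat" where
  "mode_key (L, k) = k"
| "mode_key (Y, k) = k + 10"
| "mode_key (M, k) = k + 20"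

text \<open>Rewrite rules for a bubble sort into the order of \<open>low_modes\<close>.
  \<open>mode_key\<close> orients them; its offsets keep L, Y and M apart for the small indices that
  occur. Four adjacent swaps suffice because f is evaluated in \<open>cd_zlists\<close> on lists of
  length at most 5.\<close>

lemma alternating_sort:
  assumes "alternating f"
  shows "mode_key b < mode_key a \<Longrightarrow> f (a # b # r) = - f (b # a # r)"
    "mode_key b < mode_key a \<Longrightarrow> f (c # a # b # r) = - f (c # b # a # r)"
    "mode_key b < mode_key a \<Longrightarrow> f (c # d # a # b # r) = - f (c # d # b # a # r)"
    "mode_key b < mode_key a \<Longrightarrow> f (c # d # e # a # b # r) = - f (c # d # e # b # a # r)"
    "f (a # a # r) = 0" "f (c # a # a # r) = 0" "f (c # d # a # a # r) = 0"
    "f (c # d # e # a # a # r) = 0"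
  using alternatingD[OF assms, of "[]" a b r] alternatingD[OF assms, of "[c]" a b r]
    alternatingD[OF assms, of "[c, d]" a b r] alternatingD[OF assms, of "[c, d, e]" a b r]
    alternating_not_distinct[OF assms]
  by simp_all

text \<open>The rows of the differential in the coordinates \<open>zlists\<close>, one for each
  nonempty list. The spaces have dimensions 1, 2, 4, 7, 7, 5, 2 in degrees 0 to 6, and the maps
  between them have ranks 0, 2, 2, 4, 3, 0; this leaves cohomology of dimensions 1, 0, 0, 1, 0, 2,
  2.\<close>

lemma cd_zlists:
  assumes "alternating f"
  shows
    "cd f [(L, 1)] = 0"
    "cd f [(M, 0)] = 0"
    "cd f [(L, 0), (L, 2)] = 2 * f [(L, 1)]"
    "cd f [(L, 0), (M, 1)] = f [(M, 0)]"
    "cd f [(L, 1), (M, 0)] = 0"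
    "cd f [(Y, 0), (Y, 1)] = f [(M, 0)]"
    "cd f [(L, 0), (L, 1), (L, 2)] = 0"
    "cd f [(L, 0), (L, 1), (M, 1)] = f [(L, 1), (M, 0)]"
    "cd f [(L, 0), (L, 2), (M, 0)] = 2 * f [(L, 1), (M, 0)]"
    "cd f [(L, 0), (Y, 0), (Y, 2)] = 2 * f [(Y, 0), (Y, 1)] - 2 * f [(L, 0), (M, 1)]"
    "cd f [(L, 0), (M, 0), (M, 1)] = 0"
    "cd f [(L, 1), (Y, 0), (Y, 1)] = - f [(L, 1), (M, 0)]"
    "cd f [(Y, 0), (Y, 1), (M, 0)] = 0"
    "cd f [(L, 0), (L, 1), (L, 2), (M, 0)] = 0"
    "cd f [(L, 0), (L, 1), (Y, 0), (Y, 2)] = 2 * f [(L, 1), (Y, 0), (Y, 1)] + 2 * f [(L, 0), (L, 1), (M, 1)]"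
    "cd f [(L, 0), (L, 1), (M, 0), (M, 1)] = 0"
    "cd f [(L, 0), (L, 2), (Y, 0), (Y, 1)] = 2 * f [(L, 1), (Y, 0), (Y, 1)] + f [(L, 0), (L, 2), (M, 0)]"
    "cd f [(L, 0), (Y, 0), (Y, 1), (M, 1)] = - f [(L, 0), (M, 0), (M, 1)] + f [(Y, 0), (Y, 1), (M, 0)]"
    "cd f [(L, 0), (Y, 0), (Y, 2), (M, 0)] = 2 * f [(Y, 0), (Y, 1), (M, 0)] + 2 * f [(L, 0), (M, 0), (M, 1)]"
    "cd f [(L, 1), (Y, 0), (Y, 1), (M, 0)] = 0"
    "cd f [(L, 0), (L, 1), (L, 2), (Y, 0), (Y, 1)] = - f [(L, 0), (L, 1), (L, 2), (M, 0)]"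
    "cd f [(L, 0), (L, 1), (Y, 0), (Y, 1), (M, 1)] = f [(L, 0), (L, 1), (M, 0), (M, 1)] + f [(L, 1), (Y, 0), (Y, 1), (M, 0)]"
    "cd f [(L, 0), (L, 1), (Y, 0), (Y, 2), (M, 0)] = 2 * f [(L, 1), (Y, 0), (Y, 1), (M, 0)] - 2 * f [(L, 0), (L, 1), (M, 0), (M, 1)]"
    "cd f [(L, 0), (L, 2), (Y, 0), (Y, 1), (M, 0)] = 2 * f [(L, 1), (Y, 0), (Y, 1), (M, 0)]"
    "cd f [(L, 0), (Y, 0), (Y, 1), (M, 0), (M, 1)] = 0"
    "cd f [(L, 0), (L, 1), (L, 2), (Y, 0), (Y, 1), (M, 0)] = 0"
    "cd f [(L, 0), (L, 1), (Y, 0), (Y, 1), (M, 0), (M, 1)] = 0"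
  by (simp_all add: mcoef_def mprod_def numeral_2_eq_2 alternating_sort[OF assms])

text \<open>The dual vectors of these lists span the cohomology of the weight 0 complex. They are the
  leading terms of $\Phi$ in degree 3, of $\Lambda$ and $\Psi$ in degree 5, and of $\Omega$ and
  $\Theta$ in degree 6.\<close>

definition reps :: "nat \<Rightarrow> mode list list" where
  "reps n = (if n = 0 then [[]]
     else if n = 3 then [[(L, 0), (L, 1), (L, 2)]]
     else if n = 5 then [[(L, 0), (L, 1), (Y, 0), (Y, 1), (M, 1)],
       [(L, 0), (Y, 0), (Y, 1), (M, 0), (M, 1)]]
     else if n = 6 then [[(L, 0), (L, 1), (L, 2), (Y, 0), (Y, 1), (M, 0)],
       [(L, 0), (L, 1), (Y, 0), (Y, 1), (M, 0), (M, 1)]]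
     else [])"

lemma reps_zlists: "r \<in> set (reps n) \<Longrightarrow> r \<in> set zlists"
  and reps_length: "r \<in> set (reps n) \<Longrightarrow> length r = n"
  unfolding reps_def zlists_eq by (auto split: if_splits)

lemma zlists_length: "ys \<in> set zlists \<Longrightarrow> length ys \<le> 6"
  unfolding zlists_eq by auto

text \<open>On \<open>zlists\<close> each \<open>dual r\<close> is an indicator function, so the
  decomposition becomes one scalar equation per basis list. The sum runs over the list
  \<open>reps\<close> because that unfolds to explicit equations.\<close>

lemma weight0_cochain_eqI:
  assumes f: "f \<in> mcochains (Suc m)" "weight0 f" and h: "h \<in> mcochains m" "weight0 h"
    and eq: "\<And>ys. ys \<in> set zlists \<Longrightarrow> length ys = Suc m \<Longrightarrow>
      f ys = (\<Sum>r\<leftarrow>reps (Suc m). if r = ys then c r else 0) + cd h ys"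
  shows "f = (\<lambda>xs. (\<Sum>r\<in>set (reps (Suc m)). c r * dual r xs) + cd h xs)"
proof (rule weight0_eqI[OF f])
  let ?S = "\<lambda>xs. \<Sum>r\<in>set (reps (Suc m)). c r * dual r xs"
  have S: "?S \<in> mcochains (Suc m)"
    by (rule mcochains_sum) (metis dual_mcochains reps_length)
  have S0: "weight0 ?S"
    unfolding weight0_def
  proof (intro allI impI)
    fix xs
    assume "?S xs \<noteq> 0"
    then obtain r where r: "r \<in> set (reps (Suc m))" "c r * dual r xs \<noteq> 0"
      by (rule sum.not_neutral_contains_not_neutral)
    then have "mset xs = mset r"
      by (intro dual_support) simp
    from sum_list_weight_mset[OF this] show "sum_list (map weight xs) = 0"
      using zlists_weight[OF reps_zlists[OF r(1)]] by simp
  qed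
  show "(\<lambda>xs. ?S xs + cd h xs) \<in> mcochains (Suc m)"
    using mcochains_lincomb[OF S mcochains_cd[OF h(1)], of 1 1] by simp
  show "weight0 (\<lambda>xs. ?S xs + cd h xs)"
    using weight0_lincomb[OF S0 weight0_cd[OF h(2)], of 1 1] by simp
  fix ys
  assume ys: "ys \<in> set zlists" "length ys = Suc m"
  have "distinct (reps (Suc m))"
    by (simp add: reps_def)
  then have "(\<Sum>r\<leftarrow>reps (Suc m). if r = ys then c r else 0) = (\<Sum>r\<in>set (reps (Suc m)). if r = ys then c r else 0)"
    by (rule sum_list_distinct_conv_sum_set)
  also have "\<dots> = ?S ys"
  proof (rule sum.cong)
    show "(if r = ys then c r else 0) = c r * dual r ys" if "r \<in> set (reps (Suc m))" for r
      using dual_zlists[OF reps_zlists[OF that] ys(1)] by simp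
  qed simp
  finally show "f ys = ?S ys + cd h ys"
    using eq[OF ys] by simp
qed

text \<open>In each degree the primitive \<open>h\<close> is prescribed by coordinates
  \<open>g\<close>, found by solving rows of \<open>cd_zlists\<close> for \<open>h\<close>. The rows
  that depend on the solved ones either hold because f is closed or supply the coefficients
  \<open>c\<close>.\<close>

lemma weight0_cocycle_split:
  assumes f: "f \<in> mcochains (Suc m)" "weight0 f" and closed: "cd f = (\<lambda>_. 0)"
  shows "\<exists>c. \<exists>h\<in>mcochains m. f = (\<lambda>xs. (\<Sum>r\<in>set (reps (Suc m)). c r * dual r xs) + cd h xs)"
proof -
  note alt = mcochainsD(1)[OF f(1)]
  have cl: "cd f ys = 0" for ys
    using closed by simp
  have split: ?thesis if eq: "\<And>h. h \<in> mcochains m \<Longrightarrow> alternating h \<Longrightarrow>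
      (\<And>ys. ys \<in> set zlists \<Longrightarrow> length ys = m \<Longrightarrow> h ys = g ys) \<Longrightarrow>
      \<forall>ys\<in>set zlists. length ys = Suc m \<longrightarrow>
        f ys = (\<Sum>r\<leftarrow>reps (Suc m). if r = ys then c r else 0) + cd h ys" for g c
  proof -
    obtain h where h: "h \<in> mcochains m" "weight0 h"
      "\<And>ys. ys \<in> set zlists \<Longrightarrow> length ys = m \<Longrightarrow> h ys = g ys"
      using obtain_weight0_mcochain[of m g] by blast
    show ?thesis
      using weight0_cochain_eqI[OF f h(1,2), of c] eq[OF h(1) mcochainsD(1)[OF h(1)] h(3)] h(1) by blast
  qed
  consider "m = 0" | "m = 1" | "m = 2" | "m = 3" | "m = 4" | "m = 5" | "m \<ge> 6"
    by linarith
  then show ?thesis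
  proof cases
    case 1
    \<comment> \<open>In degree 1, closedness already forces both coordinates of f to be 0.\<close>
    have e: "cd f [(L, 0), (L, 2)] = 0"
      "cd f [(L, 0), (M, 1)] = 0"
      "cd f [(Y, 0), (Y, 1)] = 0"
      by (rule cl)+
    note e = e[unfolded cd_zlists[OF alt]]
    show ?thesis
    proof (rule split[where g = "\<lambda>_. 0" and c = "\<lambda>_. 0"])
      fix h
      assume h: "h \<in> mcochains m" "alternating h"
        and hv: "\<And>ys. ys \<in> set zlists \<Longrightarrow> length ys = m \<Longrightarrow>
          h ys = 0"
      show "\<forall>ys\<in>set zlists. length ys = Suc m \<longrightarrow> f ys =
          (\<Sum>r\<leftarrow>reps (Suc m). if r = ys then 0 else 0) + cd h ys"
        unfolding zlists_eq 1
        using e by (simp add: reps_def cd_zlists[OF h(2)] del: One_nat_def cd.simps theta.simps)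
    qed
  next
    case 2
    have e: "cd f [(L, 0), (L, 1), (M, 1)] = 0"
      "cd f [(L, 0), (L, 2), (M, 0)] = 0"
      "cd f [(L, 0), (Y, 0), (Y, 2)] = 0"
      "cd f [(L, 1), (Y, 0), (Y, 1)] = 0"
      by (rule cl)+
    note e = e[unfolded cd_zlists[OF alt]]
    \<comment> \<open>Degree 2: these solve \<open>cd h [(L, 0), (L, 2)] = 2 * h [(L, 1)]\<close>
      and \<open>cd h [(L, 0), (M, 1)] = h [(M, 0)]\<close>.\<close>
    let ?g = "(\<lambda>_. 0)(
      [(L, 1)] := f [(L, 0), (L, 2)] / 2,
      [(M, 0)] := f [(L, 0), (M, 1)])"
    show ?thesis
    proof (rule split[where g = ?g and c = "\<lambda>_. 0"])
      fix h
      assume h: "h \<in> mcochains m" "alternating h"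
        and hv: "\<And>ys. ys \<in> set zlists \<Longrightarrow> length ys = m \<Longrightarrow>
          h ys = ?g ys"
      have v: "h [(L, 1)] = f [(L, 0), (L, 2)] / 2"
        "h [(M, 0)] = f [(L, 0), (M, 1)]"
        by (subst hv; simp add: zlists_eq 2)+
      show "\<forall>ys\<in>set zlists. length ys = Suc m \<longrightarrow> f ys =
          (\<Sum>r\<leftarrow>reps (Suc m). if r = ys then 0 else 0) + cd h ys"
        unfolding zlists_eq 2
        using e by (simp add: reps_def cd_zlists[OF h(2)] v
          del: One_nat_def cd.simps theta.simps)
    qed
  next
    case 3
    have e: "cd f [(L, 0), (L, 1), (Y, 0), (Y, 2)] = 0"
      "cd f [(L, 0), (L, 2), (Y, 0), (Y, 1)] = 0"
      "cd f [(L, 0), (Y, 0), (Y, 1), (M, 1)] = 0"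
      "cd f [(L, 0), (Y, 0), (Y, 2), (M, 0)] = 0"
      by (rule cl)+
    note e = e[unfolded cd_zlists[OF alt]]
    \<comment> \<open>Degree 3: the free parameter \<open>h [(L, 0), (M, 1)]\<close> is set to 0;
      the two values come from the rows of \<open>[(L, 0), (L, 1), (M, 1)]\<close> and
      \<open>[(L, 0), (Y, 0), (Y, 2)]\<close>. The row of \<open>[(L, 0), (L, 1), (L, 2)]\<close> is
      0, so that coordinate of f passes to \<open>?c\<close>.\<close>
    let ?g = "(\<lambda>_. 0)(
      [(L, 1), (M, 0)] := f [(L, 0), (L, 1), (M, 1)],
      [(Y, 0), (Y, 1)] := f [(L, 0), (Y, 0), (Y, 2)] / 2)"
      and ?c = "(\<lambda>_. 0)(
      [(L, 0), (L, 1), (L, 2)] := f [(L, 0), (L, 1), (L, 2)])"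
    show ?thesis
    proof (rule split[where g = ?g and c = ?c])
      fix h
      assume h: "h \<in> mcochains m" "alternating h"
        and hv: "\<And>ys. ys \<in> set zlists \<Longrightarrow> length ys = m \<Longrightarrow>
          h ys = ?g ys"
      have v: "h [(L, 0), (M, 1)] = 0"
        "h [(L, 1), (M, 0)] = f [(L, 0), (L, 1), (M, 1)]"
        "h [(Y, 0), (Y, 1)] = f [(L, 0), (Y, 0), (Y, 2)] / 2"
        by (subst hv; simp add: zlists_eq 3)+
      show "\<forall>ys\<in>set zlists. length ys = Suc m \<longrightarrow> f ys =
          (\<Sum>r\<leftarrow>reps (Suc m). if r = ys then ?c r else 0) + cd h ys"
        unfolding zlists_eq 3
        using e by (simp add: reps_def cd_zlists[OF h(2)] v
          del: One_nat_def cd.simps theta.simps, auto simp: complex_eq_iff)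
    qed
  next
    case 4
    have e: "cd f [(L, 0), (L, 1), (L, 2), (Y, 0), (Y, 1)] = 0"
      "cd f [(L, 0), (L, 1), (Y, 0), (Y, 1), (M, 1)] = 0"
      "cd f [(L, 0), (L, 1), (Y, 0), (Y, 2), (M, 0)] = 0"
      "cd f [(L, 0), (L, 2), (Y, 0), (Y, 1), (M, 0)] = 0"
      by (rule cl)+
    note e = e[unfolded cd_zlists[OF alt]]
    \<comment> \<open>Degree 4: \<open>h [(L, 1), (Y, 0), (Y, 1)]\<close> is set to 0. For the last
      two values, the row of \<open>[(L, 0), (Y, 0), (Y, 1), (M, 1)]\<close> gives their difference
      and half the row of \<open>[(L, 0), (Y, 0), (Y, 2), (M, 0)]\<close> gives their sum.\<close>
    let ?g = "(\<lambda>_. 0)(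
      [(L, 0), (L, 1), (M, 1)] := f [(L, 0), (L, 1), (Y, 0), (Y, 2)] / 2,
      [(L, 0), (L, 2), (M, 0)] := f [(L, 0), (L, 2), (Y, 0), (Y, 1)],
      [(Y, 0), (Y, 1), (M, 0)] := (f [(L, 0), (Y, 0), (Y, 1), (M, 1)] + f [(L, 0), (Y, 0), (Y, 2), (M, 0)] / 2) / 2,
      [(L, 0), (M, 0), (M, 1)] := (f [(L, 0), (Y, 0), (Y, 2), (M, 0)] / 2 - f [(L, 0), (Y, 0), (Y, 1), (M, 1)]) / 2)"
    show ?thesis
    proof (rule split[where g = ?g and c = "\<lambda>_. 0"])
      fix h
      assume h: "h \<in> mcochains m" "alternating h"
        and hv: "\<And>ys. ys \<in> set zlists \<Longrightarrow> length ys = m \<Longrightarrow>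
          h ys = ?g ys"
      have v: "h [(L, 0), (L, 1), (M, 1)] = f [(L, 0), (L, 1), (Y, 0), (Y, 2)] / 2"
        "h [(L, 0), (L, 2), (M, 0)] = f [(L, 0), (L, 2), (Y, 0), (Y, 1)]"
        "h [(L, 0), (M, 0), (M, 1)] = (f [(L, 0), (Y, 0), (Y, 2), (M, 0)] / 2 - f [(L, 0), (Y, 0), (Y, 1), (M, 1)]) / 2"
        "h [(L, 1), (Y, 0), (Y, 1)] = 0"
        "h [(Y, 0), (Y, 1), (M, 0)] = (f [(L, 0), (Y, 0), (Y, 1), (M, 1)] + f [(L, 0), (Y, 0), (Y, 2), (M, 0)] / 2) / 2"
        by (subst hv; simp add: zlists_eq 4)+
      show "\<forall>ys\<in>set zlists. length ys = Suc m \<longrightarrow> f ys =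
          (\<Sum>r\<leftarrow>reps (Suc m). if r = ys then 0 else 0) + cd h ys"
        unfolding zlists_eq 4
        using e by (simp add: reps_def cd_zlists[OF h(2)] v
          del: One_nat_def cd.simps theta.simps, auto simp: complex_eq_iff field_simps)
    qed
  next
    case 5
    \<comment> \<open>Degree 5: three independent rows determine \<open>h\<close>. On coboundaries
      the row of \<open>[(L, 0), (L, 1), (Y, 0), (Y, 1), (M, 1)]\<close> equals that of
      \<open>[(L, 0), (L, 2), (Y, 0), (Y, 1), (M, 0)]\<close> minus half that of
      \<open>[(L, 0), (L, 1), (Y, 0), (Y, 2), (M, 0)]\<close>; the defect of f in this relation is
      the first coefficient in \<open>?c\<close>.\<close>
    let ?g = "(\<lambda>_. 0)(
      [(L, 0), (L, 1), (L, 2), (M, 0)] := - f [(L, 0), (L, 1), (L, 2), (Y, 0), (Y, 1)],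
      [(L, 1), (Y, 0), (Y, 1), (M, 0)] := f [(L, 0), (L, 2), (Y, 0), (Y, 1), (M, 0)] / 2,
      [(L, 0), (L, 1), (M, 0), (M, 1)] := f [(L, 0), (L, 2), (Y, 0), (Y, 1), (M, 0)] / 2 - f [(L, 0), (L, 1), (Y, 0), (Y, 2), (M, 0)] / 2)"
      and ?c = "(\<lambda>_. 0)(
      [(L, 0), (L, 1), (Y, 0), (Y, 1), (M, 1)] := f [(L, 0), (L, 1), (Y, 0), (Y, 1), (M, 1)] + f [(L, 0), (L, 1), (Y, 0), (Y, 2), (M, 0)] / 2 - f [(L, 0), (L, 2), (Y, 0), (Y, 1), (M, 0)],
      [(L, 0), (Y, 0), (Y, 1), (M, 0), (M, 1)] := f [(L, 0), (Y, 0), (Y, 1), (M, 0), (M, 1)])"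
    show ?thesis
    proof (rule split[where g = ?g and c = ?c])
      fix h
      assume h: "h \<in> mcochains m" "alternating h"
        and hv: "\<And>ys. ys \<in> set zlists \<Longrightarrow> length ys = m \<Longrightarrow>
          h ys = ?g ys"
      have v: "h [(L, 0), (L, 1), (L, 2), (M, 0)] = - f [(L, 0), (L, 1), (L, 2), (Y, 0), (Y, 1)]"
        "h [(L, 0), (L, 1), (M, 0), (M, 1)] = f [(L, 0), (L, 2), (Y, 0), (Y, 1), (M, 0)] / 2 - f [(L, 0), (L, 1), (Y, 0), (Y, 2), (M, 0)] / 2"
        "h [(L, 1), (Y, 0), (Y, 1), (M, 0)] = f [(L, 0), (L, 2), (Y, 0), (Y, 1), (M, 0)] / 2"
        by (subst hv; simp add: zlists_eq 5)+
      show "\<forall>ys\<in>set zlists. length ys = Suc m \<longrightarrow> f ys =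
          (\<Sum>r\<leftarrow>reps (Suc m). if r = ys then ?c r else 0) + cd h ys"
        unfolding zlists_eq 5
        using h by (simp add: reps_def cd_zlists[OF h(2)] v
          del: One_nat_def cd.simps theta.simps)
    qed
  next
    case 6
    \<comment> \<open>Degree 6: the weight 0 differential into this degree is 0, so the coefficients
      are the coordinates of f.\<close>
    let ?c = "(\<lambda>_. 0)(
      [(L, 0), (L, 1), (L, 2), (Y, 0), (Y, 1), (M, 0)] := f [(L, 0), (L, 1), (L, 2), (Y, 0), (Y, 1), (M, 0)],
      [(L, 0), (L, 1), (Y, 0), (Y, 1), (M, 0), (M, 1)] := f [(L, 0), (L, 1), (Y, 0), (Y, 1), (M, 0), (M, 1)])"
    show ?thesis
    proof (rule split[where g = "\<lambda>_. 0" and c = ?c])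
      fix h
      assume h: "h \<in> mcochains m" "alternating h"
        and hv: "\<And>ys. ys \<in> set zlists \<Longrightarrow> length ys = m \<Longrightarrow>
          h ys = 0"
      show "\<forall>ys\<in>set zlists. length ys = Suc m \<longrightarrow> f ys =
          (\<Sum>r\<leftarrow>reps (Suc m). if r = ys then ?c r else 0) + cd h ys"
        unfolding zlists_eq 6
        using h by (simp add: reps_def cd_zlists[OF h(2)] del: One_nat_def cd.simps theta.simps)
    qed
  next
    case 7
    have "length ys \<noteq> Suc m" if "ys \<in> set zlists" for ys
      using zlists_length[OF that] 7 by simp
    then show ?thesis
      using split[of "\<lambda>_. 0" "\<lambda>_. 0"] by blast
  qed
qed

text \<open>Only coordinates in \<open>zlists\<close> have to be checked. Constants are closed, no
  row of degree 4 involves \<open>[(L, 0), (L, 1), (L, 2)]\<close>, the rows of degree 6 are 0, and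
  there is no list of length 7.\<close>

lemma dual_cocycle:
  assumes r: "r \<in> set (reps n)"
  shows "cd (dual r) = (\<lambda>_. 0)"
proof (rule weight0_eqI)
  have len: "length r = n" and z: "r \<in> set zlists"
    using reps_length[OF r] reps_zlists[OF r] by simp_all
  show "cd (dual r) \<in> mcochains (Suc n)"
    using mcochains_cd[OF dual_mcochains, of r] len by simp
  show "weight0 (cd (dual r))"
    using weight0_cd[OF weight0_dual[OF zlists_weight[OF z]]] .
  show "(\<lambda>_. 0) \<in> mcochains (Suc n)" "weight0 (\<lambda>_. 0)"
    by (simp_all add: mcochains_zero weight0_def)
  fix ys
  assume ys: "ys \<in> set zlists" "length ys = Suc n"
  note * = cd_zlists[OF alternating_dual]
  consider "n = 0" | "n = 3" | "n = 5" | "n = 6"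
    using r by (auto simp: reps_def split: if_splits)
  then show "cd (dual r) ys = 0"
  proof cases
    case 1
    then show ?thesis using ys by (cases ys) auto
  next
    case 2
    then have "r = [(L, 0), (L, 1), (L, 2)]"
      using r by (simp add: reps_def)
    then show ?thesis
      using ys 2 unfolding zlists_eq by (auto simp: * dual_zlists zlists_eq
          simp del: dual.simps One_nat_def cd.simps theta.simps)
  next
    case 3
    then show ?thesis
      using ys unfolding zlists_eq by (auto simp: *
          simp del: dual.simps One_nat_def cd.simps theta.simps)
  next
    case 4
    then show ?thesis
      using zlists_length[OF ys(1)] ys(2) by simp
  qed
qed

text \<open>The rows of the representatives in degrees 3 and 6, and of the second one in degree 5,
  are 0, so their coefficients vanish at once. Only the first representative in degree 5 needs an
  argument.\<close>

lemma dual_independent: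
  assumes h: "h \<in> mcochains m"
    and eq: "\<And>xs. (\<Sum>r\<in>set (reps (Suc m)). c r * dual r xs) = cd h xs"
    and r: "r \<in> set (reps (Suc m))"
  shows "c r = 0"
proof -
  note * = cd_zlists[OF mcochainsD(1)[OF h]]
  have c: "cd h ys = (\<Sum>r\<leftarrow>reps (Suc m). if r = ys then c r else 0)" if "ys \<in> set zlists" for ys
  proof -
    have "distinct (reps (Suc m))"
      by (simp add: reps_def)
    then have "(\<Sum>r\<leftarrow>reps (Suc m). if r = ys then c r else 0) =
        (\<Sum>r\<in>set (reps (Suc m)). if r = ys then c r else 0)"
      by (rule sum_list_distinct_conv_sum_set)
    also have "\<dots> = (\<Sum>r\<in>set (reps (Suc m)). c r * dual r ys)"
    proof (rule sum.cong)
      show "(if r = ys then c r else 0) = c r * dual r ys" if "r \<in> set (reps (Suc m))" for r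
        using dual_zlists[OF reps_zlists[OF that] \<open>ys \<in> set zlists\<close>] by simp
    qed simp
    finally show ?thesis
      using eq[of ys] by simp
  qed
  consider "m = 2" | "m = 4" | "m = 5"
    using r by (auto simp: reps_def split: if_splits)
  then show ?thesis
  proof cases
    case 1
    show ?thesis
      using c[of "[(L, 0), (L, 1), (L, 2)]"] r unfolding * 1
      by (simp add: reps_def zlists_eq del: One_nat_def cd.simps theta.simps)
  next
    case 2
    \<comment> \<open>The two lists outside \<open>reps\<close> force h to vanish on
      \<open>[(L, 1), (Y, 0), (Y, 1), (M, 0)]\<close> and
      \<open>[(L, 0), (L, 1), (M, 0), (M, 1)]\<close>, the only values entering the row of the first
      representative.\<close>
    show ?thesis
      using c[of "[(L, 0), (L, 1), (Y, 0), (Y, 1), (M, 1)]"]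
        c[of "[(L, 0), (L, 1), (Y, 0), (Y, 2), (M, 0)]"]
        c[of "[(L, 0), (L, 2), (Y, 0), (Y, 1), (M, 0)]"]
        c[of "[(L, 0), (Y, 0), (Y, 1), (M, 0), (M, 1)]"] r
      unfolding * 2 by (auto simp: reps_def zlists_eq simp del: One_nat_def cd.simps theta.simps)
  next
    case 3
    show ?thesis
      using c[of "[(L, 0), (L, 1), (L, 2), (Y, 0), (Y, 1), (M, 0)]"]
        c[of "[(L, 0), (L, 1), (Y, 0), (Y, 1), (M, 0), (M, 1)]"] r
      unfolding * 3 by (auto simp: reps_def zlists_eq simp del: One_nat_def cd.simps theta.simps)
  qed
qed

text \<open>In degree 0 there are no coboundaries, so the summand \<open>cd h\<close> is absent.\<close>

lemma cocycle_split:
  assumes f: "f \<in> mcochains n" and closed: "cd f = (\<lambda>_. 0)"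
  shows "\<exists>c. (n = 0 \<longrightarrow> f = (\<lambda>xs. \<Sum>r\<in>set (reps n). c r * dual r xs)) \<and>
    (\<forall>m. n = Suc m \<longrightarrow>
       (\<exists>h\<in>mcochains m. f = (\<lambda>xs. (\<Sum>r\<in>set (reps n). c r * dual r xs) + cd h xs)))"
proof (cases n)
  case 0
  have "f = (\<lambda>xs. \<Sum>r\<in>set (reps n). f [] * dual r xs)"
    using mcochainsD(2)[OF f] 0 by (auto simp: reps_def)
  then show ?thesis
    using 0 by (intro exI[of _ "\<lambda>_. f []"]) simp
next
  case (Suc m)
  obtain f0 where f0: "f0 \<in> mcochains n" "weight0 f0" "cd f0 = (\<lambda>_. 0)"
    "\<And>m. n = Suc m \<Longrightarrow> \<exists>h\<in>mcochains m. f = (\<lambda>xs. f0 xs + cd h xs)"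
    using cocycle_weight0[OF f closed] by metis
  obtain h where h: "h \<in> mcochains m" "f = (\<lambda>xs. f0 xs + cd h xs)"
    using f0(4)[OF Suc] by blast
  obtain c h' where h': "h' \<in> mcochains m"
    "f0 = (\<lambda>xs. (\<Sum>r\<in>set (reps n). c r * dual r xs) + cd h' xs)"
    using weight0_cocycle_split[of f0 m] f0 Suc by blast
  have "(\<lambda>xs. h' xs + h xs) \<in> mcochains m"
    using mcochains_lincomb[OF h'(1) h(1), of 1 1] by simp
  moreover have "f = (\<lambda>xs. (\<Sum>r\<in>set (reps n). c r * dual r xs) + cd (\<lambda>xs. h' xs + h xs) xs)"
    unfolding h(2) h'(2) cd_linear by (simp add: add.assoc)
  ultimately show ?thesis
    using Suc by (intro exI[of _ c]) auto
qed

section \<open>Polynomials\<close>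

lemma lconst_mult: "lconst (c * d) = lconst c * lconst d"
  by (simp add: lconst_def mult_single)

lemma lconst_add: "lconst (c + d) = lconst c + lconst d"
  by (simp add: lconst_def single_add)

lemma lconst_simps [simp]: "lconst 0 = 0" "lconst 1 = 1" "lconst (- c) = - lconst c"
  by (simp_all add: lconst_def single_uminus)

lemma lookup_lconst_mult [simp]:
  "Poly_Mapping.lookup (lconst c * p) m = c * Poly_Mapping.lookup p m"
proof -
  have "lconst c * p = Poly_Mapping.map ((*) c) p"
    by (simp add: lconst_def mult_map_scale_conv_mult)
  then show ?thesis
    by (cases "Poly_Mapping.lookup p m = 0") (simp_all add: Poly_Mapping.map.rep_eq)
qed

lemma sum_single_keys: "(\<Sum>m\<in>Poly_Mapping.keys p. Poly_Mapping.single m (Poly_Mapping.lookup p m)) = p"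
proof (rule poly_mapping_eqI)
  fix k
  have "(\<Sum>m\<in>Poly_Mapping.keys p. Poly_Mapping.lookup (Poly_Mapping.single m (Poly_Mapping.lookup p m)) k)
      = (\<Sum>m\<in>Poly_Mapping.keys p. if m = k then Poly_Mapping.lookup p k else 0)"
    by (rule sum.cong) (auto simp: lookup_single when_def)
  then show "Poly_Mapping.lookup (\<Sum>m\<in>Poly_Mapping.keys p. Poly_Mapping.single m (Poly_Mapping.lookup p m)) k
      = Poly_Mapping.lookup p k"
    by (simp add: lookup_sum in_keys_iff)
qed

lemma prod_single_one:
  "finite A \<Longrightarrow> (\<Prod>i\<in>A. Poly_Mapping.single (a i) (1 :: complex)) = Poly_Mapping.single (\<Sum>i\<in>A. a i) 1"
  by (induction A rule: finite_induct) (simp_all add: mult_single)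

lemma lvar_power: "lvar i ^ k = Poly_Mapping.single (Poly_Mapping.single i k) 1"
proof (induction k)
  case (Suc k)
  have "Poly_Mapping.single i 1 + Poly_Mapping.single i k = Poly_Mapping.single i (Suc k)"
    by (simp add: single_add[symmetric])
  then show ?case
    using Suc by (simp add: lvar_def mult_single)
qed simp

section \<open>Substitution as a ring homomorphism\<close>

definition msubst :: "(nat \<Rightarrow> lpoly) \<Rightarrow> (nat \<Rightarrow>\<^sub>0 nat) \<Rightarrow> lpoly" where
  "msubst f m = (\<Prod>i\<in>Poly_Mapping.keys m. f i ^ Poly_Mapping.lookup m i)"

lemma msubst_superset:
  assumes "finite A" and "Poly_Mapping.keys m \<subseteq> A"
  shows "msubst f m = (\<Prod>i\<in>A. f i ^ Poly_Mapping.lookup m i)"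
  unfolding msubst_def
  by (rule prod.mono_neutral_left) (use assms in \<open>auto simp: in_keys_iff\<close>)

lemma msubst_add: "msubst f (m + n) = msubst f m * msubst f n"
proof -
  let ?A = "Poly_Mapping.keys m \<union> Poly_Mapping.keys n"
  have "msubst f (m + n) = (\<Prod>i\<in>?A. f i ^ Poly_Mapping.lookup (m + n) i)"
    by (rule msubst_superset) (simp_all add: keys_add)
  also have "\<dots> = (\<Prod>i\<in>?A. f i ^ Poly_Mapping.lookup m i) * (\<Prod>i\<in>?A. f i ^ Poly_Mapping.lookup n i)"
    by (simp add: lookup_add power_add prod.distrib)
  finally show ?thesis
    by (simp add: msubst_superset[of ?A])
qed

lemma lsubst_superset:
  assumes "finite S" and "Poly_Mapping.keys p \<subseteq> S"
  shows "lsubst f p = (\<Sum>m\<in>S. lconst (Poly_Mapping.lookup p m) * msubst f m)"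
  unfolding lsubst_def msubst_def[symmetric]
  by (rule sum.mono_neutral_left) (use assms in \<open>auto simp: in_keys_iff\<close>)

lemma lsubst_add: "lsubst f (p + q) = lsubst f p + lsubst f q"
proof -
  let ?S = "Poly_Mapping.keys p \<union> Poly_Mapping.keys q"
  have "lsubst f (p + q) = (\<Sum>m\<in>?S. lconst (Poly_Mapping.lookup (p + q) m) * msubst f m)"
    by (rule lsubst_superset) (simp_all add: keys_add)
  also have "\<dots> = (\<Sum>m\<in>?S. lconst (Poly_Mapping.lookup p m) * msubst f m) +
      (\<Sum>m\<in>?S. lconst (Poly_Mapping.lookup q m) * msubst f m)"
    by (simp add: lookup_add lconst_add distrib_right sum.distrib)
  finally show ?thesis
    by (simp add: lsubst_superset[of ?S])
qed

lemma lsubst_zero [simp]: "lsubst f 0 = 0"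
  by (simp add: lsubst_def)

lemma lsubst_sum: "lsubst f (sum g A) = (\<Sum>i\<in>A. lsubst f (g i))"
  by (induction A rule: infinite_finite_induct) (simp_all add: lsubst_add)

lemma lsubst_single: "lsubst f (Poly_Mapping.single m c) = lconst c * msubst f m"
  by (cases "c = 0") (simp_all add: lsubst_def msubst_def)

lemma lsubst_mult: "lsubst f (p * q) = lsubst f p * lsubst f q"
proof -
  have 1: "lsubst f (Poly_Mapping.single m c * Poly_Mapping.single n d) =
      lsubst f (Poly_Mapping.single m c) * lsubst f (Poly_Mapping.single n d)" for m n c d
    by (simp add: mult_single lsubst_single msubst_add lconst_mult mult_ac)
  have "lsubst f ((\<Sum>m\<in>Poly_Mapping.keys p. Poly_Mapping.single m (Poly_Mapping.lookup p m)) *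
      (\<Sum>m\<in>Poly_Mapping.keys q. Poly_Mapping.single m (Poly_Mapping.lookup q m))) =
    lsubst f (\<Sum>m\<in>Poly_Mapping.keys p. Poly_Mapping.single m (Poly_Mapping.lookup p m)) *
      lsubst f (\<Sum>m\<in>Poly_Mapping.keys q. Poly_Mapping.single m (Poly_Mapping.lookup q m))"
    unfolding sum_product lsubst_sum 1 ..
  then show ?thesis
    unfolding sum_single_keys .
qed

lemma lsubst_lconst [simp]: "lsubst f (lconst c) = lconst c"
  by (simp add: lconst_def lsubst_single[of f 0 c, unfolded lconst_def] msubst_def)

lemma lsubst_one [simp]: "lsubst f 1 = 1"
  using lsubst_lconst[of f 1] by simp

lemma lsubst_lvar [simp]: "lsubst f (lvar i) = f i"
  by (simp add: lvar_def lsubst_single msubst_def)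

lemma lsubst_uminus: "lsubst f (- p) = - lsubst f p"
  using lsubst_add[of f "- p" p] by (simp add: eq_neg_iff_add_eq_0)

lemma lsubst_power: "lsubst f (p ^ k) = lsubst f p ^ k"
  by (induction k) (simp_all add: lsubst_mult)

lemma lsubst_prod: "lsubst f (prod g A) = (\<Prod>i\<in>A. lsubst f (g i))"
  by (induction A rule: infinite_finite_induct) (simp_all add: lsubst_mult)

lemma lookup_sum_single:
  "finite A \<Longrightarrow> inj_on \<sigma> A \<Longrightarrow> j \<in> A \<Longrightarrow>
     Poly_Mapping.lookup (\<Sum>i\<in>A. Poly_Mapping.single (\<sigma> i) (e i :: nat)) (\<sigma> j) = e j"
proof -
  assume A: "finite A" "inj_on \<sigma> A" "j \<in> A"
  have "(\<Sum>i\<in>A. Poly_Mapping.lookup (Poly_Mapping.single (\<sigma> i) (e i)) (\<sigma> j)) =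
      (\<Sum>i\<in>A. if i = j then e j else 0)"
    using A by (intro sum.cong) (auto simp: lookup_single when_def inj_on_def)
  then show ?thesis
    using A by (simp add: lookup_sum)
qed

lemma lookup_sum_single_notin:
  "k \<notin> \<sigma> ` A \<Longrightarrow> Poly_Mapping.lookup (\<Sum>i\<in>A. Poly_Mapping.single (\<sigma> i) (e i :: nat)) k = 0"
  unfolding lookup_sum by (rule sum.neutral) (auto simp: lookup_single when_def)

text \<open>The substitution sends the monomial with exponents m to the one with exponents m \<circ>
  \<sigma>^-1. So the coefficient at K comes from the single monomial K \<circ> \<sigma>, which is
  \<open>map_key \<sigma> K\<close>.\<close>

lemma lookup_lsubst_permute:
  assumes "bij \<sigma>"
  shows "Poly_Mapping.lookup (lsubst (\<lambda>i. lvar (\<sigma> i)) p) K =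
     Poly_Mapping.lookup p (Poly_Mapping.map_key \<sigma> K)"
proof -
  have inj: "inj \<sigma>" using assms by (rule bij_is_inj)
  let ?M = "\<lambda>m :: nat \<Rightarrow>\<^sub>0 nat. \<Sum>i\<in>Poly_Mapping.keys m. Poly_Mapping.single (\<sigma> i) (Poly_Mapping.lookup m i)"
  have M: "Poly_Mapping.lookup (?M m) (\<sigma> j) = Poly_Mapping.lookup m j" for m j
  proof (cases "j \<in> Poly_Mapping.keys m")
    case True
    then show ?thesis
      by (rule lookup_sum_single[OF finite_keys inj_on_subset[OF inj subset_UNIV]])
  next
    case False
    then have "\<sigma> j \<notin> \<sigma> ` Poly_Mapping.keys m" using inj by (simp add: inj_image_mem_iff)
    then show ?thesis using False by (simp add: lookup_sum_single_notin in_keys_iff)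
  qed
  have eq: "?M m = K \<longleftrightarrow> m = Poly_Mapping.map_key \<sigma> K" for m
  proof
    assume "?M m = K"
    then have "Poly_Mapping.lookup K (\<sigma> j) = Poly_Mapping.lookup m j" for j
      using M[of m j] by simp
    then show "m = Poly_Mapping.map_key \<sigma> K"
      by (intro poly_mapping_eqI) (simp add: map_key.rep_eq inj)
  next
    assume m: "m = Poly_Mapping.map_key \<sigma> K"
    show "?M m = K"
    proof (rule poly_mapping_eqI)
      fix k
      obtain j where "k = \<sigma> j" using assms by (metis bij_pointE)
      then show "Poly_Mapping.lookup (?M m) k = Poly_Mapping.lookup K k"
        using M[of m j] m by (simp add: map_key.rep_eq inj)
    qed
  qed
  have ms: "msubst (\<lambda>i. lvar (\<sigma> i)) m = Poly_Mapping.single (?M m) 1" for m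
    unfolding msubst_def lvar_power by (rule prod_single_one) simp
  have "Poly_Mapping.lookup (lsubst (\<lambda>i. lvar (\<sigma> i)) p) K =
     (\<Sum>m\<in>Poly_Mapping.keys p. if m = Poly_Mapping.map_key \<sigma> K then Poly_Mapping.lookup p m else 0)"
    unfolding lsubst_def msubst_def[symmetric] ms lookup_sum
    by (rule sum.cong) (simp_all add: lookup_single when_def eq)
  then show ?thesis
    by (simp add: in_keys_iff)
qed

section \<open>Polynomials in the first n variables\<close>

lemma lpolys_iff: "p \<in> lpolys n \<longleftrightarrow>
    (\<forall>m. Poly_Mapping.lookup p m \<noteq> 0 \<longrightarrow> Poly_Mapping.keys m \<subseteq> {..<n})"
  unfolding lpolys_def Ball_def in_keys_iff mem_Collect_eq ..

lemma lpolys_zero [simp]: "0 \<in> lpolys n"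
  by (simp add: lpolys_iff)

lemma lpolys_add: "p \<in> lpolys n \<Longrightarrow> q \<in> lpolys n \<Longrightarrow> p + q \<in> lpolys n"
  unfolding lpolys_iff lookup_add by (metis add_0)

lemma lpolys_mult:
  assumes "p \<in> lpolys n" and "q \<in> lpolys n"
  shows "p * q \<in> lpolys n"
  unfolding lpolys_def
proof (clarsimp)
  fix m i
  assume m: "m \<in> Poly_Mapping.keys (p * q)" and i: "i \<in> Poly_Mapping.keys m"
  obtain a b where "m = a + b" "a \<in> Poly_Mapping.keys p" "b \<in> Poly_Mapping.keys q"
    using m keys_mult[of p q] by auto
  moreover have "i \<in> Poly_Mapping.keys a \<union> Poly_Mapping.keys b"
    using i keys_add[of a b] \<open>m = a + b\<close> by blast
  ultimately show "i < n"
    using assms unfolding lpolys_def by blast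
qed

lemma lpolys_lconst [simp]: "lconst c \<in> lpolys n"
  by (simp add: lpolys_def lconst_def)

lemma lpolys_lvar [simp]: "i < n \<Longrightarrow> lvar i \<in> lpolys n"
  by (simp add: lpolys_def lvar_def)

lemma lpolys_uminus: "p \<in> lpolys n \<Longrightarrow> - p \<in> lpolys n"
  by (simp add: lpolys_iff)

lemma lpolys_sum: "(\<And>i. i \<in> A \<Longrightarrow> g i \<in> lpolys n) \<Longrightarrow> sum g A \<in> lpolys n"
  by (induction A rule: infinite_finite_induct) (simp_all add: lpolys_add)

lemma lpolys_power: "p \<in> lpolys n \<Longrightarrow> p ^ k \<in> lpolys n"
  using lpolys_lconst[of 1 n] by (induction k) (simp_all add: lpolys_mult)

lemma lpolys_prod: "(\<And>i. i \<in> A \<Longrightarrow> g i \<in> lpolys n) \<Longrightarrow> prod g A \<in> lpolys n"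
  using lpolys_lconst[of 1 n]
  by (induction A rule: infinite_finite_induct) (simp_all add: lpolys_mult)

text \<open>The sum is the coefficient of x^k y^l in (\<alpha> x + \<beta> y)(x + y)^n, two binomial
  coefficients when n + 1 = k + l. Multiplying by k! l! turns them into k n! and l n!; this is what
  the duality with \<lambda>^k/k! achieves.\<close>

lemma bracket_binomial:
  fixes \<alpha> \<beta> :: complex
  shows "fact k * fact l * (\<Sum>a\<le>n. of_nat (n choose a) *
      ((if Suc a = k \<and> n - a = l then \<alpha> else 0) + (if a = k \<and> Suc (n - a) = l then \<beta> else 0))) =
    (if Suc n = k + l then (\<alpha> * of_nat k + \<beta> * of_nat l) * fact n else 0)"
    (is "_ * ?S = _")
proof (cases "Suc n = k + l")
  case False
  then have "?S = 0" by (intro sum.neutral) auto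
  then show ?thesis using False by simp
next
  case True
  have A: "(\<Sum>a\<le>n. of_nat (n choose a) * (if Suc a = k \<and> n - a = l then \<alpha> else 0)) =
      (if k = 0 then 0 else of_nat (n choose (k - 1)) * \<alpha>)"
  proof (cases k)
    case (Suc k')
    have "(\<Sum>a\<le>n. of_nat (n choose a) * (if Suc a = k \<and> n - a = l then \<alpha> else 0)) =
        (\<Sum>a\<le>n. if a = k' then of_nat (n choose k') * \<alpha> else 0)"
      using True Suc by (intro sum.cong) auto
    then show ?thesis using True Suc by simp
  qed simp
  have B: "(\<Sum>a\<le>n. of_nat (n choose a) * (if a = k \<and> Suc (n - a) = l then \<beta> else 0)) =
      (if l = 0 then 0 else of_nat (n choose k) * \<beta>)"
  proof (cases l)
    case (Suc l')
    have "(\<Sum>a\<le>n. of_nat (n choose a) * (if a = k \<and> Suc (n - a) = l then \<beta> else 0)) =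
        (\<Sum>a\<le>n. if a = k then of_nat (n choose k) * \<beta> else 0)"
      using True Suc by (intro sum.cong) auto
    then show ?thesis using True Suc by simp
  qed simp
  have S: "?S = (if k = 0 then 0 else of_nat (n choose (k - 1)) * \<alpha>) +
      (if l = 0 then 0 else of_nat (n choose k) * \<beta>)"
    unfolding A[symmetric] B[symmetric] by (simp add: distrib_left sum.distrib)
  have a: "fact k * fact l * (of_nat (n choose (k - 1)) * \<alpha>) = \<alpha> * of_nat k * fact n" if "k \<noteq> 0"
  proof -
    obtain k' where k': "k = Suc k'" using \<open>k \<noteq> 0\<close> by (cases k) auto
    then have n: "n = k' + l" using True by simp
    have "fact k' * fact l * (n choose k') = fact n"
      using binomial_fact_lemma[of k' n] n by simp
    then have "(fact k' * fact l * of_nat (n choose k') :: complex) = fact n"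
      by (metis of_nat_fact of_nat_mult)
    then show ?thesis
      unfolding k' by (simp add: mult_ac)
  qed
  have b: "fact k * fact l * (of_nat (n choose k) * \<beta>) = \<beta> * of_nat l * fact n" if "l \<noteq> 0"
  proof -
    obtain l' where l': "l = Suc l'" using \<open>l \<noteq> 0\<close> by (cases l) auto
    then have n: "n = k + l'" using True by simp
    have "fact k * fact l' * (n choose k) = fact n"
      using binomial_fact_lemma[of k n] n by simp
    then have "(fact k * fact l' * of_nat (n choose k) :: complex) = fact n"
      by (metis of_nat_fact of_nat_mult)
    then show ?thesis
      unfolding l' by (simp add: mult_ac)
  qed
  have a': "fact k * fact l * (if k = 0 then 0 else of_nat (n choose (k - 1)) * \<alpha>) =
      \<alpha> * of_nat k * fact n"
    using a by (cases "k = 0") simp_all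
  have b': "fact k * fact l * (if l = 0 then 0 else of_nat (n choose k) * \<beta>) =
      \<beta> * of_nat l * fact n"
    using b by (cases "l = 0") simp_all
  show ?thesis
    unfolding S unfolding distrib_left a' b' using True by (simp add: distrib_right)
qed

text \<open>A monomial of q can contribute to K only if its exponents from position 1 on match K
  along \<open>ks\<close> and its exponent at position 0 is k i + k j - 1. So one monomial survives,
  and \<open>bracket_binomial\<close> evaluates its contribution.\<close>

lemma lookup_bracket_subst:
  fixes K :: "nat \<Rightarrow>\<^sub>0 nat"
  defines "k \<equiv> Poly_Mapping.lookup K"
  assumes q: "q \<in> lpolys (Suc (length ks))" and dist: "distinct (i # j # ks)"
    and K: "Poly_Mapping.keys K \<subseteq> insert i (insert j (set ks))"
  shows "fact (k i) * fact (k j) * Poly_Mapping.lookup ((lconst \<alpha> * lvar i + lconst \<beta> * lvar j) *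
       lsubst (case_nat (lvar i + lvar j) (\<lambda>t. lvar (ks ! t))) q) K =
     (\<alpha> * of_nat (k i) + \<beta> * of_nat (k j)) * (fact (k i + k j - 1) *
       Poly_Mapping.lookup q (Poly_Mapping.nth ((k i + k j - 1) # map k ks)))"
    (is "?c * Poly_Mapping.lookup (?lin * lsubst ?F q) K = _ * (_ * Poly_Mapping.lookup q ?K')")
proof -
  let ?N = "length ks"
  \<comment> \<open>\<open>R m\<close> is the image of the variables from position 1 on, and
    \<open>C m\<close> says that it matches K along \<open>ks\<close>.\<close>
  define R where "R m = (\<Sum>t<?N. Poly_Mapping.single (ks ! t) (Poly_Mapping.lookup m (Suc t)))"
    for m :: "nat \<Rightarrow>\<^sub>0 nat"
  define C where "C m \<longleftrightarrow> (\<forall>t<?N. Poly_Mapping.lookup m (Suc t) = k (ks ! t))"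
    for m :: "nat \<Rightarrow>\<^sub>0 nat"
  have inj: "inj_on ((!) ks) {..<?N}"
    using dist by (auto simp: inj_on_def nth_eq_iff_index_eq)
  have Rij: "Poly_Mapping.lookup (R m) i = 0" "Poly_Mapping.lookup (R m) j = 0" for m
    unfolding R_def using dist by (intro lookup_sum_single_notin; force)+
  have Rks: "Poly_Mapping.lookup (R m) (ks ! t) = Poly_Mapping.lookup m (Suc t)" if "t < ?N" for m t
    unfolding R_def using that by (intro lookup_sum_single[OF _ inj]) auto
  have Rout: "Poly_Mapping.lookup (R m) s = 0" if "s \<notin> set ks" for m s
    unfolding R_def using that by (intro lookup_sum_single_notin) auto
  have mono: "Poly_Mapping.lookup (Poly_Mapping.single (Poly_Mapping.single i x + Poly_Mapping.single j y + R m) 1) K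
      = (if x = k i \<and> y = k j \<and> C m then 1 else 0 :: complex)" for x y m
  proof -
    let ?m = "Poly_Mapping.single i x + Poly_Mapping.single j y + R m"
    have "?m = K \<longleftrightarrow> x = k i \<and> y = k j \<and> C m"
    proof
      assume e: "?m = K"
      have "x = k i" "y = k j"
        using dist unfolding k_def e[symmetric] by (simp_all add: lookup_add lookup_single Rij)
      moreover have "Poly_Mapping.lookup m (Suc t) = k (ks ! t)" if "t < ?N" for t
        using dist nth_mem[OF that] Rks[OF that, of m] unfolding k_def e[symmetric]
        by (auto simp: lookup_add lookup_single when_def)
      ultimately show "x = k i \<and> y = k j \<and> C m"
        by (simp add: C_def)
    next
      assume e: "x = k i \<and> y = k j \<and> C m"
      show "?m = K"
      proof (rule poly_mapping_eqI)
        fix s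
        consider "s = i" | "s = j" | t where "t < ?N" "s = ks ! t" | "s \<noteq> i" "s \<noteq> j" "s \<notin> set ks"
          by (metis in_set_conv_nth)
        then show "Poly_Mapping.lookup ?m s = Poly_Mapping.lookup K s"
        proof cases
          case 1
          then show ?thesis using e dist by (simp add: lookup_add lookup_single Rij k_def)
        next
          case 2
          then show ?thesis using e dist by (simp add: lookup_add lookup_single Rij k_def)
        next
          case 3
          then have "s \<noteq> i" "s \<noteq> j" using dist nth_mem[of t ks] by auto
          then show ?thesis
            using 3 e Rks[of t m] by (simp add: lookup_add lookup_single C_def k_def)
        next
          case 4
          then have "Poly_Mapping.lookup K s = 0" using K by (auto simp: in_keys_iff)
          then show ?thesis using 4 Rout by (simp add: lookup_add lookup_single)
        qed
      qed
    qed
    then show ?thesis by (simp add: lookup_single when_def)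
  qed
  have monomial: "?c * Poly_Mapping.lookup (?lin * msubst ?F m) K =
      (if m = ?K' then (\<alpha> * of_nat (k i) + \<beta> * of_nat (k j)) * fact (k i + k j - 1) else 0)"
    if m: "Poly_Mapping.keys m \<subseteq> {..<Suc ?N}" for m
  proof -
    define n where "n = Poly_Mapping.lookup m 0"
    have "msubst ?F m = (\<Prod>t<Suc ?N. ?F t ^ Poly_Mapping.lookup m t)"
      by (rule msubst_superset) (use m in simp_all)
    also have "\<dots> = (lvar i + lvar j) ^ n * (\<Prod>t<?N. lvar (ks ! t) ^ Poly_Mapping.lookup m (Suc t))"
      unfolding prod.lessThan_Suc_shift by (simp add: n_def)
    also have "(\<Prod>t<?N. lvar (ks ! t) ^ Poly_Mapping.lookup m (Suc t)) = Poly_Mapping.single (R m) 1"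
      unfolding lvar_power R_def by (rule prod_single_one) simp
    also have "(lvar i + lvar j) ^ n = (\<Sum>a\<le>n. lconst (of_nat (n choose a)) * (lvar i ^ a * lvar j ^ (n - a)))"
      by (simp add: binomial_ring lconst_def mult.assoc)
    finally have ms: "msubst ?F m = (\<Sum>a\<le>n. lconst (of_nat (n choose a)) *
        (lvar i ^ a * lvar j ^ (n - a) * Poly_Mapping.single (R m) 1))"
      by (simp add: sum_distrib_right mult.assoc)
    have "?lin * msubst ?F m = (\<Sum>a\<le>n. lconst (of_nat (n choose a)) *
        (lconst \<alpha> * (lvar i ^ Suc a * lvar j ^ (n - a) * Poly_Mapping.single (R m) 1) +
         lconst \<beta> * (lvar i ^ a * lvar j ^ Suc (n - a) * Poly_Mapping.single (R m) 1)))"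
      unfolding ms sum_distrib_left by (rule sum.cong) (simp_all add: algebra_simps)
    then have "Poly_Mapping.lookup (?lin * msubst ?F m) K = (\<Sum>a\<le>n. of_nat (n choose a) *
        (\<alpha> * (if Suc a = k i \<and> n - a = k j \<and> C m then 1 else 0) +
         \<beta> * (if a = k i \<and> Suc (n - a) = k j \<and> C m then 1 else 0)))"
      by (simp only: lookup_sum lookup_lconst_mult lookup_add lvar_power mult_single mono mult_1_left)
    also have "\<dots> = (if C m then (\<Sum>a\<le>n. of_nat (n choose a) *
      ((if Suc a = k i \<and> n - a = k j then \<alpha> else 0) + (if a = k i \<and> Suc (n - a) = k j then \<beta> else 0))) else 0)"
      by (auto intro!: sum.cong sum.neutral)
    finally have "?c * Poly_Mapping.lookup (?lin * msubst ?F m) K =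
        (if C m \<and> Suc n = k i + k j then (\<alpha> * of_nat (k i) + \<beta> * of_nat (k j)) * fact n else 0)"
      using bracket_binomial[of "k i" "k j" n \<alpha> \<beta>] by auto
    moreover have "m = ?K' \<longleftrightarrow> C m \<and> n = k i + k j - 1"
    proof
      assume "m = ?K'"
      then show "C m \<and> n = k i + k j - 1"
        by (simp add: C_def n_def nth_default_def)
    next
      assume e: "C m \<and> n = k i + k j - 1"
      show "m = ?K'"
      proof (rule poly_mapping_eqI)
        fix s
        show "Poly_Mapping.lookup m s = Poly_Mapping.lookup ?K' s"
        proof (cases s)
          case 0
          then show ?thesis using e by (simp add: n_def)
        next
          case (Suc t)
          then show ?thesis
            using e m by (cases "t < ?N") (auto simp: C_def nth_default_def in_keys_iff)
        qed
      qed
    qed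
    \<comment> \<open>If both exponents are 0, truncation admits n = 0 on the right, but there the
      factor \<alpha> k i + \<beta> k j is 0.\<close>
    ultimately show ?thesis
      by (cases "k i + k j = 0") auto
  qed
  have "Poly_Mapping.lookup (?lin * lsubst ?F q) K =
      (\<Sum>m\<in>Poly_Mapping.keys q. Poly_Mapping.lookup q m * Poly_Mapping.lookup (?lin * msubst ?F m) K)"
    unfolding lsubst_def msubst_def[symmetric] sum_distrib_left lookup_sum
    by (simp only: mult.left_commute[of ?lin] lookup_lconst_mult)
  then have "?c * Poly_Mapping.lookup (?lin * lsubst ?F q) K =
      (\<Sum>m\<in>Poly_Mapping.keys q. Poly_Mapping.lookup q m * (?c * Poly_Mapping.lookup (?lin * msubst ?F m) K))"
    by (simp only: sum_distrib_left mult_ac)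
  also have "\<dots> = (\<Sum>m\<in>Poly_Mapping.keys q. if m = ?K' then Poly_Mapping.lookup q ?K' *
      ((\<alpha> * of_nat (k i) + \<beta> * of_nat (k j)) * fact (k i + k j - 1)) else 0)"
  proof (rule sum.cong)
    fix m
    assume "m \<in> Poly_Mapping.keys q"
    then have "Poly_Mapping.keys m \<subseteq> {..<Suc ?N}" using q by (auto simp: lpolys_def)
    from monomial[OF this] show "Poly_Mapping.lookup q m * (?c * Poly_Mapping.lookup (?lin * msubst ?F m) K) =
        (if m = ?K' then Poly_Mapping.lookup q ?K' *
           ((\<alpha> * of_nat (k i) + \<beta> * of_nat (k j)) * fact (k i + k j - 1)) else 0)"
      by simp
  qed simp
  also have "\<dots> = Poly_Mapping.lookup q ?K' *
      ((\<alpha> * of_nat (k i) + \<beta> * of_nat (k j)) * fact (k i + k j - 1))"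
    by (simp add: in_keys_iff)
  finally show ?thesis
    by (simp only: mult_ac)
qed

text \<open>The coefficients of the three components express every element through iterated images
  of the generators under \<partial>. This reduces identities between sesquilinear maps to
  generators.\<close>

lemma sv_induct [case_names gen add scale D]:
  assumes gen: "\<And>g. P (gen g)" and add: "\<And>a b. P a \<Longrightarrow> P b \<Longrightarrow> P (a + b)"
    and scale: "\<And>c a. P a \<Longrightarrow> P (sv_scale c a)" and D: "\<And>a. P a \<Longrightarrow> P (sv_D a)"
  shows "P a"
proof -
  have zero: "P 0"
    using scale[OF gen, of 0 L] by (simp add: sv_at_eqI[of "sv_scale 0 (gen L)" 0])
  have sum: "(\<And>i. i \<in> A \<Longrightarrow> P (f i)) \<Longrightarrow> P (sum f A)" for f :: "'b \<Rightarrow> sv" and A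
    by (induction A rule: infinite_finite_induct) (simp_all add: zero add)
  have pow: "P ((sv_D ^^ k) (gen g))" for k g
    by (induction k) (simp_all add: gen D)
  have at: "sv_at h t ((sv_D ^^ k) (gen g)) = t ^ k * (if h = g then 1 else 0)" for h t k g
    by (induction k) simp_all
  have "a = (\<Sum>g\<in>{L, Y, M}. \<Sum>k\<le>degree (Poly_Mapping.lookup a g).
      sv_scale (coeff (Poly_Mapping.lookup a g) k) ((sv_D ^^ k) (gen g)))"
    (is "a = ?s")
  proof (rule sv_at_eqI)
    fix h t
    have "sv_at h t ?s = (\<Sum>g\<in>{L, Y, M}. if h = g then poly (Poly_Mapping.lookup a h) t else 0)"
      unfolding sv_at_sum by (rule sum.cong) (auto simp: at poly_altdef mult_ac)
    also have "\<dots> = sv_at h t a"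
      by (cases h) (simp_all add: sv_at_def)
    finally show "sv_at h t a = sv_at h t ?s" ..
  qed
  moreover have "P ?s"
    by (intro sum scale pow)
  ultimately show ?thesis by metis
qed


section \<open>Multilinear maps\<close>

text \<open>The conditions on a cochain that can be verified one argument at a time. They are
  separated from skew-symmetry because the differential is known to satisfy them first.\<close>

definition multilinear :: "nat \<Rightarrow> (sv list \<Rightarrow> lpoly) \<Rightarrow> bool" where
  "multilinear n \<gamma> \<longleftrightarrow>
     (\<forall>as. length as \<noteq> n \<longrightarrow> \<gamma> as = 0) \<and>
     (\<forall>as i a b. length as = n \<and> i < n \<longrightarrow>
        \<gamma> (as[i := a + b]) = \<gamma> (as[i := a]) + \<gamma> (as[i := b])) \<and>
     (\<forall>as i c a. length as = n \<and> i < n \<longrightarrow>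
        \<gamma> (as[i := sv_scale c a]) = lconst c * \<gamma> (as[i := a])) \<and>
     (\<forall>as i a. length as = n \<and> i < n \<longrightarrow>
        \<gamma> (as[i := sv_D a]) = - lvar i * \<gamma> (as[i := a]))"

lemma multilinearD:
  assumes "multilinear n \<gamma>"
  shows "length as \<noteq> n \<Longrightarrow> \<gamma> as = 0"
    and "length as = n \<Longrightarrow> i < n \<Longrightarrow> \<gamma> (as[i := a + b]) = \<gamma> (as[i := a]) + \<gamma> (as[i := b])"
    and "length as = n \<Longrightarrow> i < n \<Longrightarrow> \<gamma> (as[i := sv_scale c a]) = lconst c * \<gamma> (as[i := a])"
    and "length as = n \<Longrightarrow> i < n \<Longrightarrow> \<gamma> (as[i := sv_D a]) = - lvar i * \<gamma> (as[i := a])"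
  using assms unfolding multilinear_def by blast+

lemma multilinear_eqI:
  assumes \<gamma>: "multilinear n \<gamma>" and \<delta>: "multilinear n \<delta>"
    and eq: "\<And>gs. length gs = n \<Longrightarrow> \<gamma> (map gen gs) = \<delta> (map gen gs)"
  shows "\<gamma> = \<delta>"
proof
  fix as
  \<comment> \<open>Arguments are freed one at a time: the first m are arbitrary, the others are
    generators.\<close>
  have "\<gamma> as = \<delta> as" if "length as = n" "m \<le> n" "\<forall>i\<in>{m..<n}. as ! i \<in> range gen" for m as
    using that
  proof (induction m arbitrary: as)
    case 0
    then have "set as \<subseteq> range gen" by (auto simp: in_set_conv_nth)
    then obtain gs where "as = map gen gs" by (metis ex_map_conv image_iff subset_iff)
    then show ?case using eq 0 by simp
  next
    case (Suc m)
    have "\<gamma> (as[m := a]) = \<delta> (as[m := a])" for a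
    proof (induction a rule: sv_induct)
      case (gen g)
      show ?case using Suc.prems by (intro Suc.IH) (auto simp: nth_list_update)
    next
      case (add a b)
      then show ?case using Suc.prems multilinearD(2)[OF \<gamma>] multilinearD(2)[OF \<delta>] by simp
    next
      case (scale c a)
      then show ?case using Suc.prems multilinearD(3)[OF \<gamma>] multilinearD(3)[OF \<delta>] by simp
    next
      case (D a)
      then show ?case using Suc.prems multilinearD(4)[OF \<gamma>] multilinearD(4)[OF \<delta>] by simp
    qed
    from this[of "as ! m"] show ?case by simp
  qed
  note gens = this
  show "\<gamma> as = \<delta> as"
  proof (cases "length as = n")
    case True
    then show ?thesis using gens[of as n] by simp
  next
    case False
    then show ?thesis by (simp add: multilinearD(1)[OF \<gamma>] multilinearD(1)[OF \<delta>])
  qed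
qed

lemma cochains_iff: "\<gamma> \<in> SV.cochains n \<longleftrightarrow> multilinear n \<gamma> \<and>
     (\<forall>as. length as = n \<longrightarrow> \<gamma> as \<in> lpolys n) \<and>
     (\<forall>as \<sigma>. length as = n \<and> \<sigma> permutes {..<n} \<longrightarrow>
        lsubst (\<lambda>i. lvar (\<sigma> i)) (\<gamma> (permute_list \<sigma> as)) = of_int (sign \<sigma>) * \<gamma> as)"
proof -
  have "(\<forall>as i. length as = n \<and> i < n \<longrightarrow> \<gamma> (as[i := sv_D (as ! i)]) = - lvar i * \<gamma> as) \<longleftrightarrow>
     (\<forall>as i a. length as = n \<and> i < n \<longrightarrow> \<gamma> (as[i := sv_D a]) = - lvar i * \<gamma> (as[i := a]))"
    (is "?l \<longleftrightarrow> ?r")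
  proof
    assume l: ?l
    show ?r
    proof (intro allI impI)
      fix as :: "sv list" and i a
      assume "length as = n \<and> i < n"
      then show "\<gamma> (as[i := sv_D a]) = - lvar i * \<gamma> (as[i := a])"
        using l[rule_format, of "as[i := a]" i] by simp
    qed
  next
    assume r: ?r
    show ?l
    proof (intro allI impI)
      fix as :: "sv list" and i
      assume "length as = n \<and> i < n"
      then show "\<gamma> (as[i := sv_D (as ! i)]) = - lvar i * \<gamma> as"
        using r[rule_format, of as i "as ! i"] by simp
    qed
  qed
  then show ?thesis
    unfolding SV.cochains_def multilinear_def mem_Collect_eq by blast
qed

text \<open>One summand of the differential, with $v = [{a_i}_{\lambda_i}a_j]$ and \<open>bs\<close> the other arguments.\<close>

definition bracket_term :: "nat list \<Rightarrow> nat \<Rightarrow> nat \<Rightarrow> (sv list \<Rightarrow> lpoly) \<Rightarrow> sv poly \<Rightarrow> sv list \<Rightarrow> lpoly" where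
  "bracket_term ks i j \<gamma> v bs = (\<Sum>p\<le>degree v. lvar i ^ p *
     lsubst (case_nat (lvar i + lvar j) (\<lambda>l. lvar (ks ! l))) (\<gamma> (coeff v p # bs)))"

definition others :: "nat \<Rightarrow> nat \<Rightarrow> nat \<Rightarrow> nat list" where
  "others n i j = filter (\<lambda>k. k \<noteq> i \<and> k \<noteq> j) [0..<Suc n]"

lemma differential_eq: "SV.differential n \<gamma> as = (if length as \<noteq> Suc n then 0 else
    (\<Sum>j\<le>n. \<Sum>i<j. (-1) ^ (i + j) *
       bracket_term (others n i j) i j \<gamma> (sv_bracket (as ! i) (as ! j)) (map ((!) as) (others n i j))))"
  unfolding SV.differential_def bracket_term_def others_def Let_def ..

lemma others: "distinct (others n i j)" "set (others n i j) = {..n} - {i, j}"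
  by (auto simp: others_def)

lemma length_others:
  assumes "i < j" "j \<le> n"
  shows "Suc (length (others n i j)) = n"
proof -
  have "length (others n i j) = card ({..n} - {i, j})"
    using distinct_card[OF others(1)] others(2) by metis
  also have "\<dots> = card {..n} - card {i, j}"
    using assms by (intro card_Diff_subset) auto
  finally show ?thesis using assms by simp
qed

section \<open>Linearity of one summand of the differential\<close>

context
  fixes \<gamma> :: "sv list \<Rightarrow> lpoly" and ks :: "nat list" and i j n :: nat and bs :: "sv list"
  assumes ml: "multilinear n \<gamma>" and len: "Suc (length bs) = n"
begin

lemma multilinear_Cons:
  "\<gamma> ((a + b) # bs) = \<gamma> (a # bs) + \<gamma> (b # bs)"
  "\<gamma> (sv_scale c a # bs) = lconst c * \<gamma> (a # bs)"
  "\<gamma> (sv_D a # bs) = - lvar 0 * \<gamma> (a # bs)"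
  "\<gamma> (0 # bs) = 0"
proof -
  show "\<gamma> ((a + b) # bs) = \<gamma> (a # bs) + \<gamma> (b # bs)"
    using multilinearD(2)[OF ml, of "a # bs" 0 a b] len by simp
  show s: "\<gamma> (sv_scale c a # bs) = lconst c * \<gamma> (a # bs)" for c a
    using multilinearD(3)[OF ml, of "a # bs" 0 c a] len by simp
  show "\<gamma> (sv_D a # bs) = - lvar 0 * \<gamma> (a # bs)"
    using multilinearD(4)[OF ml, of "a # bs" 0 a] len by simp
  show "\<gamma> (0 # bs) = 0"
    using s[of 0 0] by simp
qed

lemma bracket_term_bound:
  assumes "degree v \<le> N"
  shows "bracket_term ks i j \<gamma> v bs = (\<Sum>p\<le>N. lvar i ^ p *
     lsubst (case_nat (lvar i + lvar j) (\<lambda>l. lvar (ks ! l))) (\<gamma> (coeff v p # bs)))"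
  unfolding bracket_term_def
  by (rule sum.mono_neutral_left) (use assms in \<open>auto simp: coeff_eq_0 multilinear_Cons\<close>)

text \<open>In the first argument of \<gamma>, \<partial> is multiplication by
  \<open>- lvar 0\<close>, which the substitution turns into -(\<lambda>_i + \<lambda>_j), while the
  formal \<lambda> of the bracket becomes \<lambda>_i.\<close>

lemma bracket_term_linear:
  "bracket_term ks i j \<gamma> (v + w) bs = bracket_term ks i j \<gamma> v bs + bracket_term ks i j \<gamma> w bs"
  "bracket_term ks i j \<gamma> (map_poly (sv_scale c) v) bs = lconst c * bracket_term ks i j \<gamma> v bs"
  "bracket_term ks i j \<gamma> (map_poly sv_D v) bs = - (lvar i + lvar j) * bracket_term ks i j \<gamma> v bs"
  "bracket_term ks i j \<gamma> (pCons 0 v) bs = lvar i * bracket_term ks i j \<gamma> v bs"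
  "bracket_term ks i j \<gamma> (- v) bs = - bracket_term ks i j \<gamma> v bs"
proof -
  let ?N = "max (degree v) (degree w)"
  show "bracket_term ks i j \<gamma> (v + w) bs = bracket_term ks i j \<gamma> v bs + bracket_term ks i j \<gamma> w bs"
    by (simp add: bracket_term_bound[of _ ?N] degree_add_le_max multilinear_Cons lsubst_add distrib_left sum.distrib)
  show sc: "bracket_term ks i j \<gamma> (map_poly (sv_scale c) v) bs = lconst c * bracket_term ks i j \<gamma> v bs" for c
    by (simp add: bracket_term_bound[of _ "degree v"] map_poly_degree_leq coeff_map_poly multilinear_Cons
        lsubst_mult sum_distrib_left mult.left_commute)
  show "bracket_term ks i j \<gamma> (map_poly sv_D v) bs = - (lvar i + lvar j) * bracket_term ks i j \<gamma> v bs"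
    by (simp add: bracket_term_bound[of _ "degree v"] map_poly_degree_leq coeff_map_poly multilinear_Cons
        lsubst_mult lsubst_uminus sum_distrib_left sum_negf mult.left_commute del: minus_add_distrib)
  show "bracket_term ks i j \<gamma> (pCons 0 v) bs = lvar i * bracket_term ks i j \<gamma> v bs"
    unfolding bracket_term_bound[of "pCons 0 v" "Suc (degree v)", OF degree_pCons_le] sum.atMost_Suc_shift
    by (simp add: bracket_term_def multilinear_Cons sum_distrib_left mult.assoc)
  have "- v = map_poly (sv_scale (-1)) v"
    by (intro poly_eqI) (simp add: coeff_map_poly sv_at_eqI)
  then show "bracket_term ks i j \<gamma> (- v) bs = - bracket_term ks i j \<gamma> v bs"
    using sc[of "-1"] by simp
qed

lemma bracket_term_args:
  assumes t: "t < length bs"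
  shows "bracket_term ks i j \<gamma> v (bs[t := a + b]) =
      bracket_term ks i j \<gamma> v (bs[t := a]) + bracket_term ks i j \<gamma> v (bs[t := b])"
    "bracket_term ks i j \<gamma> v (bs[t := sv_scale c a]) = lconst c * bracket_term ks i j \<gamma> v (bs[t := a])"
    "bracket_term ks i j \<gamma> v (bs[t := sv_D a]) = - lvar (ks ! t) * bracket_term ks i j \<gamma> v (bs[t := a])"
proof -
  have 1: "\<gamma> (x # bs[t := a + b]) = \<gamma> (x # bs[t := a]) + \<gamma> (x # bs[t := b])"
    "\<gamma> (x # bs[t := sv_scale c a]) = lconst c * \<gamma> (x # bs[t := a])"
    "\<gamma> (x # bs[t := sv_D a]) = - lvar (Suc t) * \<gamma> (x # bs[t := a])" for x
    using multilinearD(2)[OF ml, of "x # bs" "Suc t" a b] multilinearD(3)[OF ml, of "x # bs" "Suc t" c a]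
      multilinearD(4)[OF ml, of "x # bs" "Suc t" a] len t by simp_all
  show "bracket_term ks i j \<gamma> v (bs[t := a + b]) =
      bracket_term ks i j \<gamma> v (bs[t := a]) + bracket_term ks i j \<gamma> v (bs[t := b])"
    by (simp add: bracket_term_def 1 lsubst_add distrib_left sum.distrib)
  show "bracket_term ks i j \<gamma> v (bs[t := sv_scale c a]) = lconst c * bracket_term ks i j \<gamma> v (bs[t := a])"
    by (simp add: bracket_term_def 1 lsubst_mult sum_distrib_left mult.left_commute)
  show "bracket_term ks i j \<gamma> v (bs[t := sv_D a]) = - lvar (ks ! t) * bracket_term ks i j \<gamma> v (bs[t := a])"
    by (simp add: bracket_term_def 1 lsubst_mult lsubst_uminus sum_distrib_left sum_negf mult.left_commute)
qed

end

text \<open>The argument is the first or second entry of the bracket or one of the others.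
  Sesquilinearity turns \<partial> into -\<lambda>_i in the first entry, and into \<partial> +
  \<lambda>, that is -(\<lambda>_i + \<lambda>_j) + \<lambda>_i = -\<lambda>_j, in the
  second.\<close>

lemma multilinear_differential:
  assumes ml: "multilinear n \<gamma>"
  shows "multilinear (Suc n) (SV.differential n \<gamma>)"
proof -
  define B where "B i j as = bracket_term (others n i j) i j \<gamma>
      (sv_bracket (as ! i) (as ! j)) (map ((!) as) (others n i j))" for i j and as :: "sv list"
  have B: "B i j (as[l := a + b]) = B i j (as[l := a]) + B i j (as[l := b])"
    "B i j (as[l := sv_scale c a]) = lconst c * B i j (as[l := a])"
    "B i j (as[l := sv_D a]) = - lvar l * B i j (as[l := a])"
    if ij: "i < j" "j \<le> n" and l: "l \<le> n" and as: "length as = Suc n" for i j l as a b c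
  proof -
    let ?ks = "others n i j"
    have len: "Suc (length (map ((!) as) ?ks)) = n" for as :: "sv list"
      using length_others[OF ij] by simp
    note lin = bracket_term_linear[OF ml len] and args = bracket_term_args[OF ml len]
    consider "l = i" | "l = j" | "l \<noteq> i" "l \<noteq> j" by blast
    then have "B i j (as[l := a + b]) = B i j (as[l := a]) + B i j (as[l := b]) \<and>
      B i j (as[l := sv_scale c a]) = lconst c * B i j (as[l := a]) \<and>
      B i j (as[l := sv_D a]) = - lvar l * B i j (as[l := a])"
    proof cases
      case 1
      have m: "map ((!) (as[l := x])) ?ks = map ((!) as) ?ks" for x
        using 1 others(2)[of n i j] by auto
      show ?thesis
        using 1 ij as unfolding B_def m
        by (simp add: sv_bracket_linear sv_sesquilinear lin)
    next
      case 2
      have m: "map ((!) (as[l := x])) ?ks = map ((!) as) ?ks" for x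
        using 2 others(2)[of n i j] by auto
      show ?thesis
        using 2 ij as unfolding B_def m
        by (simp add: sv_bracket_linear sv_sesquilinear lin) (simp add: algebra_simps)
    next
      case 3
      then obtain t where t: "t < length ?ks" "?ks ! t = l"
        using others(2)[of n i j] l by (metis Diff_iff atMost_iff empty_iff in_set_conv_nth insert_iff)
      have m: "map ((!) (as[l := x])) ?ks = (map ((!) as) ?ks)[t := x]" for x
        using t others(1)[of n i j] l as
        by (intro nth_equalityI) (auto simp: nth_list_update nth_eq_iff_index_eq)
      have t': "t < length (map ((!) as) ?ks)" using t by simp
      show ?thesis
        using 3 unfolding B_def m by (simp add: args[OF t'] t(2))
    qed
    then show "B i j (as[l := a + b]) = B i j (as[l := a]) + B i j (as[l := b])"
      "B i j (as[l := sv_scale c a]) = lconst c * B i j (as[l := a])"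
      "B i j (as[l := sv_D a]) = - lvar l * B i j (as[l := a])"
      by blast+
  qed
  have d: "SV.differential n \<gamma> as = (\<Sum>j\<le>n. \<Sum>i<j. (-1) ^ (i + j) * B i j as)"
    if "length as = Suc n" for as
    using that unfolding differential_eq B_def by simp
  show ?thesis
    unfolding multilinear_def
  proof (intro conjI allI impI)
    fix as :: "sv list" assume "length as \<noteq> Suc n"
    then show "SV.differential n \<gamma> as = 0" by (simp add: differential_eq)
  next
    fix as :: "sv list" and l a b
    assume "length as = Suc n \<and> l < Suc n"
    then have as: "length as = Suc n" "l \<le> n" by simp_all
    show "SV.differential n \<gamma> (as[l := a + b]) =
        SV.differential n \<gamma> (as[l := a]) + SV.differential n \<gamma> (as[l := b])"
      using as by (simp add: d B(1) distrib_left sum.distrib)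
  next
    fix as :: "sv list" and l c a
    assume "length as = Suc n \<and> l < Suc n"
    then have as: "length as = Suc n" "l \<le> n" by simp_all
    show "SV.differential n \<gamma> (as[l := sv_scale c a]) = lconst c * SV.differential n \<gamma> (as[l := a])"
      using as by (simp add: d B(2) sum_distrib_left mult.left_commute)
  next
    fix as :: "sv list" and l a
    assume "length as = Suc n \<and> l < Suc n"
    then have as: "length as = Suc n" "l \<le> n" by simp_all
    show "SV.differential n \<gamma> (as[l := sv_D a]) = - lvar l * SV.differential n \<gamma> (as[l := a])"
      using as by (simp add: d B(3) sum_distrib_left sum_negf mult.left_commute)
  qed
qed

section \<open>Coefficients of cochains\<close>

definition coef :: "nat \<Rightarrow> (sv list \<Rightarrow> lpoly) \<Rightarrow> mode list \<Rightarrow> complex" where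
  "coef n \<gamma> xs = (if length xs = n then (\<Prod>x\<leftarrow>xs. fact (snd x)) *
     Poly_Mapping.lookup (\<gamma> (map (gen \<circ> fst) xs)) (Poly_Mapping.nth (map snd xs)) else 0)"

lemma coef_lincomb:
  "coef n (\<lambda>as. lconst a * \<gamma> as + lconst b * \<delta> as) xs = a * coef n \<gamma> xs + b * coef n \<delta> xs"
  by (simp add: coef_def lookup_add distrib_left)

lemma monomial_eq_nth:
  fixes K :: "nat \<Rightarrow>\<^sub>0 nat"
  assumes "Poly_Mapping.keys K \<subseteq> {..<n}"
  shows "Poly_Mapping.nth (map (Poly_Mapping.lookup K) [0..<n]) = K"
  using assms by (intro poly_mapping_eqI) (auto simp: nth_default_def in_keys_iff)

text \<open>Multilinear polynomial maps instead of cochains, so that it applies to a differential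
  whose skew-symmetry is not yet known.\<close>

lemma coef_eqI:
  assumes \<gamma>: "multilinear n \<gamma>" "\<And>as. length as = n \<Longrightarrow> \<gamma> as \<in> lpolys n"
    and \<delta>: "multilinear n \<delta>" "\<And>as. length as = n \<Longrightarrow> \<delta> as \<in> lpolys n"
    and eq: "coef n \<gamma> = coef n \<delta>"
  shows "\<gamma> = \<delta>"
proof (rule multilinear_eqI[OF \<gamma>(1) \<delta>(1)])
  fix gs :: "sv_gen list"
  assume gs: "length gs = n"
  show "\<gamma> (map gen gs) = \<delta> (map gen gs)"
  proof (rule poly_mapping_eqI)
    fix K
    have lp: "\<gamma> (map gen gs) \<in> lpolys n" "\<delta> (map gen gs) \<in> lpolys n"
      using \<gamma>(2) \<delta>(2) gs by simp_all
    show "Poly_Mapping.lookup (\<gamma> (map gen gs)) K = Poly_Mapping.lookup (\<delta> (map gen gs)) K"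
    proof (cases "Poly_Mapping.keys K \<subseteq> {..<n}")
      case True
      let ?xs = "zip gs (map (Poly_Mapping.lookup K) [0..<n])"
      have m: "map snd ?xs = map (Poly_Mapping.lookup K) [0..<n]" "map (gen \<circ> fst) ?xs = map gen gs"
        using gs by (simp_all add: map_zip_map2[symmetric] flip: map_map)
      have "(\<Prod>x\<leftarrow>?xs. fact (snd x) :: complex) \<noteq> 0"
        by (auto simp: prod_list_zero_iff)
      moreover have "coef n \<gamma> ?xs = coef n \<delta> ?xs"
        using eq by simp
      ultimately show ?thesis
        using gs unfolding coef_def m monomial_eq_nth[OF True] by simp
    next
      case False
      then show ?thesis using lp unfolding lpolys_iff by metis
    qed
  qed
qed

lemma coef_inj: "\<gamma> \<in> SV.cochains n \<Longrightarrow> \<delta> \<in> SV.cochains n \<Longrightarrow> coef n \<gamma> = coef n \<delta> \<Longrightarrow> \<gamma> = \<delta>"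
  by (rule coef_eqI) (simp_all add: cochains_iff)

lemma map_key_nth_permute:
  assumes "\<sigma> permutes {..<length ks}"
  shows "Poly_Mapping.map_key \<sigma> (Poly_Mapping.nth ks) = Poly_Mapping.nth (permute_list \<sigma> ks)"
proof (rule poly_mapping_eqI)
  fix i
  have "\<sigma> i < length ks \<longleftrightarrow> i < length ks"
    using permutes_in_image[OF assms, of i] by simp
  then show "Poly_Mapping.lookup (Poly_Mapping.map_key \<sigma> (Poly_Mapping.nth ks)) i =
      Poly_Mapping.lookup (Poly_Mapping.nth (permute_list \<sigma> ks)) i"
    using assms by (simp add: map_key.rep_eq permutes_inj nth_default_def permute_list_nth)
qed

text \<open>The substitution permutes exponents exactly as \<open>permute_list\<close> permutes the
  arguments, and the product of factorials is symmetric.\<close>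

lemma coef_permute:
  assumes \<gamma>: "\<gamma> \<in> SV.cochains n" and \<sigma>: "\<sigma> permutes {..<n}" and xs: "length xs = n"
  shows "coef n \<gamma> (permute_list \<sigma> xs) = of_int (sign \<sigma>) * coef n \<gamma> xs"
proof -
  let ?as = "map (gen \<circ> fst) xs" and ?K = "Poly_Mapping.nth (map snd xs)"
  have "lsubst (\<lambda>i. lvar (\<sigma> i)) (\<gamma> (permute_list \<sigma> ?as)) = of_int (sign \<sigma>) * \<gamma> ?as"
    using \<gamma> \<sigma> xs by (simp add: cochains_iff)
  moreover have "(of_int (sign \<sigma>) :: lpoly) = lconst (of_int (sign \<sigma>))"
    by (simp add: lconst_def)
  ultimately have "Poly_Mapping.lookup (\<gamma> (permute_list \<sigma> ?as)) (Poly_Mapping.map_key \<sigma> ?K) =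
      of_int (sign \<sigma>) * Poly_Mapping.lookup (\<gamma> ?as) ?K"
    by (metis lookup_lsubst_permute permutes_bij[OF \<sigma>] lookup_lconst_mult)
  moreover have "Poly_Mapping.map_key \<sigma> ?K = Poly_Mapping.nth (map snd (permute_list \<sigma> xs))"
    using \<sigma> xs by (simp add: map_key_nth_permute permute_list_map)
  moreover have "(\<Prod>x\<leftarrow>permute_list \<sigma> xs. fact (snd x) :: complex) = (\<Prod>x\<leftarrow>xs. fact (snd x))"
  proof -
    have "prod_mset (mset (map (\<lambda>x. fact (snd x) :: complex) (permute_list \<sigma> xs))) =
        prod_mset (mset (map (\<lambda>x. fact (snd x)) xs))"
      using \<sigma> xs by simp
    then show ?thesis
      by (simp only: prod_mset_prod_list)
  qed
  ultimately show ?thesis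
    using \<sigma> xs by (simp add: coef_def permute_list_map)
qed

lemma permute_list_adjacent:
  "permute_list (transpose (length us) (Suc (length us))) (us @ x # y # vs) = us @ y # x # vs"
proof (rule nth_equalityI)
  let ?l = "us @ x # y # vs" and ?\<sigma> = "transpose (length us) (Suc (length us))"
  fix i
  assume "i < length (permute_list ?\<sigma> ?l)"
  then have e: "permute_list ?\<sigma> ?l ! i = ?l ! ?\<sigma> i"
    by (simp add: permute_list_def del: upt_Suc)
  consider "i < length us" | "i = length us" | "i = Suc (length us)"
    | t where "i = length us + Suc (Suc t)"
    by (metis less_natE linorder_neqE_nat not_less_eq add_Suc_right less_antisym)
  then show "permute_list ?\<sigma> ?l ! i = (us @ y # x # vs) ! i"
    unfolding e by cases (simp_all add: nth_append transpose_def)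
qed simp

lemma finite_gen_lists: "finite {gs :: sv_gen list. length gs = n}"
proof -
  have "{gs :: sv_gen list. length gs = n} = {gs. set gs \<subseteq> {L, Y, M} \<and> length gs = n}"
    using sv_gen.exhaust by blast
  then show ?thesis
    using finite_lists_length_eq[of "{L, Y, M}" n] by simp
qed

lemma coef_mcochains:
  assumes \<gamma>: "\<gamma> \<in> SV.cochains n"
  shows "coef n \<gamma> \<in> mcochains n"
proof -
  have "coef n \<gamma> (us @ x # y # vs) = - coef n \<gamma> (us @ y # x # vs)" for us x y vs
  proof (cases "length (us @ x # y # vs) = n")
    case True
    let ?\<sigma> = "transpose (length us) (Suc (length us))"
    have "?\<sigma> permutes {..<n}"
      using True by (intro permutes_swap_id) auto
    from coef_permute[OF \<gamma> this True] show ?thesis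
      by (simp add: permute_list_adjacent sign_swap_id)
  qed (simp add: coef_def)
  then have "alternating (coef n \<gamma>)"
    unfolding alternating_def by blast
  moreover
  define S where "S = (\<Union>gs\<in>{gs. length gs = n}. Poly_Mapping.keys (\<gamma> (map gen gs)))"
  have S: "finite S"
    unfolding S_def using finite_gen_lists by simp
  \<comment> \<open>A crude common bound: all exponents of all monomials in the values on the
    finitely many generator tuples, added up.\<close>
  define N where "N = (\<Sum>K\<in>S. \<Sum>i\<in>Poly_Mapping.keys K. Poly_Mapping.lookup K i)"
  have lookup_le: "Poly_Mapping.lookup K i \<le> (\<Sum>i\<in>Poly_Mapping.keys K. Poly_Mapping.lookup K i)"
    for K :: "nat \<Rightarrow>\<^sub>0 nat" and i
    by (cases "i \<in> Poly_Mapping.keys K") (auto intro: member_le_sum simp: in_keys_iff)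
  have "length xs = n \<and> (\<forall>x\<in>set xs. snd x \<le> N)" if nz: "coef n \<gamma> xs \<noteq> 0" for xs
  proof
    show len: "length xs = n"
      using nz by (auto simp: coef_def split: if_splits)
    let ?K = "Poly_Mapping.nth (map snd xs)"
    have "?K \<in> Poly_Mapping.keys (\<gamma> (map gen (map fst xs)))"
      using nz by (auto simp: coef_def in_keys_iff split: if_splits)
    then have K: "?K \<in> S"
      unfolding S_def using len by (metis (mono_tags) UN_I length_map mem_Collect_eq)
    show "\<forall>x\<in>set xs. snd x \<le> N"
    proof
      fix x
      assume "x \<in> set xs"
      then obtain i where i: "i < length xs" "x = xs ! i" by (metis in_set_conv_nth)
      then have "snd x = Poly_Mapping.lookup ?K i" by (simp add: nth_default_def)
      also have "\<dots> \<le> (\<Sum>i\<in>Poly_Mapping.keys ?K. Poly_Mapping.lookup ?K i)"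
        by (rule lookup_le)
      also have "\<dots> \<le> N"
        unfolding N_def
        using member_le_sum[OF K, of "\<lambda>K. \<Sum>i\<in>Poly_Mapping.keys K. Poly_Mapping.lookup K i"] S
        by simp
      finally show "snd x \<le> N" .
    qed
  qed
  ultimately show ?thesis
    unfolding mcochains_def by blast
qed

text \<open>With a and b the values of \<open>lcoef\<close> and \<open>rcoef\<close>, the operator
  -b \<partial> + (a - b) \<lambda> is the one that becomes a \<lambda>_i + b \<lambda>_j when
  \<partial> is replaced by -(\<lambda>_i + \<lambda>_j) and \<lambda> by \<lambda>_i.\<close>

lemma sv_bracket_gen: "sv_bracket (gen g) (gen h) =
    map_poly (sv_scale (- rcoef g h)) (map_poly sv_D [:gen (gprod g h):]) +
    pCons 0 (map_poly (sv_scale (lcoef g h - rcoef g h)) [:gen (gprod g h):])"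
  by (rule sv_ev_eqI, cases g; cases h) (simp_all add: sv_ev_bracket)

lemma lconst_diff: "lconst (c - d) = lconst c - lconst d"
  by (simp add: lconst_def single_diff)

lemma bracket_term_gen:
  assumes ml: "multilinear n \<gamma>" and len: "Suc (length bs) = n"
  shows "bracket_term ks i j \<gamma> (sv_bracket (gen g) (gen h)) bs =
    (lconst (lcoef g h) * lvar i + lconst (rcoef g h) * lvar j) *
      lsubst (case_nat (lvar i + lvar j) (\<lambda>l. lvar (ks ! l))) (\<gamma> (gen (gprod g h) # bs))"
proof -
  have "bracket_term ks i j \<gamma> [:gen (gprod g h):] bs =
      lsubst (case_nat (lvar i + lvar j) (\<lambda>l. lvar (ks ! l))) (\<gamma> (gen (gprod g h) # bs))"
    by (simp add: bracket_term_def)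
  then show ?thesis
    unfolding sv_bracket_gen bracket_term_linear[OF ml len] lconst_diff by (simp add: algebra_simps)
qed

text \<open>By \<open>cd_sum\<close>, both sides are sums over i < j with the same signs. The
  summands agree by \<open>lookup_bracket_subst\<close>, the factorials of the remaining arguments
  being carried along.\<close>

lemma coef_differential:
  assumes \<gamma>: "\<gamma> \<in> SV.cochains n"
  shows "coef (Suc n) (SV.differential n \<gamma>) = cd (coef n \<gamma>)"
proof
  fix xs
  note mc = coef_mcochains[OF \<gamma>]
  show "coef (Suc n) (SV.differential n \<gamma>) xs = cd (coef n \<gamma>) xs"
  proof (cases "length xs = Suc n")
    case False
    then show ?thesis
      using mcochainsD(2)[OF mcochains_cd[OF mc]] by (simp add: coef_def)
  next
    case len: True
    let ?as = "map (gen \<circ> fst) xs" and ?K = "Poly_Mapping.nth (map snd xs)"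
    let ?f = "\<lambda>k. fact (snd (xs ! k)) :: complex"
    define B where "B i j = bracket_term (others n i j) i j \<gamma> (sv_bracket (?as ! i) (?as ! j))
      (map ((!) ?as) (others n i j))" for i j
    have pl: "(\<Prod>x\<leftarrow>xs. fact (snd x)) = (\<Prod>k\<le>n. ?f k)"
      using len by (simp add: prod.list_conv_set_nth atLeast0LessThan lessThan_Suc_atMost)
    have B: "(\<Prod>k\<le>n. ?f k) * Poly_Mapping.lookup (B i j) ?K =
        mcoef (xs ! i) (xs ! j) * coef n \<gamma> (mprod (xs ! i) (xs ! j) # map ((!) xs) (others n i j))"
      if ij: "i < j" "j \<le> n" for i j
    proof -
      let ?ks = "others n i j" and ?w = "gprod (fst (xs ! i)) (fst (xs ! j))"
      have lks: "Suc (length ?ks) = n" using length_others[OF ij] .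
      have ml: "multilinear n \<gamma>" using \<gamma> by (simp add: cochains_iff)
      let ?bs = "map ((!) ?as) ?ks"
      have bs: "?bs = map (gen \<circ> fst) (map ((!) xs) ?ks)"
        using others(2)[of n i j] len by auto
      have Kk: "Poly_Mapping.lookup ?K k = snd (xs ! k)" if "k \<le> n" for k
        using that len by (simp add: nth_default_def)
      have Kks: "map (Poly_Mapping.lookup ?K) ?ks = map snd (map ((!) xs) ?ks)"
        using others(2)[of n i j] Kk by auto
      have "{..n} = insert i (insert j (set ?ks))"
        unfolding others(2) using ij by auto
      then have "(\<Prod>k\<le>n. ?f k) = (\<Prod>k\<in>insert i (insert j (set ?ks)). ?f k)"
        by simp
      also have "\<dots> = ?f i * (?f j * (\<Prod>k\<in>set ?ks. ?f k))"
        using ij by (simp add: others(2))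
      also have "(\<Prod>k\<in>set ?ks. ?f k) = (\<Prod>x\<leftarrow>map ((!) xs) ?ks. fact (snd x))"
        using prod.distinct_set_conv_list[OF others(1), of ?f n i j] by (simp add: o_def)
      finally have fac: "(\<Prod>k\<le>n. ?f k) = ?f i * (?f j * (\<Prod>x\<leftarrow>map ((!) xs) ?ks. fact (snd x)))" .
      have q: "\<gamma> (gen ?w # ?bs) \<in> lpolys (Suc (length ?ks))"
        using \<gamma> lks by (simp add: cochains_iff)
      have d: "distinct (i # j # ?ks)"
        using ij by (simp add: others)
      have keys: "Poly_Mapping.keys ?K \<subseteq> insert i (insert j (set ?ks))"
      proof
        fix k
        assume "k \<in> Poly_Mapping.keys ?K"
        then have "k \<le> n"
          using len by (auto simp: in_keys_iff nth_default_def simp del: keys_nth split: if_splits)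
        then show "k \<in> insert i (insert j (set ?ks))"
          unfolding others(2) by blast
      qed
      have "B i j = (lconst (lcoef (fst (xs ! i)) (fst (xs ! j))) * lvar i +
          lconst (rcoef (fst (xs ! i)) (fst (xs ! j))) * lvar j) *
          lsubst (case_nat (lvar i + lvar j) (\<lambda>l. lvar (?ks ! l))) (\<gamma> (gen ?w # ?bs))"
        unfolding B_def using bracket_term_gen[OF ml, of ?bs] lks ij len by simp
      then have "?f i * ?f j * Poly_Mapping.lookup (B i j) ?K = mcoef (xs ! i) (xs ! j) *
          (fact (snd (xs ! i) + snd (xs ! j) - 1) * Poly_Mapping.lookup (\<gamma> (gen ?w # ?bs))
            (Poly_Mapping.nth ((snd (xs ! i) + snd (xs ! j) - 1) # map snd (map ((!) xs) ?ks))))"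
        using lookup_bracket_subst[OF q d keys, of "lcoef (fst (xs ! i)) (fst (xs ! j))"
            "rcoef (fst (xs ! i)) (fst (xs ! j))"] Kk[of i] Kk[of j] ij
        unfolding Kks mcoef_def by simp
      then show ?thesis
        unfolding fac using lks by (simp add: coef_def mprod_def bs mult_ac del: map_map)
    qed
    have "coef (Suc n) (SV.differential n \<gamma>) xs = (\<Prod>k\<le>n. ?f k) *
        Poly_Mapping.lookup (\<Sum>j\<le>n. \<Sum>i<j. (-1) ^ (i + j) * B i j) ?K"
      using len by (simp add: coef_def pl differential_eq B_def del: lookup_nth)
    also have "\<dots> = (\<Sum>j\<le>n. \<Sum>i<j. (-1) ^ (i + j) * ((\<Prod>k\<le>n. ?f k) * Poly_Mapping.lookup (B i j) ?K))"
    proof -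
      have "Poly_Mapping.lookup ((-1) ^ m * p) K = (-1) ^ m * Poly_Mapping.lookup p K"
        for m K and p :: lpoly
        by (cases "even m") simp_all
      then show ?thesis
        by (simp add: lookup_sum sum_distrib_left mult.left_commute)
    qed
    also have "\<dots> = (\<Sum>j\<le>n. \<Sum>i<j. (-1) ^ (i + j) * (mcoef (xs ! i) (xs ! j) *
        coef n \<gamma> (mprod (xs ! i) (xs ! j) # map ((!) xs) (others n i j))))"
      by (intro sum.cong refl) (simp add: B)
    also have "\<dots> = cd (coef n \<gamma>) xs"
      unfolding cd_sum[OF mcochainsD(1)[OF mc]] len others_def lessThan_Suc_atMost ..
    finally show ?thesis .
  qed
qed

section \<open>Cochains from their coefficients\<close>

lemma alternating_append: "alternating f \<Longrightarrow> alternating (\<lambda>zs. f (us @ zs))"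
  unfolding alternating_def by (metis append_assoc)

lemma alternating_swap:
  assumes f: "alternating f"
  shows "f (us @ x # ms @ y # vs) = - f (us @ y # ms @ x # vs)"
proof -
  let ?g = "\<lambda>zs. f (us @ zs)"
  have g: "alternating ?g" using f by (rule alternating_append)
  have "?g (x # ms @ y # vs) = (-1) ^ length ms * ?g (ms @ x # y # vs)"
    by (rule alternating_move[OF g])
  also have "?g (ms @ x # y # vs) = - ?g (ms @ y # x # vs)"
    by (rule alternatingD[OF g])
  also have "(-1) ^ length ms * - ?g (ms @ y # x # vs) = - ((-1) ^ length ms * ?g (ms @ y # x # vs))"
    by simp
  also have "(-1) ^ length ms * ?g (ms @ y # x # vs) = ?g (y # ms @ x # vs)"
    by (rule alternating_move[OF g, symmetric])
  finally show ?thesis .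
qed

lemma alternating_transpose:
  assumes f: "alternating f" and ab: "a < b" "b < length xs"
  shows "f (permute_list (transpose a b) xs) = - f xs"
proof -
  define us ms vs where "us = take a xs" and "ms = take (b - Suc a) (drop (Suc a) xs)"
    and "vs = drop (Suc b) xs"
  have len: "length us = a" "length ms = b - Suc a"
    using ab by (simp_all add: us_def ms_def)
  have "drop (Suc a) xs = ms @ drop (b - Suc a) (drop (Suc a) xs)"
    unfolding ms_def by (rule append_take_drop_id[symmetric])
  also have "drop (b - Suc a) (drop (Suc a) xs) = xs ! b # vs"
    using ab by (simp add: vs_def Cons_nth_drop_Suc del: append_take_drop_id)
  finally have xs: "xs = us @ xs ! a # ms @ xs ! b # vs"
    using ab id_take_nth_drop[of a xs] by (simp add: us_def)
  have "permute_list (transpose a b) xs = us @ xs ! b # ms @ xs ! a # vs"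
  proof (rule nth_equalityI)
    show "length (permute_list (transpose a b) xs) = length (us @ xs ! b # ms @ xs ! a # vs)"
      using arg_cong[OF xs, of length] by simp
    fix i
    assume "i < length (permute_list (transpose a b) xs)"
    then have e: "permute_list (transpose a b) xs ! i = xs ! transpose a b i"
      by (simp add: permute_list_def)
    have nth: "(us @ u # ms @ v # vs) ! i =
        (if i = a then u else if i = b then v else (us @ xs ! a # ms @ xs ! b # vs) ! i)" for u v
      using len ab by (auto simp: nth_append nth_Cons' )
    show "permute_list (transpose a b) xs ! i = (us @ xs ! b # ms @ xs ! a # vs) ! i"
      unfolding e nth[of "xs ! b" "xs ! a"] xs[symmetric] by (simp add: transpose_def)
  qed
  then show ?thesis
    using alternating_swap[OF f, of us "xs ! b" ms "xs ! a" vs] xs by simp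
qed

lemma alternating_permute:
  assumes f: "alternating f" and \<sigma>: "\<sigma> permutes {..<length xs}"
  shows "f (permute_list \<sigma> xs) = of_int (sign \<sigma>) * f xs"
  using finite_lessThan \<sigma>
proof (induction \<sigma> rule: permutes_rev_induct)
  case id
  show ?case by simp
next
  case (swap a b p)
  have t: "transpose a b permutes {..<length xs}"
    using swap by (intro permutes_swap_id)
  have "f (permute_list (transpose a b) ys) = - f ys" if "length ys = length xs" for ys
  proof (cases "a < b")
    case True
    then show ?thesis using swap that by (intro alternating_transpose[OF f]) auto
  next
    case False
    then have "f (permute_list (transpose b a) ys) = - f ys"
      using swap that by (intro alternating_transpose[OF f]) auto
    then show ?thesis by (simp add: transpose_commute)
  qed
  then have "f (permute_list (p \<circ> transpose a b) xs) = - (of_int (sign p) * f xs)"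
    using swap.IH permute_list_compose[OF t, of p] by simp
  moreover have "sign (p \<circ> transpose a b) = - sign p"
    using swap by (simp add: sign_compose permutation_swap_id sign_swap_id
        permutes_imp_permutation[OF finite_lessThan])
  ultimately show ?case
    by (simp only: of_int_minus mult_minus_left)
qed

text \<open>\<open>lev i p\<close> is $p(-\lambda_i)$, since $\partial$ in the \<open>i\<close>-th argument of a cochain acts as
  multiplication by $-\lambda_i$.\<close>

definition lev :: "nat \<Rightarrow> complex poly \<Rightarrow> lpoly" where
  "lev i p = (\<Sum>k\<le>degree p. lconst (coeff p k) * (- lvar i) ^ k)"

lemma lev_bound: "degree p \<le> N \<Longrightarrow> lev i p = (\<Sum>k\<le>N. lconst (coeff p k) * (- lvar i) ^ k)"
  unfolding lev_def by (rule sum.mono_neutral_left) (auto simp: coeff_eq_0)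

lemma lev_simps:
  "lev i (p + q) = lev i p + lev i q"
  "lev i (Polynomial.smult c p) = lconst c * lev i p"
  "lev i (pCons 0 p) = - lvar i * lev i p"
  "lev i 0 = 0" "lev i 1 = 1"
proof -
  let ?N = "max (degree p) (degree q)"
  show "lev i (p + q) = lev i p + lev i q"
    by (simp add: lev_bound[of _ ?N] degree_add_le_max lconst_add distrib_right sum.distrib)
  show "lev i (Polynomial.smult c p) = lconst c * lev i p"
    by (simp add: lev_bound[of _ "degree p"] lconst_mult sum_distrib_left mult.assoc)
  show "lev i (pCons 0 p) = - lvar i * lev i p"
    unfolding lev_bound[of "pCons 0 p" "Suc (degree p)", OF degree_pCons_le] sum.atMost_Suc_shift
    by (simp add: lev_def sum_distrib_left sum_negf mult.left_commute)
qed (simp_all add: lev_def)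

lemma lsubst_lev: "lsubst (\<lambda>i. lvar (\<sigma> i)) (lev i p) = lev (\<sigma> i) p"
  by (simp add: lev_def lsubst_sum lsubst_mult lsubst_power lsubst_uminus)

lemma lpolys_lev: "i < n \<Longrightarrow> lev i p \<in> lpolys n"
  unfolding lev_def by (intro lpolys_sum lpolys_mult lpolys_power lpolys_uminus) simp_all

definition gen_value :: "(mode list \<Rightarrow> complex) \<Rightarrow> sv_gen list \<Rightarrow> lpoly" where
  "gen_value f gs = Abs_poly_mapping (\<lambda>K. if Poly_Mapping.keys K \<subseteq> {..<length gs}
     then f (map (\<lambda>i. (gs ! i, Poly_Mapping.lookup K i)) [0..<length gs]) /
       (\<Prod>i<length gs. fact (Poly_Mapping.lookup K i)) else 0)"

text \<open>The index bound of \<open>mcochains\<close> leaves finitely many monomials with nonzero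
  coefficient, which is what \<open>Abs_poly_mapping\<close> requires.\<close>

lemma lookup_gen_value:
  assumes f: "f \<in> mcochains (length gs)"
  shows "Poly_Mapping.lookup (gen_value f gs) K = (if Poly_Mapping.keys K \<subseteq> {..<length gs}
     then f (map (\<lambda>i. (gs ! i, Poly_Mapping.lookup K i)) [0..<length gs]) /
       (\<Prod>i<length gs. fact (Poly_Mapping.lookup K i)) else 0)"
proof -
  let ?n = "length gs"
  obtain N where N: "\<And>xs. f xs \<noteq> 0 \<Longrightarrow> \<forall>x\<in>set xs. snd x \<le> N"
    using f by (auto simp: mcochains_def)
  let ?F = "\<lambda>K. if Poly_Mapping.keys K \<subseteq> {..<?n}
     then f (map (\<lambda>i. (gs ! i, Poly_Mapping.lookup K i)) [0..<?n]) /
       (\<Prod>i<?n. fact (Poly_Mapping.lookup K i)) else 0"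
  have "{K. ?F K \<noteq> 0} \<subseteq> Poly_Mapping.nth ` {ks. set ks \<subseteq> {..N} \<and> length ks = ?n}"
  proof
    fix K
    assume "K \<in> {K. ?F K \<noteq> 0}"
    then have K: "Poly_Mapping.keys K \<subseteq> {..<?n}"
      and nz: "f (map (\<lambda>i. (gs ! i, Poly_Mapping.lookup K i)) [0..<?n]) \<noteq> 0"
      by (auto split: if_splits)
    have "set (map (Poly_Mapping.lookup K) [0..<?n]) \<subseteq> {..N}"
      using N[OF nz] by auto
    then have "map (Poly_Mapping.lookup K) [0..<?n] \<in> {ks. set ks \<subseteq> {..N} \<and> length ks = ?n}"
      by simp
    then show "K \<in> Poly_Mapping.nth ` {ks. set ks \<subseteq> {..N} \<and> length ks = ?n}"
      by (rule rev_image_eqI) (rule monomial_eq_nth[OF K, symmetric])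
  qed
  then have "finite {K. ?F K \<noteq> 0}"
    by (rule finite_subset) (intro finite_imageI finite_lists_length_eq finite_atMost)
  then show ?thesis
    unfolding gen_value_def by (subst lookup_Abs_poly_mapping) simp_all
qed

lemma gen_value_permute:
  assumes f: "f \<in> mcochains n" and \<sigma>: "\<sigma> permutes {..<n}" and gs: "length gs = n"
  shows "lsubst (\<lambda>i. lvar (\<sigma> i)) (gen_value f (permute_list \<sigma> gs)) = of_int (sign \<sigma>) * gen_value f gs"
proof (rule poly_mapping_eqI)
  fix K :: "nat \<Rightarrow>\<^sub>0 nat"
  let ?K = "Poly_Mapping.map_key \<sigma> K"
  have lk: "Poly_Mapping.lookup ?K i = Poly_Mapping.lookup K (\<sigma> i)" for i
    by (simp add: map_key.rep_eq permutes_inj[OF \<sigma>])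
  have keys: "Poly_Mapping.keys ?K \<subseteq> {..<n} \<longleftrightarrow> Poly_Mapping.keys K \<subseteq> {..<n}"
  proof
    assume l: "Poly_Mapping.keys ?K \<subseteq> {..<n}"
    show "Poly_Mapping.keys K \<subseteq> {..<n}"
    proof
      fix i
      assume "i \<in> Poly_Mapping.keys K"
      then have "inv_into UNIV \<sigma> i \<in> Poly_Mapping.keys ?K"
        using permutes_inverses(1)[OF \<sigma>, of i] by (simp add: in_keys_iff lk)
      then have "inv_into UNIV \<sigma> i \<in> {..<n}" using l by blast
      then show "i \<in> {..<n}"
        using permutes_in_image[OF \<sigma>, of "inv_into UNIV \<sigma> i"] permutes_inverses(1)[OF \<sigma>, of i] by simp
    qed
  next
    assume r: "Poly_Mapping.keys K \<subseteq> {..<n}"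
    show "Poly_Mapping.keys ?K \<subseteq> {..<n}"
    proof
      fix i
      assume "i \<in> Poly_Mapping.keys ?K"
      then have "\<sigma> i \<in> Poly_Mapping.keys K"
        by (simp add: in_keys_iff lk)
      then have "\<sigma> i \<in> {..<n}"
        using r by blast
      then show "i \<in> {..<n}"
        using permutes_in_image[OF \<sigma>] by blast
    qed
  qed
  let ?xs = "map (\<lambda>i. (gs ! i, Poly_Mapping.lookup K i)) [0..<n]"
  have "map (\<lambda>i. (permute_list \<sigma> gs ! i, Poly_Mapping.lookup ?K i)) [0..<n] = permute_list \<sigma> ?xs"
  proof (rule nth_equalityI)
    fix i
    assume "i < length (map (\<lambda>i. (permute_list \<sigma> gs ! i, Poly_Mapping.lookup ?K i)) [0..<n])"
    then have "i < n" by simp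
    moreover from this have "\<sigma> i < n"
      using permutes_in_image[OF \<sigma>, of i] by simp
    ultimately show "map (\<lambda>i. (permute_list \<sigma> gs ! i, Poly_Mapping.lookup ?K i)) [0..<n] ! i =
        permute_list \<sigma> ?xs ! i"
      using \<sigma> gs by (simp add: permute_list_nth lk)
  qed simp
  moreover have "f (permute_list \<sigma> ?xs) = of_int (sign \<sigma>) * f ?xs"
    using alternating_permute[OF mcochainsD(1)[OF f], of \<sigma> ?xs] \<sigma> by simp
  moreover have "(\<Prod>i<n. fact (Poly_Mapping.lookup ?K i) :: complex) = (\<Prod>i<n. fact (Poly_Mapping.lookup K i))"
    unfolding lk using prod.permute[OF \<sigma>, of "\<lambda>i. fact (Poly_Mapping.lookup K i) :: complex"]
    by (simp add: o_def)
  moreover have "(of_int (sign \<sigma>) :: lpoly) = lconst (of_int (sign \<sigma>))"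
    by (simp add: lconst_def)
  ultimately show "Poly_Mapping.lookup (lsubst (\<lambda>i. lvar (\<sigma> i)) (gen_value f (permute_list \<sigma> gs))) K =
      Poly_Mapping.lookup (of_int (sign \<sigma>) * gen_value f gs) K"
    using f gs by (simp add: lookup_lsubst_permute permutes_bij[OF \<sigma>] lookup_gen_value keys)
qed

text \<open>Each argument is expanded as a sum of p_g(\<partial>) g over the generators, and
  p_g(\<partial>) in position i becomes p_g(-\<lambda>_i). This is the sesquilinear extension from
  generators.\<close>

definition of_coef :: "nat \<Rightarrow> (mode list \<Rightarrow> complex) \<Rightarrow> sv list \<Rightarrow> lpoly" where
  "of_coef n f as = (if length as = n then
     \<Sum>gs | length gs = n. (\<Prod>i<n. lev i (Poly_Mapping.lookup (as ! i) (gs ! i))) * gen_value f gs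
   else 0)"

lemma of_coef_gen:
  assumes hs: "length hs = n"
  shows "of_coef n f (map gen hs) = gen_value f hs"
proof -
  have lev_gen: "lev i (Poly_Mapping.lookup (gen h) g) = (if g = h then 1 else 0)" for i g h
    by (simp add: gen_def lookup_single when_def lev_simps)
  have "(\<Prod>i<n. lev i (Poly_Mapping.lookup (map gen hs ! i) (gs ! i))) = (if gs = hs then 1 else 0)"
    if gs: "length gs = n" for gs
  proof (cases "gs = hs")
    case True
    then show ?thesis using hs by (simp add: lev_gen)
  next
    case False
    then obtain i where "i < n" "gs ! i \<noteq> hs ! i"
      using gs hs by (auto simp: list_eq_iff_nth_eq)
    then show ?thesis
      using False hs by (auto simp: lev_gen intro!: prod_zero)
  qed
  then have "of_coef n f (map gen hs) = (\<Sum>gs | length gs = n. if gs = hs then gen_value f hs else 0)"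
    unfolding of_coef_def using hs by (auto intro!: sum.cong)
  then show ?thesis
    using hs finite_gen_lists by simp
qed

lemma of_coef_cochain:
  assumes f: "f \<in> mcochains n"
  shows "of_coef n f \<in> SV.cochains n"
  unfolding cochains_iff
proof (intro conjI allI impI)
  let ?P = "\<lambda>as gs. \<Prod>i<n. lev i (Poly_Mapping.lookup (as ! i) (gs ! i))"
  have P: "?P (as[l := a]) gs = lev l (Poly_Mapping.lookup a (gs ! l)) *
      (\<Prod>i\<in>{..<n} - {l}. lev i (Poly_Mapping.lookup (as ! i) (gs ! i)))"
    if "length as = n" "l < n" for as :: "sv list" and l a gs
  proof -
    have "?P (as[l := a]) gs = lev l (Poly_Mapping.lookup (as[l := a] ! l) (gs ! l)) *
        (\<Prod>i\<in>{..<n} - {l}. lev i (Poly_Mapping.lookup (as[l := a] ! i) (gs ! i)))"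
      using that by (intro prod.remove) auto
    also have "(\<Prod>i\<in>{..<n} - {l}. lev i (Poly_Mapping.lookup (as[l := a] ! i) (gs ! i))) =
        (\<Prod>i\<in>{..<n} - {l}. lev i (Poly_Mapping.lookup (as ! i) (gs ! i)))"
      by (rule prod.cong) auto
    finally show ?thesis using that by simp
  qed
  show "multilinear n (of_coef n f)"
    unfolding multilinear_def
  proof (intro conjI allI impI)
    fix as :: "sv list" and l a b assume "length as = n \<and> l < n"
    then show "of_coef n f (as[l := a + b]) = of_coef n f (as[l := a]) + of_coef n f (as[l := b])"
      by (simp add: of_coef_def P lookup_add lev_simps distrib_right sum.distrib)
  next
    fix as :: "sv list" and l c a assume "length as = n \<and> l < n"
    then show "of_coef n f (as[l := sv_scale c a]) = lconst c * of_coef n f (as[l := a])"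
      by (simp add: of_coef_def P lev_simps sum_distrib_left mult.assoc)
  next
    fix as :: "sv list" and l a assume "length as = n \<and> l < n"
    then show "of_coef n f (as[l := sv_D a]) = - lvar l * of_coef n f (as[l := a])"
      by (simp add: of_coef_def P lev_simps sum_distrib_left sum_negf mult.assoc)
  qed (simp add: of_coef_def)
  fix as :: "sv list"
  show "of_coef n f as \<in> lpolys n" if "length as = n"
  proof -
    have "gen_value f gs \<in> lpolys n" if "length gs = n" for gs
      using lookup_gen_value[of f gs] f that unfolding lpolys_iff by (auto split: if_splits)
    then show ?thesis
      unfolding of_coef_def using that
      by (auto intro!: lpolys_sum lpolys_mult lpolys_prod lpolys_lev)
  qed
  fix \<sigma>
  assume "length as = n \<and> \<sigma> permutes {..<n}"
  then have as: "length as = n" and \<sigma>: "\<sigma> permutes {..<n}" by simp_all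
  \<comment> \<open>For skew-symmetry, the generator tuples in the sum are permuted along with the
    arguments.\<close>
  have bij: "bij_betw (permute_list \<sigma>) {gs :: sv_gen list. length gs = n} {gs. length gs = n}"
  proof (rule bij_betwI[where g = "permute_list (inv_into UNIV \<sigma>)"])
    show "permute_list (inv_into UNIV \<sigma>) (permute_list \<sigma> gs) = gs" if "gs \<in> {gs :: sv_gen list. length gs = n}" for gs
      using that permute_list_compose[of "inv_into UNIV \<sigma>" gs \<sigma>] permutes_inv[OF \<sigma>] permutes_inv_o(1)[OF \<sigma>] by simp
    show "permute_list \<sigma> (permute_list (inv_into UNIV \<sigma>) gs) = gs" if "gs \<in> {gs :: sv_gen list. length gs = n}" for gs
      using that permute_list_compose[of \<sigma> gs "inv_into UNIV \<sigma>"] \<sigma> permutes_inv_o(2)[OF \<sigma>] by simp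
  qed auto
  have "lsubst (\<lambda>i. lvar (\<sigma> i)) (of_coef n f (permute_list \<sigma> as)) =
      (\<Sum>gs | length gs = n. (\<Prod>i<n. lev (\<sigma> i) (Poly_Mapping.lookup (permute_list \<sigma> as ! i) (gs ! i))) *
         lsubst (\<lambda>i. lvar (\<sigma> i)) (gen_value f gs))"
    using as by (simp add: of_coef_def lsubst_sum lsubst_mult lsubst_prod lsubst_lev)
  also have "\<dots> = (\<Sum>gs | length gs = n.
      (\<Prod>i<n. lev (\<sigma> i) (Poly_Mapping.lookup (permute_list \<sigma> as ! i) (permute_list \<sigma> gs ! i))) *
         lsubst (\<lambda>i. lvar (\<sigma> i)) (gen_value f (permute_list \<sigma> gs)))"
    by (rule sum.reindex_bij_betw[OF bij, symmetric])
  also have "\<dots> = (\<Sum>gs | length gs = n. ?P as gs * (of_int (sign \<sigma>) * gen_value f gs))"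
  proof (rule sum.cong)
    fix gs :: "sv_gen list"
    assume "gs \<in> {gs. length gs = n}"
    then have gs: "length gs = n" by simp
    have "(\<Prod>i<n. lev (\<sigma> i) (Poly_Mapping.lookup (permute_list \<sigma> as ! i) (permute_list \<sigma> gs ! i))) =
        (\<Prod>i<n. lev (\<sigma> i) (Poly_Mapping.lookup (as ! \<sigma> i) (gs ! \<sigma> i)))"
      using as gs \<sigma> by (intro prod.cong) (auto simp: permute_list_nth)
    also have "\<dots> = ?P as gs"
      using prod.permute[OF \<sigma>, of "\<lambda>i. lev i (Poly_Mapping.lookup (as ! i) (gs ! i))"] by (simp add: o_def)
    finally show "(\<Prod>i<n. lev (\<sigma> i) (Poly_Mapping.lookup (permute_list \<sigma> as ! i) (permute_list \<sigma> gs ! i))) *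
         lsubst (\<lambda>i. lvar (\<sigma> i)) (gen_value f (permute_list \<sigma> gs)) =
      ?P as gs * (of_int (sign \<sigma>) * gen_value f gs)"
      using gen_value_permute[OF f \<sigma> gs] by simp
  qed simp
  also have "\<dots> = of_int (sign \<sigma>) * of_coef n f as"
    using as by (simp add: of_coef_def sum_distrib_left mult.left_commute)
  finally show "lsubst (\<lambda>i. lvar (\<sigma> i)) (of_coef n f (permute_list \<sigma> as)) =
      of_int (sign \<sigma>) * of_coef n f as" .
qed

lemma coef_of_coef:
  assumes f: "f \<in> mcochains n"
  shows "coef n (of_coef n f) = f"
proof
  fix xs
  show "coef n (of_coef n f) xs = f xs"
  proof (cases "length xs = n")
    case False
    then show ?thesis using mcochainsD(2)[OF f] by (simp add: coef_def)
  next
    case True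
    let ?K = "Poly_Mapping.nth (map snd xs)" and ?gs = "map fst xs"
    have "of_coef n f (map (gen \<circ> fst) xs) = gen_value f ?gs"
      using of_coef_gen[of ?gs n f] True by simp
    moreover have "Poly_Mapping.keys ?K \<subseteq> {..<n}"
      using True by (auto simp: in_keys_iff nth_default_def simp del: keys_nth split: if_splits)
    moreover have "map (\<lambda>i. (?gs ! i, Poly_Mapping.lookup ?K i)) [0..<n] = xs"
      using True by (intro nth_equalityI) (auto simp: nth_default_def)
    moreover have "(\<Prod>i<n. fact (Poly_Mapping.lookup ?K i) :: complex) = (\<Prod>x\<leftarrow>xs. fact (snd x))"
      using True by (simp add: prod.list_conv_set_nth atLeast0LessThan nth_default_def)
    moreover have "(\<Prod>x\<leftarrow>xs. fact (snd x) :: complex) \<noteq> 0"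
      by (auto simp: prod_list_zero_iff)
    ultimately show ?thesis
      using f True by (simp add: coef_def lookup_gen_value del: lookup_nth keys_nth)
  qed
qed

lemma lpolys_lsubst:
  assumes "q \<in> lpolys m" and "\<And>i. i < m \<Longrightarrow> F i \<in> lpolys n"
  shows "lsubst F q \<in> lpolys n"
  unfolding lsubst_def using assms
  by (auto simp: lpolys_def[of m] intro!: lpolys_sum lpolys_mult lpolys_prod lpolys_power)

lemma lpolys_differential:
  assumes \<gamma>: "\<And>as. length as = n \<Longrightarrow> \<gamma> as \<in> lpolys n" and as: "length as = Suc n"
  shows "SV.differential n \<gamma> as \<in> lpolys (Suc n)"
proof -
  have "bracket_term (others n i j) i j \<gamma> v (map ((!) as) (others n i j)) \<in> lpolys (Suc n)"
    if ij: "i < j" "j \<le> n" for i j v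
  proof -
    have "case_nat (lvar i + lvar j) (\<lambda>l. lvar (others n i j ! l)) l \<in> lpolys (Suc n)" if "l < n" for l
    proof (cases l)
      case 0
      then show ?thesis using ij by (simp add: lpolys_add)
    next
      case (Suc l')
      then have "others n i j ! l' \<in> set (others n i j)"
        using that length_others[OF ij] by simp
      then show ?thesis
        using Suc by (simp add: others(2))
    qed
    then show ?thesis
      unfolding bracket_term_def using length_others[OF ij] ij \<gamma>
      by (intro lpolys_sum lpolys_mult lpolys_power lpolys_lsubst[of _ n]) simp_all
  qed
  moreover have "(-1) ^ k \<in> lpolys m" for k m
    by (intro lpolys_power) (metis lconst_simps(2,3) lpolys_lconst)
  ultimately show ?thesis
    unfolding differential_eq using as by (auto intro!: lpolys_sum lpolys_mult)
qed

text \<open>A direct check of skew-symmetry is avoided: \<open>of_coef\<close> applied to the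
  alternating function \<open>cd (coef n \<gamma>)\<close> is a cochain with the same coefficients
  as the differential, so \<open>coef_eqI\<close> identifies the two.\<close>

lemma differential_cochain:
  assumes \<gamma>: "\<gamma> \<in> SV.cochains n"
  shows "SV.differential n \<gamma> \<in> SV.cochains (Suc n)"
proof -
  let ?\<delta> = "of_coef (Suc n) (cd (coef n \<gamma>))"
  have mc: "cd (coef n \<gamma>) \<in> mcochains (Suc n)"
    using coef_mcochains[OF \<gamma>] by (rule mcochains_cd)
  have \<delta>: "?\<delta> \<in> SV.cochains (Suc n)"
    using mc by (rule of_coef_cochain)
  have "SV.differential n \<gamma> = ?\<delta>"
  proof (rule coef_eqI)
    show "multilinear (Suc n) (SV.differential n \<gamma>)"
      using \<gamma> by (intro multilinear_differential) (simp add: cochains_iff)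
    show "SV.differential n \<gamma> as \<in> lpolys (Suc n)" if "length as = Suc n" for as
      using \<gamma> that by (intro lpolys_differential) (simp_all add: cochains_iff)
    show "coef (Suc n) (SV.differential n \<gamma>) = coef (Suc n) ?\<delta>"
      unfolding coef_differential[OF \<gamma>] coef_of_coef[OF mc] ..
  qed (use \<delta> in \<open>simp_all add: cochains_iff\<close>)
  with \<delta> show ?thesis by simp
qed

section \<open>Bases of quotient vector spaces\<close>

locale quotient_vectorspace = vectorspace K V for K :: "('k, 'm) ring_scheme" and V :: "('k, 'v, 'n) module_scheme" +
  fixes W :: "'v set"
  assumes W: "additive_subgroup W V"
    and W_smult: "c \<in> carrier K \<Longrightarrow> w \<in> W \<Longrightarrow> c \<odot>\<^bsub>V\<^esub> w \<in> W"
begin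

sublocale sub: abelian_subgroup W V
  using W M.abelian_group_axioms by (rule abelian_subgroupI3)

abbreviation Q :: "('k, 'v set) module" where
  "Q \<equiv> quotient_space V W"

abbreviation cls :: "'v \<Rightarrow> 'v set" where
  "cls x \<equiv> W +>\<^bsub>V\<^esub> x"

lemma cls_eq_iff:
  assumes "x \<in> carrier V" and "y \<in> carrier V"
  shows "cls x = cls y \<longleftrightarrow> (\<exists>w\<in>W. x = w \<oplus>\<^bsub>V\<^esub> y)"
proof
  assume "cls x = cls y"
  then have "x \<in> cls y" using sub.a_rcos_self[OF assms(1)] by simp
  then show "\<exists>w\<in>W. x = w \<oplus>\<^bsub>V\<^esub> y" by (auto simp: a_r_coset_def')
next
  assume "\<exists>w\<in>W. x = w \<oplus>\<^bsub>V\<^esub> y"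
  then have "x \<in> cls y" by (auto simp: a_r_coset_def')
  then show "cls x = cls y"
    using M.a_repr_independence[OF _ assms(2) sub.a_subgroup] by simp
qed

lemma carrier_Q: "carrier Q = cls ` carrier V"
  by (auto simp: quotient_space_def A_RCOSETS_def')

lemma zero_Q: "\<zero>\<^bsub>Q\<^esub> = cls \<zero>\<^bsub>V\<^esub>"
  using M.a_coset_add_zero[OF sub.a_subset] by (simp add: quotient_space_def)

lemma add_Q: "x \<in> carrier V \<Longrightarrow> y \<in> carrier V \<Longrightarrow> cls x \<oplus>\<^bsub>Q\<^esub> cls y = cls (x \<oplus>\<^bsub>V\<^esub> y)"
  by (simp add: quotient_space_def sub.a_rcos_sum)

lemma smult_Q:
  assumes c: "c \<in> carrier K" and x: "x \<in> carrier V"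
  shows "c \<odot>\<^bsub>Q\<^esub> cls x = cls (c \<odot>\<^bsub>V\<^esub> x)"
proof -
  have "cls (c \<odot>\<^bsub>V\<^esub> u) = cls (c \<odot>\<^bsub>V\<^esub> x)" if u: "u \<in> cls x" for u
  proof -
    obtain w where w: "w \<in> W" "u = w \<oplus>\<^bsub>V\<^esub> x" using u by (auto simp: a_r_coset_def')
    have wV: "w \<in> carrier V" using w(1) sub.a_subset by blast
    have "c \<odot>\<^bsub>V\<^esub> u = (c \<odot>\<^bsub>V\<^esub> w) \<oplus>\<^bsub>V\<^esub> (c \<odot>\<^bsub>V\<^esub> x)"
      using w wV c x by (simp add: smult_r_distr)
    then show ?thesis
      using W_smult[OF c w(1)] c x w wV by (subst cls_eq_iff) auto
  qed
  then have "(\<Union>u\<in>cls x. cls (c \<odot>\<^bsub>V\<^esub> u)) = (\<Union>u\<in>cls x. cls (c \<odot>\<^bsub>V\<^esub> x))"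
    by (intro SUP_cong) simp_all
  also have "\<dots> = cls (c \<odot>\<^bsub>V\<^esub> x)"
    using sub.a_rcos_self[OF x] by blast
  finally show ?thesis
    by (simp add: quotient_space_def)
qed

lemma vectorspace_Q: "vectorspace K Q"
proof -
  have "abelian_group Q"
  proof (rule abelian_groupI)
    show "\<exists>y\<in>carrier Q. y \<oplus>\<^bsub>Q\<^esub> X = \<zero>\<^bsub>Q\<^esub>" if "X \<in> carrier Q" for X
    proof -
      obtain x where x: "x \<in> carrier V" "X = cls x" using \<open>X \<in> carrier Q\<close> by (auto simp: carrier_Q)
      then show ?thesis
        by (intro bexI[of _ "cls (\<ominus>\<^bsub>V\<^esub> x)"]) (simp_all add: add_Q zero_Q carrier_Q M.l_neg)
    qed
  qed (auto simp: carrier_Q zero_Q add_Q M.a_ac)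
  moreover have "cring K" by (rule R.cring_axioms)
  ultimately have "module K Q"
    by (intro moduleI) (auto simp: carrier_Q smult_Q add_Q smult_l_distr smult_r_distr smult_assoc1)
  then show ?thesis
    using vectorspace_axioms by (simp add: vectorspace_def)
qed

text \<open>\<open>span\<close> and \<open>indep\<close> say that the \<gamma> r form a basis of V
  modulo W, phrased in V, where combinations can be computed. Injectivity is recorded as well
  because a basis is a set, and the dimension is to be the size of R.\<close>

lemma basis_Q:
  assumes fin: "finite R" and \<gamma>: "\<gamma> \<in> R \<rightarrow> carrier V"
    and span: "\<And>v. v \<in> carrier V \<Longrightarrow>
      \<exists>c\<in>R \<rightarrow> carrier K. \<exists>w\<in>W. v = w \<oplus>\<^bsub>V\<^esub> (\<Oplus>\<^bsub>V\<^esub>r\<in>R. c r \<odot>\<^bsub>V\<^esub> \<gamma> r)"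
    and indep: "\<And>c r. c \<in> R \<rightarrow> carrier K \<Longrightarrow> (\<Oplus>\<^bsub>V\<^esub>r\<in>R. c r \<odot>\<^bsub>V\<^esub> \<gamma> r) \<in> W \<Longrightarrow> r \<in> R \<Longrightarrow> c r = \<zero>\<^bsub>K\<^esub>"
  shows "vectorspace.basis K Q ((\<lambda>r. cls (\<gamma> r)) ` R)" and "inj_on (\<lambda>r. cls (\<gamma> r)) R"
proof -
  interpret Q: vectorspace K Q by (rule vectorspace_Q)
  have finsum: "(\<Oplus>\<^bsub>Q\<^esub>r\<in>S. c r \<odot>\<^bsub>Q\<^esub> cls (\<gamma> r)) = cls (\<Oplus>\<^bsub>V\<^esub>r\<in>S. c r \<odot>\<^bsub>V\<^esub> \<gamma> r)"
    if "finite S" "S \<subseteq> R" "c \<in> R \<rightarrow> carrier K" for c S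
    using that
  proof (induction S rule: finite_induct)
    case empty
    then show ?case by (simp add: zero_Q)
  next
    case (insert r S)
    have V: "c s \<odot>\<^bsub>V\<^esub> \<gamma> s \<in> carrier V" "c s \<odot>\<^bsub>Q\<^esub> cls (\<gamma> s) \<in> carrier Q"
      "c s \<odot>\<^bsub>Q\<^esub> cls (\<gamma> s) = cls (c s \<odot>\<^bsub>V\<^esub> \<gamma> s)" if "s \<in> insert r S" for s
    proof -
      have cs: "c s \<in> carrier K" "\<gamma> s \<in> carrier V" using that insert.prems \<gamma> by auto
      then show V: "c s \<odot>\<^bsub>V\<^esub> \<gamma> s \<in> carrier V" by simp
      show eq: "c s \<odot>\<^bsub>Q\<^esub> cls (\<gamma> s) = cls (c s \<odot>\<^bsub>V\<^esub> \<gamma> s)"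
        by (rule smult_Q[OF cs])
      show "c s \<odot>\<^bsub>Q\<^esub> cls (\<gamma> s) \<in> carrier Q"
        unfolding eq carrier_Q using V by blast
    qed
    have S: "(\<Oplus>\<^bsub>V\<^esub>r\<in>S. c r \<odot>\<^bsub>V\<^esub> \<gamma> r) \<in> carrier V"
      using V(1) by (intro M.finsum_closed) auto
    have "(\<Oplus>\<^bsub>Q\<^esub>r\<in>insert r S. c r \<odot>\<^bsub>Q\<^esub> cls (\<gamma> r)) =
        c r \<odot>\<^bsub>Q\<^esub> cls (\<gamma> r) \<oplus>\<^bsub>Q\<^esub> (\<Oplus>\<^bsub>Q\<^esub>r\<in>S. c r \<odot>\<^bsub>Q\<^esub> cls (\<gamma> r))"
      using insert.hyps V(2) by (intro Q.M.finsum_insert) auto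
    also have "\<dots> = cls ((c r \<odot>\<^bsub>V\<^esub> \<gamma> r) \<oplus>\<^bsub>V\<^esub> (\<Oplus>\<^bsub>V\<^esub>r\<in>S. c r \<odot>\<^bsub>V\<^esub> \<gamma> r))"
      using insert V S by (simp add: add_Q)
    also have "(c r \<odot>\<^bsub>V\<^esub> \<gamma> r) \<oplus>\<^bsub>V\<^esub> (\<Oplus>\<^bsub>V\<^esub>r\<in>S. c r \<odot>\<^bsub>V\<^esub> \<gamma> r) = (\<Oplus>\<^bsub>V\<^esub>r\<in>insert r S. c r \<odot>\<^bsub>V\<^esub> \<gamma> r)"
      using insert.hyps V(1) by (intro M.finsum_insert[symmetric]) auto
    finally show ?case .
  qed
  have sumV: "(\<Oplus>\<^bsub>V\<^esub>r\<in>R. c r \<odot>\<^bsub>V\<^esub> \<gamma> r) \<in> carrier V" if "c \<in> R \<rightarrow> carrier K" for c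
    using that \<gamma> by (intro M.finsum_closed) auto
  have clsW: "cls x = \<zero>\<^bsub>Q\<^esub> \<longleftrightarrow> x \<in> W" if "x \<in> carrier V" for x
    unfolding zero_Q using cls_eq_iff[OF that M.zero_closed] sub.a_subset by (auto simp: subset_iff)
  show inj: "inj_on (\<lambda>r. cls (\<gamma> r)) R"
  proof (rule inj_onI, rule ccontr)
    fix r s
    assume rs: "r \<in> R" "s \<in> R" "cls (\<gamma> r) = cls (\<gamma> s)" "r \<noteq> s"
    \<comment> \<open>Equal classes would put the combination with coefficients 1 and -1 into W,
      against \<open>indep\<close>.\<close>
    let ?c = "\<lambda>t. if t = r then \<one>\<^bsub>K\<^esub> else if t = s then \<ominus>\<^bsub>K\<^esub> \<one>\<^bsub>K\<^esub> else \<zero>\<^bsub>K\<^esub>"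
    have c: "?c \<in> R \<rightarrow> carrier K" by auto
    have g: "\<gamma> r \<in> carrier V" "\<gamma> s \<in> carrier V" using \<gamma> rs by auto
    have "(\<Oplus>\<^bsub>V\<^esub>t\<in>R. ?c t \<odot>\<^bsub>V\<^esub> \<gamma> t) = (\<Oplus>\<^bsub>V\<^esub>t\<in>{r, s}. ?c t \<odot>\<^bsub>V\<^esub> \<gamma> t)"
      using fin rs funcset_mem[OF \<gamma>]
      by (intro M.add.finprod_mono_neutral_cong_right) (auto simp: smult_l_null)
    also have "\<dots> = \<gamma> r \<oplus>\<^bsub>V\<^esub> (\<ominus>\<^bsub>K\<^esub> \<one>\<^bsub>K\<^esub>) \<odot>\<^bsub>V\<^esub> \<gamma> s"
      using rs g by (simp add: M.finsum_insert)
    also have "\<dots> = \<gamma> r \<ominus>\<^bsub>V\<^esub> \<gamma> s"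
      using g by (simp add: smult_l_minus M.minus_eq)
    also have "\<dots> \<in> W"
    proof -
      obtain w where "w \<in> W" "\<gamma> r = w \<oplus>\<^bsub>V\<^esub> \<gamma> s" using cls_eq_iff[OF g] rs(3) by blast
      then show ?thesis
        using g sub.a_subset by (auto simp: M.minus_eq M.a_assoc M.r_neg subset_iff)
    qed
    finally have "?c r = \<zero>\<^bsub>K\<^esub>" using indep[OF c _ rs(1)] by blast
    then show False by simp
  qed
  show "Q.basis ((\<lambda>r. cls (\<gamma> r)) ` R)"
    unfolding Q.basis_def
  proof (intro conjI)
    show sub: "(\<lambda>r. cls (\<gamma> r)) ` R \<subseteq> carrier Q"
      using \<gamma> by (auto simp: carrier_Q)
    have lc: "Q.lincomb a ((\<lambda>r. cls (\<gamma> r)) ` R) = cls (\<Oplus>\<^bsub>V\<^esub>r\<in>R. a (cls (\<gamma> r)) \<odot>\<^bsub>V\<^esub> \<gamma> r)"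
      if a: "a \<in> (\<lambda>r. cls (\<gamma> r)) ` R \<rightarrow> carrier K" for a
    proof -
      have "Q.lincomb a ((\<lambda>r. cls (\<gamma> r)) ` R) = (\<Oplus>\<^bsub>Q\<^esub>r\<in>R. a (cls (\<gamma> r)) \<odot>\<^bsub>Q\<^esub> cls (\<gamma> r))"
        unfolding Q.lincomb_def using inj sub a
        by (intro Q.M.add.finprod_reindex) (auto intro!: Q.smult_closed)
      also have "\<dots> = cls (\<Oplus>\<^bsub>V\<^esub>r\<in>R. a (cls (\<gamma> r)) \<odot>\<^bsub>V\<^esub> \<gamma> r)"
        using a fin by (intro finsum) auto
      finally show ?thesis .
    qed
    show "Q.lin_indpt ((\<lambda>r. cls (\<gamma> r)) ` R)"
    proof (rule Q.finite_lin_indpt2[OF finite_imageI[OF fin] sub])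
      fix a
      assume a: "a \<in> (\<lambda>r. cls (\<gamma> r)) ` R \<rightarrow> carrier K"
        and zero: "Q.lincomb a ((\<lambda>r. cls (\<gamma> r)) ` R) = \<zero>\<^bsub>Q\<^esub>"
      have aR: "(\<lambda>r. a (cls (\<gamma> r))) \<in> R \<rightarrow> carrier K"
        using a by auto
      have W: "(\<Oplus>\<^bsub>V\<^esub>r\<in>R. a (cls (\<gamma> r)) \<odot>\<^bsub>V\<^esub> \<gamma> r) \<in> W"
        using lc[OF a] clsW[OF sumV[OF aR]] zero by metis
      show "\<forall>v\<in>(\<lambda>r. cls (\<gamma> r)) ` R. a v = \<zero>\<^bsub>K\<^esub>"
        using indep[OF aR W] by blast
    qed
    show "Q.span ((\<lambda>r. cls (\<gamma> r)) ` R) = carrier Q"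
    proof
      show "Q.span ((\<lambda>r. cls (\<gamma> r)) ` R) \<subseteq> carrier Q"
        using Q.span_is_subset2[OF sub] .
      show "carrier Q \<subseteq> Q.span ((\<lambda>r. cls (\<gamma> r)) ` R)"
      proof
        fix X
        assume "X \<in> carrier Q"
        then obtain v where v: "v \<in> carrier V" "X = cls v" by (auto simp: carrier_Q)
        obtain c w where c: "c \<in> R \<rightarrow> carrier K" and w: "w \<in> W"
          and vw: "v = w \<oplus>\<^bsub>V\<^esub> (\<Oplus>\<^bsub>V\<^esub>r\<in>R. c r \<odot>\<^bsub>V\<^esub> \<gamma> r)"
          using span[OF v(1)] by blast
        \<comment> \<open>Coefficients in the quotient are indexed by classes; injectivity allows
          them to be transported from R.\<close>
        define a where "a U = c (inv_into R (\<lambda>r. cls (\<gamma> r)) U)" for U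
        have a: "a (cls (\<gamma> r)) = c r" if "r \<in> R" for r
          unfolding a_def using inv_into_f_f[OF inj that] by simp
        have aK: "a \<in> (\<lambda>r. cls (\<gamma> r)) ` R \<rightarrow> carrier K"
          using a c by auto
        have "(\<Oplus>\<^bsub>V\<^esub>r\<in>R. a (cls (\<gamma> r)) \<odot>\<^bsub>V\<^esub> \<gamma> r) = (\<Oplus>\<^bsub>V\<^esub>r\<in>R. c r \<odot>\<^bsub>V\<^esub> \<gamma> r)"
          using a c \<gamma> by (intro M.finsum_cong') auto
        moreover have "cls v = cls (\<Oplus>\<^bsub>V\<^esub>r\<in>R. c r \<odot>\<^bsub>V\<^esub> \<gamma> r)"
          using cls_eq_iff[OF v(1) sumV[OF c]] w vw by blast
        ultimately have "X = Q.lincomb a ((\<lambda>r. cls (\<gamma> r)) ` R)"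
          using v(2) lc[OF aK] by simp
        then show "X \<in> Q.span ((\<lambda>r. cls (\<gamma> r)) ` R)"
          unfolding Q.finite_span[OF finite_imageI[OF fin] sub] using aK by blast
      qed
    qed
  qed
qed

end

section \<open>Basic cohomology\<close>

lemma zero_cochain: "(\<lambda>_. 0) \<in> SV.cochains n"
  by (simp add: cochains_iff multilinear_def)

lemma cochains_lincomb:
  assumes "\<gamma> \<in> SV.cochains n" and "\<delta> \<in> SV.cochains n"
  shows "(\<lambda>as. lconst a * \<gamma> as + lconst b * \<delta> as) \<in> SV.cochains n"
  unfolding cochains_iff
proof (intro conjI allI impI)
  have ml: "multilinear n \<gamma>" "multilinear n \<delta>"
    using assms by (simp_all add: cochains_iff)
  show "multilinear n (\<lambda>as. lconst a * \<gamma> as + lconst b * \<delta> as)"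
    unfolding multilinear_def
    by (simp add: multilinearD[OF ml(1)] multilinearD[OF ml(2)] algebra_simps)
  show "lconst a * \<gamma> as + lconst b * \<delta> as \<in> lpolys n" if "length as = n" for as
    using assms that by (intro lpolys_add lpolys_mult) (simp_all add: cochains_iff)
  show "lsubst (\<lambda>i. lvar (\<sigma> i)) (lconst a * \<gamma> (permute_list \<sigma> as) + lconst b * \<delta> (permute_list \<sigma> as)) =
      of_int (sign \<sigma>) * (lconst a * \<gamma> as + lconst b * \<delta> as)"
    if "length as = n \<and> \<sigma> permutes {..<n}" for as \<sigma>
    using assms that by (simp add: cochains_iff lsubst_add lsubst_mult algebra_simps)
qed

lemma cochains_simps:
  "\<gamma> \<in> SV.cochains n \<Longrightarrow> \<delta> \<in> SV.cochains n \<Longrightarrow> (\<lambda>as. \<gamma> as + \<delta> as) \<in> SV.cochains n"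
  "\<gamma> \<in> SV.cochains n \<Longrightarrow> (\<lambda>as. lconst a * \<gamma> as) \<in> SV.cochains n"
  using cochains_lincomb[of \<gamma> n \<delta> 1 1] cochains_lincomb[of \<gamma> n \<gamma> a 0] by simp_all

lemma coef_simps:
  "coef n (\<lambda>as. \<gamma> as + \<delta> as) = (\<lambda>xs. coef n \<gamma> xs + coef n \<delta> xs)"
  "coef n (\<lambda>as. lconst a * \<gamma> as) = (\<lambda>xs. a * coef n \<gamma> xs)"
  "coef n (\<lambda>as. 0) = (\<lambda>xs. 0)"
  using coef_lincomb[of n 1 \<gamma> 1 \<delta>] coef_lincomb[of n a \<gamma> 0 \<gamma>] coef_lincomb[of n 0 \<gamma> 0 \<gamma>]
  by (simp_all add: fun_eq_iff)

lemma cocycles_iff: "\<gamma> \<in> SV.cocycles n \<longleftrightarrow> \<gamma> \<in> SV.cochains n \<and> cd (coef n \<gamma>) = (\<lambda>_. 0)"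
proof -
  have "SV.differential n \<gamma> = (\<lambda>_. 0) \<longleftrightarrow> cd (coef n \<gamma>) = (\<lambda>_. 0)" if \<gamma>: "\<gamma> \<in> SV.cochains n"
  proof
    assume eq: "SV.differential n \<gamma> = (\<lambda>_. 0)"
    show "cd (coef n \<gamma>) = (\<lambda>_. 0)"
      unfolding coef_differential[OF \<gamma>, symmetric] eq by (rule coef_simps)
  next
    assume "cd (coef n \<gamma>) = (\<lambda>_. 0)"
    then have "coef (Suc n) (SV.differential n \<gamma>) = coef (Suc n) (\<lambda>_. 0)"
      unfolding coef_differential[OF \<gamma>] by (simp add: coef_simps)
    then show "SV.differential n \<gamma> = (\<lambda>_. 0)"
      by (rule coef_inj[OF differential_cochain[OF \<gamma>] zero_cochain])
  qed
  then show ?thesis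
    unfolding SV.cocycles_def by blast
qed

text \<open>A primitive \<open>h\<close> on modes comes from the cochain \<open>of_coef m h\<close>,
  and equality of coefficients then gives equality of cochains.\<close>

lemma coboundaries_iff: "\<gamma> \<in> SV.coboundaries n \<longleftrightarrow> \<gamma> \<in> SV.cochains n \<and>
    (case n of 0 \<Rightarrow> coef n \<gamma> = (\<lambda>_. 0) | Suc m \<Rightarrow> \<exists>h\<in>mcochains m. coef n \<gamma> = cd h)"
proof (cases n)
  case 0
  have "\<gamma> = (\<lambda>_. 0)" if "\<gamma> \<in> SV.cochains 0" "coef 0 \<gamma> = (\<lambda>_. 0)"
    using that by (intro coef_inj[OF that(1) zero_cochain]) (simp add: coef_simps)
  then show ?thesis
    using 0 zero_cochain[of 0] by (auto simp: SV.coboundaries_def coef_simps)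
next
  case (Suc m)
  have "\<gamma> \<in> SV.differential m ` SV.cochains m"
    if \<gamma>: "\<gamma> \<in> SV.cochains (Suc m)" and h: "h \<in> mcochains m" "coef (Suc m) \<gamma> = cd h" for h
  proof
    show oc: "of_coef m h \<in> SV.cochains m"
      using h(1) by (rule of_coef_cochain)
    show "\<gamma> = SV.differential m (of_coef m h)"
      by (rule coef_inj[OF \<gamma> differential_cochain[OF oc]])
        (simp add: coef_differential[OF oc] coef_of_coef[OF h(1)] h(2))
  qed
  moreover have "\<gamma> \<in> SV.cochains (Suc m) \<and> (\<exists>h\<in>mcochains m. coef (Suc m) \<gamma> = cd h)"
    if "\<gamma> \<in> SV.differential m ` SV.cochains m"
    using that differential_cochain coef_differential coef_mcochains by blast
  ultimately show ?thesis
    unfolding Suc SV.coboundaries_def by auto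
qed

text \<open>Here d^2 = 0 is inherited from \<open>cd_cd\<close> through the coefficients.\<close>

lemma coboundaries_subset: "SV.coboundaries n \<subseteq> SV.cocycles n"
proof
  fix \<gamma>
  assume \<gamma>: "\<gamma> \<in> SV.coboundaries n"
  show "\<gamma> \<in> SV.cocycles n"
  proof (cases n)
    case 0
    then show ?thesis
      using \<gamma> by (simp add: coboundaries_iff cocycles_iff cd_linear fun_eq_iff[of "cd _"])
  next
    case (Suc m)
    then obtain h where "coef n \<gamma> = cd h"
      using \<gamma> by (auto simp: coboundaries_iff)
    then have "cd (coef n \<gamma>) = (\<lambda>_. 0)"
      by (simp add: cd_cd fun_eq_iff[of "cd _"])
    then show ?thesis
      using \<gamma> by (simp add: coboundaries_iff cocycles_iff)
  qed
qed

lemma cocycles_simps: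
  "(\<lambda>_. 0) \<in> SV.cocycles n"
  "\<gamma> \<in> SV.cocycles n \<Longrightarrow> \<delta> \<in> SV.cocycles n \<Longrightarrow> (\<lambda>as. \<gamma> as + \<delta> as) \<in> SV.cocycles n"
  "\<gamma> \<in> SV.cocycles n \<Longrightarrow> (\<lambda>as. lconst a * \<gamma> as) \<in> SV.cocycles n"
  by (simp_all add: cocycles_iff zero_cochain cochains_simps coef_simps)
    (intro ext, simp add: cd_linear)+

lemma coboundaries_simps:
  "(\<lambda>_. 0) \<in> SV.coboundaries n"
  "\<gamma> \<in> SV.coboundaries n \<Longrightarrow> \<delta> \<in> SV.coboundaries n \<Longrightarrow> (\<lambda>as. \<gamma> as + \<delta> as) \<in> SV.coboundaries n"
  "\<gamma> \<in> SV.coboundaries n \<Longrightarrow> (\<lambda>as. lconst a * \<gamma> as) \<in> SV.coboundaries n"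
proof -
  show "(\<lambda>_. 0) \<in> SV.coboundaries n"
    using mcochains_zero
    by (cases n) (auto simp: coboundaries_iff zero_cochain coef_simps cd_linear
        intro!: bexI[of _ "\<lambda>_. 0"] ext)
  show "(\<lambda>as. \<gamma> as + \<delta> as) \<in> SV.coboundaries n"
    if gd: "\<gamma> \<in> SV.coboundaries n" "\<delta> \<in> SV.coboundaries n"
  proof (cases n)
    case 0
    then show ?thesis using gd by (simp add: coboundaries_iff cochains_simps coef_simps)
  next
    case (Suc m)
    then obtain g h where "g \<in> mcochains m" "coef n \<gamma> = cd g" "h \<in> mcochains m" "coef n \<delta> = cd h"
      using gd by (auto simp: coboundaries_iff)
    then have "(\<lambda>xs. g xs + h xs) \<in> mcochains m" "coef n (\<lambda>as. \<gamma> as + \<delta> as) = cd (\<lambda>xs. g xs + h xs)"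
      using mcochains_lincomb[of g m h 1 1] by (simp_all add: coef_simps cd_linear fun_eq_iff[of _ "cd _"])
    then show ?thesis
      using gd Suc by (auto simp: coboundaries_iff cochains_simps)
  qed
  show "(\<lambda>as. lconst a * \<gamma> as) \<in> SV.coboundaries n" if gd: "\<gamma> \<in> SV.coboundaries n"
  proof (cases n)
    case 0
    then show ?thesis using gd by (simp add: coboundaries_iff cochains_simps coef_simps)
  next
    case (Suc m)
    then obtain g where "g \<in> mcochains m" "coef n \<gamma> = cd g"
      using gd by (auto simp: coboundaries_iff)
    then have "(\<lambda>xs. a * g xs) \<in> mcochains m" "coef n (\<lambda>as. lconst a * \<gamma> as) = cd (\<lambda>xs. a * g xs)"
      using mcochains_lincomb[of g m g a 0] by (simp_all add: coef_simps cd_linear fun_eq_iff[of _ "cd _"])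
    then show ?thesis
      using gd Suc by (auto simp: coboundaries_iff cochains_simps)
  qed
qed

lemma cocycle_space_simps [simp]:
  "carrier (SV.cocycle_space n) = SV.cocycles n"
  "zero (SV.cocycle_space n) = (\<lambda>_. 0)"
  "\<gamma> \<oplus>\<^bsub>SV.cocycle_space n\<^esub> \<delta> = (\<lambda>as. \<gamma> as + \<delta> as)"
  "c \<odot>\<^bsub>SV.cocycle_space n\<^esub> \<gamma> = (\<lambda>as. lconst c * \<gamma> as)"
  by (simp_all add: SV.cocycle_space_def SV.cochain_space_def)

lemma uminus_cocycle:
  "\<gamma> \<in> SV.cocycles n \<Longrightarrow> (\<lambda>as. - \<gamma> as) \<in> SV.cocycles n"
  using cocycles_simps(3)[of \<gamma> n "-1"] by simp

lemma vectorspace_cocycles: "vectorspace class_ring (SV.cocycle_space n)"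
proof -
  have "abelian_group (SV.cocycle_space n)"
  proof (rule abelian_groupI)
    show "\<exists>\<delta>\<in>carrier (SV.cocycle_space n). \<delta> \<oplus>\<^bsub>SV.cocycle_space n\<^esub> \<gamma> = \<zero>\<^bsub>SV.cocycle_space n\<^esub>"
      if "\<gamma> \<in> carrier (SV.cocycle_space n)" for \<gamma>
      using that by (intro bexI[of _ "\<lambda>as. - \<gamma> as"]) (simp_all add: uminus_cocycle)
  qed (simp_all add: cocycles_simps add_ac)
  then have "module (class_ring :: complex ring) (SV.cocycle_space n)"
    by (intro moduleI class_cring.cring_axioms)
      (simp_all add: cocycles_simps lconst_add lconst_mult distrib_left distrib_right mult.assoc)
  then show ?thesis
    using class_field by (simp add: vectorspace_def)
qed

lemma quotient_vectorspace_cohomology: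
  "quotient_vectorspace class_ring (SV.cocycle_space n) (SV.coboundaries n)"
proof -
  interpret V: vectorspace "class_ring :: complex ring" "SV.cocycle_space n"
    by (rule vectorspace_cocycles)
  have neg: "\<ominus>\<^bsub>SV.cocycle_space n\<^esub> \<gamma> = (\<lambda>as. - \<gamma> as)" if "\<gamma> \<in> SV.cocycles n" for \<gamma>
    using that by (intro V.M.minus_equality) (simp_all add: uminus_cocycle)
  have "subgroup (SV.coboundaries n) (add_monoid (SV.cocycle_space n))"
  proof (rule group.subgroupI[OF V.M.a_group])
    show "inv\<^bsub>add_monoid (SV.cocycle_space n)\<^esub> \<gamma> \<in> SV.coboundaries n" if "\<gamma> \<in> SV.coboundaries n" for \<gamma>
    proof -
      have "\<gamma> \<in> SV.cocycles n" using that coboundaries_subset by blast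
      from neg[OF this] have "inv\<^bsub>add_monoid (SV.cocycle_space n)\<^esub> \<gamma> = (\<lambda>as. - \<gamma> as)"
        by (simp add: a_inv_def)
      then show ?thesis
        using coboundaries_simps(3)[OF that, of "-1"] by simp
    qed
    show "SV.coboundaries n \<noteq> {}"
      using coboundaries_simps(1) by blast
  qed (use coboundaries_simps coboundaries_subset in auto)
  then have "additive_subgroup (SV.coboundaries n) (SV.cocycle_space n)"
    by (rule additive_subgroup.intro)
  then show ?thesis
    by (intro quotient_vectorspace.intro quotient_vectorspace_axioms.intro vectorspace_cocycles)
      (simp_all add: coboundaries_simps)
qed

lemma finsum_cocycles:
  assumes "finite R" and "\<And>r. r \<in> R \<Longrightarrow> g r \<in> SV.cocycles n"
  shows "finsum (SV.cocycle_space n) g R = (\<lambda>as. \<Sum>r\<in>R. g r as)"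
proof -
  interpret V: vectorspace "class_ring :: complex ring" "SV.cocycle_space n"
    by (rule vectorspace_cocycles)
  show ?thesis
    using assms
  proof (induction R rule: finite_induct)
    case (insert r R)
    then show ?case by (subst V.M.finsum_insert) auto
  qed simp
qed

lemma coef_sum:
  "coef n (\<lambda>as. \<Sum>r\<in>R. lconst (c r) * \<gamma> r as) xs = (\<Sum>r\<in>R. c r * coef n (\<gamma> r) xs)"
  by (induction R rule: infinite_finite_induct) (simp_all add: coef_simps)

text \<open>Spanning is \<open>cocycle_split\<close> and independence is
  \<open>dual_independent\<close>, both read through \<open>coef\<close>. The scalars
  \<open>k r\<close> allow the cocycles to be normalised by their polynomial formulas instead of by
  the dual vectors.\<close>

lemma basis_cohomology:
  assumes \<gamma>: "\<And>r. r \<in> set (reps n) \<Longrightarrow> \<gamma> r \<in> SV.cochains n"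
    and coef: "\<And>r. r \<in> set (reps n) \<Longrightarrow> coef n (\<gamma> r) = (\<lambda>xs. k r * dual r xs)"
    and k: "\<And>r. r \<in> set (reps n) \<Longrightarrow> k r \<noteq> 0"
  shows "vectorspace.basis class_ring (SV.cohomology n) ((\<lambda>r. SV.cohomology_class n (\<gamma> r)) ` set (reps n))"
    and "inj_on (\<lambda>r. SV.cohomology_class n (\<gamma> r)) (set (reps n))"
    and "\<And>r. r \<in> set (reps n) \<Longrightarrow> \<gamma> r \<in> SV.cocycles n"
proof -
  let ?V = "SV.cocycle_space n" and ?W = "SV.coboundaries n" and ?R = "set (reps n)"
  interpret Q: quotient_vectorspace "class_ring :: complex ring" ?V ?W
    by (rule quotient_vectorspace_cohomology)
  show cocycle: "\<gamma> r \<in> SV.cocycles n" if "r \<in> ?R" for r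
    unfolding cocycles_iff coef[OF that] using \<gamma>[OF that] dual_cocycle[OF that]
    by (simp add: cd_linear fun_eq_iff)
  have sum: "(\<Oplus>\<^bsub>?V\<^esub>r\<in>?R. c r \<odot>\<^bsub>?V\<^esub> \<gamma> r) = (\<lambda>as. \<Sum>r\<in>?R. lconst (c r) * \<gamma> r as)" for c
    by (subst finsum_cocycles) (simp_all add: cocycle cocycles_simps)
  have csum: "coef n (\<lambda>as. \<Sum>r\<in>?R. lconst (c r) * \<gamma> r as) = (\<lambda>xs. \<Sum>r\<in>?R. c r * k r * dual r xs)" for c
    by (intro ext) (simp add: coef_sum coef mult.assoc)
  have sum_cochain: "(\<lambda>as. \<Sum>r\<in>?R. lconst (c r) * \<gamma> r as) \<in> SV.cochains n" for c
  proof -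
    have "(\<lambda>as. \<Sum>r\<in>S. lconst (c r) * \<gamma> r as) \<in> SV.cochains n" if "finite S" "S \<subseteq> ?R" for S
      using that by (induction S rule: finite_induct) (simp_all add: zero_cochain cochains_simps \<gamma>)
    then show ?thesis by simp
  qed
  have span: "\<exists>c\<in>?R \<rightarrow> carrier class_ring. \<exists>w\<in>?W. v = w \<oplus>\<^bsub>?V\<^esub> (\<Oplus>\<^bsub>?V\<^esub>r\<in>?R. c r \<odot>\<^bsub>?V\<^esub> \<gamma> r)"
    if "v \<in> carrier ?V" for v
  proof -
    have v: "v \<in> SV.cochains n" "cd (coef n v) = (\<lambda>_. 0)"
      using that by (simp_all add: cocycles_iff)
    obtain c where c: "n = 0 \<longrightarrow> coef n v = (\<lambda>xs. \<Sum>r\<in>?R. c r * dual r xs)"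
      "\<forall>m. n = Suc m \<longrightarrow> (\<exists>h\<in>mcochains m. coef n v = (\<lambda>xs. (\<Sum>r\<in>?R. c r * dual r xs) + cd h xs))"
      using cocycle_split[OF coef_mcochains[OF v(1)] v(2)] by blast
    \<comment> \<open>Dividing by \<open>k r\<close> undoes the normalisation, so the coefficients
      of \<open>?s\<close> are exactly the \<open>dual\<close> part of those of v.\<close>
    let ?s = "\<lambda>as. \<Sum>r\<in>?R. lconst (c r / k r) * \<gamma> r as"
    have cs: "coef n ?s = (\<lambda>xs. \<Sum>r\<in>?R. c r * dual r xs)"
      unfolding csum using k by (intro ext sum.cong) simp_all
    define w where "w = (\<lambda>as. v as + lconst (-1) * ?s as)"
    have wc: "w \<in> SV.cochains n"
      unfolding w_def by (intro cochains_simps v sum_cochain)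
    have cw: "coef n w xs = coef n v xs - (\<Sum>r\<in>?R. c r * dual r xs)" for xs
      unfolding w_def coef_simps cs by simp
    have "w \<in> ?W"
    proof (cases n)
      case 0
      then show ?thesis using wc cw c(1) by (simp add: coboundaries_iff fun_eq_iff[of "coef _ _"])
    next
      case (Suc m)
      then obtain h where h: "h \<in> mcochains m" "coef n v = (\<lambda>xs. (\<Sum>r\<in>?R. c r * dual r xs) + cd h xs)"
        using c(2) by blast
      then have "coef n w = cd h"
        using cw by (intro ext) simp
      then show ?thesis using wc h(1) Suc by (auto simp: coboundaries_iff)
    qed
    moreover have "v = w \<oplus>\<^bsub>?V\<^esub> (\<Oplus>\<^bsub>?V\<^esub>r\<in>?R. (c r / k r) \<odot>\<^bsub>?V\<^esub> \<gamma> r)"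
      unfolding sum by (simp add: w_def)
    ultimately show ?thesis
      by (intro bexI[of _ "\<lambda>r. c r / k r"] bexI[of _ w]) simp_all
  qed
  have indep: "c r = \<zero>\<^bsub>class_ring\<^esub>"
    if "(\<Oplus>\<^bsub>?V\<^esub>r\<in>?R. c r \<odot>\<^bsub>?V\<^esub> \<gamma> r) \<in> ?W" and r: "r \<in> ?R" for c r
  proof -
    have W: "(\<lambda>as. \<Sum>r\<in>?R. lconst (c r) * \<gamma> r as) \<in> ?W"
      using that(1) unfolding sum .
    have "c r * k r = 0"
    proof (cases n)
      case 0
      then have "(\<Sum>r\<in>?R. c r * k r * dual r []) = 0"
        using W unfolding coboundaries_iff csum by (simp add: fun_eq_iff)
      then show ?thesis using 0 r by (simp add: reps_def)
    next
      case (Suc m)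
      then obtain h where "h \<in> mcochains m" "(\<lambda>xs. \<Sum>r\<in>?R. c r * k r * dual r xs) = cd h"
        using W unfolding coboundaries_iff csum by auto
      then show ?thesis
        using dual_independent[of h m "\<lambda>r. c r * k r" r] r Suc by (simp add: fun_eq_iff)
    qed
    then show ?thesis using k[OF r] by simp
  qed
  show "vectorspace.basis class_ring (SV.cohomology n) ((\<lambda>r. SV.cohomology_class n (\<gamma> r)) ` ?R)"
    unfolding SV.cohomology_def SV.cohomology_class_def
    by (rule Q.basis_Q) (use cocycle span indep in auto)
  show "inj_on (\<lambda>r. SV.cohomology_class n (\<gamma> r)) ?R"
    unfolding SV.cohomology_class_def
    by (rule Q.basis_Q) (use cocycle span indep in auto)
qed

section \<open>The generating cocycles\<close>

lemma dual_support_fst: "dual r xs \<noteq> 0 \<Longrightarrow> mset (map fst xs) = mset (map fst r)"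
  by (simp only: mset_map dual_support)

text \<open>\<open>dual r\<close> lives on rearrangements of r, so only the value on gs has to be
  compared with p, coefficient by coefficient. For uniqueness, any other tuple with the same
  multiset of generators is a permutation of gs, and skew-symmetry fixes the value there.\<close>

lemma given_by_of_coef:
  assumes p: "p \<in> lpolys n" and n: "length gs = n" "length r = n" and r: "mset (map fst r) = mset gs"
    and val: "\<And>ks. length ks = n \<Longrightarrow>
      (\<Prod>k\<leftarrow>ks. fact k) * Poly_Mapping.lookup p (Poly_Mapping.nth ks) = k * dual r (zip gs ks)"
  shows "is_cochain_given_by gs p (of_coef n (\<lambda>xs. k * dual r xs))"
proof -
  define f where "f = (\<lambda>xs. k * dual r xs)"
  have f: "f \<in> mcochains n"
    using mcochains_lincomb[OF dual_mcochains dual_mcochains, of k r 0] n by (simp add: f_def)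
  let ?\<gamma> = "of_coef n f"
  have \<gamma>: "?\<gamma> \<in> SV.cochains n" using f by (rule of_coef_cochain)
  have on_gs: "?\<gamma> (map gen gs) = p"
    unfolding of_coef_gen[OF n(1)]
  proof (rule poly_mapping_eqI)
    fix K
    show "Poly_Mapping.lookup (gen_value f gs) K = Poly_Mapping.lookup p K"
    proof (cases "Poly_Mapping.keys K \<subseteq> {..<n}")
      case True
      let ?ks = "map (Poly_Mapping.lookup K) [0..<n]"
      have 1: "map (\<lambda>i. (gs ! i, Poly_Mapping.lookup K i)) [0..<n] = zip gs ?ks"
        using n by (intro nth_equalityI) simp_all
      have 2: "(\<Prod>i<n. fact (Poly_Mapping.lookup K i) :: complex) = (\<Prod>k\<leftarrow>?ks. fact k)"
        by (simp add: prod.list_conv_set_nth atLeast0LessThan)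
      have 3: "(\<Prod>k\<leftarrow>?ks. fact k :: complex) \<noteq> 0"
        by (auto simp: prod_list_zero_iff)
      have "Poly_Mapping.lookup (gen_value f gs) K = f (zip gs ?ks) / (\<Prod>k\<leftarrow>?ks. fact k)"
        using lookup_gen_value[of f gs K] f True n unfolding n 1 2 by simp
      also have "\<dots> = Poly_Mapping.lookup p (Poly_Mapping.nth ?ks)"
        using val[of ?ks] 3 by (simp add: f_def field_simps del: lookup_nth)
      finally show ?thesis
        unfolding monomial_eq_nth[OF True] .
    next
      case False
      then show ?thesis
        using lookup_gen_value[of f gs K] f n p unfolding lpolys_iff by auto
    qed
  qed
  have off: "?\<gamma> (map gen hs) = 0" if hs: "length hs = n" "mset hs \<noteq> mset gs" for hs
    unfolding of_coef_gen[OF hs(1)]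
  proof (rule poly_mapping_eqI)
    fix K :: "nat \<Rightarrow>\<^sub>0 nat"
    let ?xs = "map (\<lambda>i. (hs ! i, Poly_Mapping.lookup K i)) [0..<length hs]"
    have "map fst ?xs = hs"
      by (simp add: o_def map_nth)
    then have "dual r ?xs = 0"
      using dual_support_fst[of r ?xs] hs(2) r by argo
    then show "Poly_Mapping.lookup (gen_value f hs) K = Poly_Mapping.lookup 0 K"
      using lookup_gen_value[of f hs K] f hs(1) by (simp add: f_def)
  qed
  have "\<delta> = ?\<gamma>" if \<delta>: "\<delta> \<in> SV.cochains n" "\<delta> (map gen gs) = p"
    "\<forall>hs. length hs = n \<and> mset hs \<noteq> mset gs \<longrightarrow> \<delta> (map gen hs) = 0" for \<delta>
  proof (rule coef_inj[OF \<delta>(1) \<gamma>], rule ext)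
    fix xs
    show "coef n \<delta> xs = coef n ?\<gamma> xs"
    proof (cases "length xs = n \<and> mset (map fst xs) = mset gs")
      case False
      then show ?thesis
        using \<delta>(3) off[of "map fst xs"] by (auto simp: coef_def simp flip: map_map)
    next
      case True
      have "mset (map fst xs) = mset gs"
        using True by blast
      then obtain \<sigma> where \<sigma>: "\<sigma> permutes {..<length gs}" "permute_list \<sigma> gs = map fst xs"
        by (rule mset_eq_permutation)
      note \<sigma> = \<sigma>[unfolded n]
      \<comment> \<open>\<open>?xs'\<close> carries the modes of xs, reordered so that their
        generators appear in the order gs.\<close>
      let ?inv = "inv_into UNIV \<sigma>" and ?xs' = "permute_list (inv_into UNIV \<sigma>) xs"
      have inv: "?inv permutes {..<n}" using \<sigma>(1) by (rule permutes_inv)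
      have xs': "length ?xs' = n" "permute_list \<sigma> ?xs' = xs"
        using True permute_list_compose[of \<sigma> xs ?inv] \<sigma>(1) permutes_inv_o(2)[OF \<sigma>(1)] by simp_all
      have "map fst ?xs' = permute_list ?inv (permute_list \<sigma> gs)"
        using True inv \<sigma>(2) by (simp add: permute_list_map)
      also have "\<dots> = gs"
        using n permute_list_compose[of ?inv gs \<sigma>] inv permutes_inv_o(1)[OF \<sigma>(1)] by simp
      finally have "map (gen \<circ> fst) ?xs' = map gen gs"
        by (simp only: map_map[symmetric])
      then have "coef n \<delta> ?xs' = coef n ?\<gamma> ?xs'"
        using \<delta>(2) on_gs by (simp add: coef_def del: lookup_nth)
      then show ?thesis
        using coef_permute[OF \<delta>(1) \<sigma>(1) xs'(1)] coef_permute[OF \<gamma> \<sigma>(1) xs'(1)] xs'(2) by simp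
    qed
  qed
  then show ?thesis
    unfolding is_cochain_given_by_def Let_def n f_def[symmetric] using \<gamma> on_gs off by blast
qed

text \<open>Exponent lists let products and coefficients be computed by rewriting, so that an
  expanded polynomial can be matched with the recursion for \<open>dual\<close>.\<close>

definition mon :: "nat list \<Rightarrow> lpoly" where
  "mon es = Poly_Mapping.single (Poly_Mapping.nth es) 1"

lemma mon_mult: "length es = length fs \<Longrightarrow> mon es * mon fs = mon (map2 (+) es fs)"
proof -
  assume "length es = length fs"
  then have "Poly_Mapping.nth es + Poly_Mapping.nth fs = Poly_Mapping.nth (map2 (+) es fs)"
    by (intro poly_mapping_eqI) (auto simp: lookup_add nth_default_def)
  then show ?thesis
    by (simp add: mon_def mult_single)
qed

lemma lookup_mon:
  assumes "length es = length ks"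
  shows "Poly_Mapping.lookup (mon es) (Poly_Mapping.nth ks) = (if es = ks then 1 else 0)"
proof -
  have "es = ks" if eq: "Poly_Mapping.nth es = Poly_Mapping.nth ks"
  proof (rule nth_equalityI[OF assms])
    fix i
    assume "i < length es"
    then show "es ! i = ks ! i"
      using arg_cong[OF eq, of "\<lambda>K. Poly_Mapping.lookup K i"] assms by (simp add: nth_default_def)
  qed
  then show ?thesis
    by (auto simp: mon_def lookup_single when_def)
qed

lemma lvar_eq_mon:
  assumes "\<forall>k<length es. es ! k = (if k = i then 1 else 0)" and "i < length es"
  shows "lvar i = mon es"
proof -
  have "Poly_Mapping.single i 1 = Poly_Mapping.nth es"
    using assms by (intro poly_mapping_eqI) (auto simp: lookup_single when_def nth_default_def)
  then show ?thesis
    by (simp only: mon_def lvar_def)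
qed

lemma lpolys_diff: "p \<in> lpolys n \<Longrightarrow> q \<in> lpolys n \<Longrightarrow> p - q \<in> lpolys n"
  using lpolys_add[of p n "- q"] lpolys_uminus[of q n] by simp

lemma Phi_given_by: "is_cochain_given_by [L, L, L]
    ((lvar 0 - lvar 1) * (lvar 0 - lvar 2) * (lvar 1 - lvar 2))
    (of_coef 3 (\<lambda>xs. -2 * dual [(L, 0), (L, 1), (L, 2)] xs))"
proof (rule given_by_of_coef)
  let ?p = "(lvar 0 - lvar 1) * (lvar 0 - lvar 2) * (lvar 1 - lvar 2)"
  show "?p \<in> lpolys 3"
    by (intro lpolys_mult lpolys_diff) simp_all
  fix ks :: "nat list"
  assume "length ks = 3"
  then obtain a b c where ks: "ks = [a, b, c]"
    by (auto simp: numeral_eq_Suc length_Suc_conv)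
  have v: "lvar 0 = mon [1, 0, 0]"
    "lvar 1 = mon [0, 1, 0]"
    "lvar 2 = mon [0, 0, 1]"
    by (rule lvar_eq_mon; simp add: All_less_Suc numeral_eq_Suc)+
  have p: "?p = mon [2, 1, 0] - mon [2, 0, 1] - mon [1, 2, 0] + mon [1, 0, 2] + mon [0, 2, 1]
      - mon [0, 1, 2]"
    unfolding v by (simp add: algebra_simps mon_mult numeral_2_eq_2)
  show "(\<Prod>k\<leftarrow>ks. fact k) * Poly_Mapping.lookup ?p (Poly_Mapping.nth ks) =
      -2 * dual [(L, 0), (L, 1), (L, 2)] (zip [L, L, L] ks)"
    unfolding p ks by (auto simp: lookup_add lookup_minus lookup_mon)
qed simp_all

text \<open>The scalar is the coefficient at exponents (0, 1, 0, 1, 1): each of the two differences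
  contributes -1, and all factorials are 1.\<close>

lemma Lambda_given_by: "is_cochain_given_by [L, L, Y, Y, M]
    ((lvar 0 - lvar 1) * (lvar 2 - lvar 3) * lvar 4)
    (of_coef 5 (\<lambda>xs. 1 * dual [(L, 0), (L, 1), (Y, 0), (Y, 1), (M, 1)] xs))"
proof (rule given_by_of_coef)
  let ?p = "(lvar 0 - lvar 1) * (lvar 2 - lvar 3) * lvar 4"
  show "?p \<in> lpolys 5"
    by (intro lpolys_mult lpolys_diff) simp_all
  fix ks :: "nat list"
  assume "length ks = 5"
  then obtain a b c d e where ks: "ks = [a, b, c, d, e]"
    by (auto simp: numeral_eq_Suc length_Suc_conv)
  have v: "lvar 0 = mon [1, 0, 0, 0, 0]"
    "lvar 1 = mon [0, 1, 0, 0, 0]"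
    "lvar 2 = mon [0, 0, 1, 0, 0]"
    "lvar 3 = mon [0, 0, 0, 1, 0]"
    "lvar 4 = mon [0, 0, 0, 0, 1]"
    by (rule lvar_eq_mon; simp add: All_less_Suc numeral_eq_Suc)+
  have p: "?p = mon [1, 0, 1, 0, 1] - mon [1, 0, 0, 1, 1] - mon [0, 1, 1, 0, 1] + mon [0, 1, 0, 1, 1]"
    unfolding v by (simp add: algebra_simps mon_mult numeral_2_eq_2)
  show "(\<Prod>k\<leftarrow>ks. fact k) * Poly_Mapping.lookup ?p (Poly_Mapping.nth ks) =
      1 * dual [(L, 0), (L, 1), (Y, 0), (Y, 1), (M, 1)] (zip [L, L, Y, Y, M] ks)"
    unfolding p ks by (auto simp: lookup_add lookup_minus lookup_mon)
qed simp_all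

lemma Psi_given_by: "is_cochain_given_by [L, Y, Y, M, M]
    ((lvar 1 - lvar 2) * (lvar 3 - lvar 4))
    (of_coef 5 (\<lambda>xs. 1 * dual [(L, 0), (Y, 0), (Y, 1), (M, 0), (M, 1)] xs))"
proof (rule given_by_of_coef)
  let ?p = "(lvar 1 - lvar 2) * (lvar 3 - lvar 4)"
  show "?p \<in> lpolys 5"
    by (intro lpolys_mult lpolys_diff) simp_all
  fix ks :: "nat list"
  assume "length ks = 5"
  then obtain a b c d e where ks: "ks = [a, b, c, d, e]"
    by (auto simp: numeral_eq_Suc length_Suc_conv)
  have v: "lvar 1 = mon [0, 1, 0, 0, 0]"
    "lvar 2 = mon [0, 0, 1, 0, 0]"
    "lvar 3 = mon [0, 0, 0, 1, 0]"
    "lvar 4 = mon [0, 0, 0, 0, 1]"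
    by (rule lvar_eq_mon; simp add: All_less_Suc numeral_eq_Suc)+
  have p: "?p = mon [0, 1, 0, 1, 0] - mon [0, 1, 0, 0, 1] - mon [0, 0, 1, 1, 0] + mon [0, 0, 1, 0, 1]"
    unfolding v by (simp add: algebra_simps mon_mult numeral_2_eq_2)
  show "(\<Prod>k\<leftarrow>ks. fact k) * Poly_Mapping.lookup ?p (Poly_Mapping.nth ks) =
      1 * dual [(L, 0), (Y, 0), (Y, 1), (M, 0), (M, 1)] (zip [L, Y, Y, M, M] ks)"
    unfolding p ks by (auto simp: lookup_add lookup_minus lookup_mon)
qed simp_all

text \<open>At exponents (0, 1, 2, 0, 1, 0) the Vandermonde factor in the L-variables contributes -1
  and the Y-difference contributes -1; the factorial 2! makes the scalar 2.\<close>

lemma Omega_given_by: "is_cochain_given_by [L, L, L, Y, Y, M]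
    ((lvar 0 - lvar 1) * (lvar 0 - lvar 2) * (lvar 1 - lvar 2) * (lvar 3 - lvar 4))
    (of_coef 6 (\<lambda>xs. 2 * dual [(L, 0), (L, 1), (L, 2), (Y, 0), (Y, 1), (M, 0)] xs))"
proof (rule given_by_of_coef)
  let ?p = "(lvar 0 - lvar 1) * (lvar 0 - lvar 2) * (lvar 1 - lvar 2) * (lvar 3 - lvar 4)"
  show "?p \<in> lpolys 6"
    by (intro lpolys_mult lpolys_diff) simp_all
  fix ks :: "nat list"
  assume "length ks = 6"
  then obtain a b c d e g where ks: "ks = [a, b, c, d, e, g]"
    by (auto simp: numeral_eq_Suc length_Suc_conv)
  have v: "lvar 0 = mon [1, 0, 0, 0, 0, 0]"
    "lvar 1 = mon [0, 1, 0, 0, 0, 0]"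
    "lvar 2 = mon [0, 0, 1, 0, 0, 0]"
    "lvar 3 = mon [0, 0, 0, 1, 0, 0]"
    "lvar 4 = mon [0, 0, 0, 0, 1, 0]"
    by (rule lvar_eq_mon; simp add: All_less_Suc numeral_eq_Suc)+
  have p: "?p = mon [2, 1, 0, 1, 0, 0] - mon [2, 1, 0, 0, 1, 0] - mon [2, 0, 1, 1, 0, 0]
      + mon [2, 0, 1, 0, 1, 0] - mon [1, 2, 0, 1, 0, 0] + mon [1, 2, 0, 0, 1, 0]
      + mon [1, 0, 2, 1, 0, 0] - mon [1, 0, 2, 0, 1, 0] + mon [0, 2, 1, 1, 0, 0]
      - mon [0, 2, 1, 0, 1, 0] - mon [0, 1, 2, 1, 0, 0] + mon [0, 1, 2, 0, 1, 0]"
    unfolding v by (simp add: algebra_simps mon_mult numeral_2_eq_2)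
  show "(\<Prod>k\<leftarrow>ks. fact k) * Poly_Mapping.lookup ?p (Poly_Mapping.nth ks) =
      2 * dual [(L, 0), (L, 1), (L, 2), (Y, 0), (Y, 1), (M, 0)] (zip [L, L, L, Y, Y, M] ks)"
    unfolding p ks by (auto simp: lookup_add lookup_minus lookup_mon)
qed simp_all

text \<open>At exponents (0, 1, 0, 1, 0, 1) each of the three differences contributes -1 and all
  factorials are 1, hence the scalar -1.\<close>

lemma Theta_given_by: "is_cochain_given_by [L, L, Y, Y, M, M]
    ((lvar 0 - lvar 1) * (lvar 2 - lvar 3) * (lvar 4 - lvar 5))
    (of_coef 6 (\<lambda>xs. -1 * dual [(L, 0), (L, 1), (Y, 0), (Y, 1), (M, 0), (M, 1)] xs))"
proof (rule given_by_of_coef)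
  let ?p = "(lvar 0 - lvar 1) * (lvar 2 - lvar 3) * (lvar 4 - lvar 5)"
  show "?p \<in> lpolys 6"
    by (intro lpolys_mult lpolys_diff) simp_all
  fix ks :: "nat list"
  assume "length ks = 6"
  then obtain a b c d e g where ks: "ks = [a, b, c, d, e, g]"
    by (auto simp: numeral_eq_Suc length_Suc_conv)
  have v: "lvar 0 = mon [1, 0, 0, 0, 0, 0]"
    "lvar 1 = mon [0, 1, 0, 0, 0, 0]"
    "lvar 2 = mon [0, 0, 1, 0, 0, 0]"
    "lvar 3 = mon [0, 0, 0, 1, 0, 0]"
    "lvar 4 = mon [0, 0, 0, 0, 1, 0]"
    "lvar 5 = mon [0, 0, 0, 0, 0, 1]"
    by (rule lvar_eq_mon; simp add: All_less_Suc numeral_eq_Suc)+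
  have p: "?p = mon [1, 0, 1, 0, 1, 0] - mon [1, 0, 1, 0, 0, 1] - mon [1, 0, 0, 1, 1, 0]
      + mon [1, 0, 0, 1, 0, 1] - mon [0, 1, 1, 0, 1, 0] + mon [0, 1, 1, 0, 0, 1]
      + mon [0, 1, 0, 1, 1, 0] - mon [0, 1, 0, 1, 0, 1]"
    unfolding v by (simp add: algebra_simps mon_mult numeral_2_eq_2)
  show "(\<Prod>k\<leftarrow>ks. fact k) * Poly_Mapping.lookup ?p (Poly_Mapping.nth ks) =
      -1 * dual [(L, 0), (L, 1), (Y, 0), (Y, 1), (M, 0), (M, 1)] (zip [L, L, Y, Y, M, M] ks)"
    unfolding p ks by (auto simp: lookup_add lookup_minus lookup_mon)
qed simp_all

text \<open>A coefficient times factorials; for instance $\Phi$ contains the term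
  $-\lambda_2\lambda_3^2$, which gives $-1 \cdot 2! = -2$.\<close>

definition factor :: "mode list \<Rightarrow> complex" where
  "factor r = (if r = [(L, 0), (L, 1), (L, 2)] then -2
     else if r = [(L, 0), (L, 1), (L, 2), (Y, 0), (Y, 1), (M, 0)] then 2
     else if r = [(L, 0), (L, 1), (Y, 0), (Y, 1), (M, 0), (M, 1)] then -1 else 1)"

definition generator :: "mode list \<Rightarrow> sv list \<Rightarrow> lpoly" where
  "generator r = of_coef (length r) (\<lambda>xs. factor r * dual r xs)"

lemma basis_generators:
  "vectorspace.basis class_ring (SV.cohomology n) ((\<lambda>r. SV.cohomology_class n (generator r)) ` set (reps n))"
  "inj_on (\<lambda>r. SV.cohomology_class n (generator r)) (set (reps n))"
  "r \<in> set (reps n) \<Longrightarrow> generator r \<in> SV.cocycles n"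
proof -
  have m: "(\<lambda>xs. factor r * dual r xs) \<in> mcochains n" if "r \<in> set (reps n)" for r
    using mcochains_lincomb[OF dual_mcochains dual_mcochains, of "factor r" r 0] reps_length[OF that] by simp
  have \<gamma>: "generator r \<in> SV.cochains n" "coef n (generator r) = (\<lambda>xs. factor r * dual r xs)"
    if "r \<in> set (reps n)" for r
    unfolding generator_def reps_length[OF that]
    using of_coef_cochain[OF m[OF that]] coef_of_coef[OF m[OF that]] by simp_all
  have k: "factor r \<noteq> 0" for r
    by (simp add: factor_def)
  note b = basis_cohomology[of n generator factor, OF \<gamma> k]
  show "vectorspace.basis class_ring (SV.cohomology n) ((\<lambda>r. SV.cohomology_class n (generator r)) ` set (reps n))"
    by (rule b(1))
  show "inj_on (\<lambda>r. SV.cohomology_class n (generator r)) (set (reps n))"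
    by (rule b(2))
  show "r \<in> set (reps n) \<Longrightarrow> generator r \<in> SV.cocycles n"
    by (rule b(3))
qed

lemma generator_Nil: "generator [] = (\<lambda>as. if as = [] then 1 else 0)"
proof (rule coef_inj)
  have m: "(\<lambda>xs. factor [] * dual [] xs) \<in> mcochains 0"
    using mcochains_lincomb[OF dual_mcochains dual_mcochains, of "factor []" "[]" 0] by simp
  show "generator [] \<in> SV.cochains 0"
    using of_coef_cochain[OF m] by (simp add: generator_def)
  have "multilinear 0 (\<lambda>as. if as = [] then 1 else 0)"
    by (simp add: multilinear_def)
  moreover have "(1 :: lpoly) \<in> lpolys 0"
    using lpolys_lconst[of 1 0] by simp
  ultimately show "(\<lambda>as. if as = [] then 1 else 0) \<in> SV.cochains 0"
    by (auto simp: cochains_iff)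
  have "coef 0 (generator []) = (\<lambda>xs. factor [] * dual [] xs)"
    using coef_of_coef[OF m] by (simp add: generator_def)
  then show "coef 0 (generator []) = coef 0 (\<lambda>as. if as = [] then 1 else 0)"
    by (auto simp: coef_def factor_def)
qed

lemma dim_cohomology:
  "vectorspace class_ring (SV.cohomology n)"
  "vectorspace.fin_dim class_ring (SV.cohomology n)"
  "vectorspace.dim class_ring (SV.cohomology n) = card (set (reps n))"
proof -
  interpret Q: quotient_vectorspace "class_ring :: complex ring" "SV.cocycle_space n" "SV.coboundaries n"
    by (rule quotient_vectorspace_cohomology)
  show vs: "vectorspace class_ring (SV.cohomology n)"
    unfolding SV.cohomology_def by (rule Q.vectorspace_Q)
  interpret H: vectorspace "class_ring :: complex ring" "SV.cohomology n" by (rule vs)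
  note b = basis_generators[where n = n]
  have fin: "finite ((\<lambda>r. SV.cohomology_class n (generator r)) ` set (reps n))" by simp
  show "H.fin_dim"
    unfolding H.fin_dim_def using fin b(1) unfolding H.basis_def by blast
  show "H.dim = card (set (reps n))"
    using H.dim_basis[OF fin b(1)] card_image[OF b(2)] by simp
qed

theorem theorem3p11:
  shows "(\<forall>q. vectorspace class_ring (SV.cohomology q) \<and>
            vectorspace.fin_dim class_ring (SV.cohomology q) \<and>
            vectorspace.dim class_ring (SV.cohomology q) =
              (if q = 0 \<or> q = 3 then 1 else if q = 5 \<or> q = 6 then 2 else 0)) \<and>
    (\<exists>\<Phi> \<Lambda> \<Psi> \<Omega> \<Theta>.
       is_cochain_given_by [L, L, L]
         ((lvar 0 - lvar 1) * (lvar 0 - lvar 2) * (lvar 1 - lvar 2)) \<Phi> \<and>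
       is_cochain_given_by [L, L, Y, Y, M]
         ((lvar 0 - lvar 1) * (lvar 2 - lvar 3) * lvar 4) \<Lambda> \<and>
       is_cochain_given_by [L, Y, Y, M, M]
         ((lvar 1 - lvar 2) * (lvar 3 - lvar 4)) \<Psi> \<and>
       is_cochain_given_by [L, L, L, Y, Y, M]
         ((lvar 0 - lvar 1) * (lvar 0 - lvar 2) * (lvar 1 - lvar 2) * (lvar 3 - lvar 4)) \<Omega> \<and>
       is_cochain_given_by [L, L, Y, Y, M, M]
         ((lvar 0 - lvar 1) * (lvar 2 - lvar 3) * (lvar 4 - lvar 5)) \<Theta> \<and>
       \<Phi> \<in> SV.cocycles 3 \<and> \<Lambda> \<in> SV.cocycles 5 \<and> \<Psi> \<in> SV.cocycles 5 \<and>
       \<Omega> \<in> SV.cocycles 6 \<and> \<Theta> \<in> SV.cocycles 6 \<and>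
       (\<forall>q. vectorspace.basis class_ring (SV.cohomology q)
          (if q = 0 then {SV.cohomology_class 0 (\<lambda>as. if as = [] then 1 else 0)}
           else if q = 3 then {SV.cohomology_class 3 \<Phi>}
           else if q = 5 then {SV.cohomology_class 5 \<Lambda>, SV.cohomology_class 5 \<Psi>}
           else if q = 6 then {SV.cohomology_class 6 \<Omega>, SV.cohomology_class 6 \<Theta>}
           else {})))"
proof -
  define \<Phi> where "\<Phi> = generator [(L, 0), (L, 1), (L, 2)]"
  define \<Lambda> where "\<Lambda> = generator [(L, 0), (L, 1), (Y, 0), (Y, 1), (M, 1)]"
  define \<Psi> where "\<Psi> = generator [(L, 0), (Y, 0), (Y, 1), (M, 0), (M, 1)]"
  define \<Omega> where "\<Omega> = generator [(L, 0), (L, 1), (L, 2), (Y, 0), (Y, 1), (M, 0)]"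
  define \<Theta> where "\<Theta> = generator [(L, 0), (L, 1), (Y, 0), (Y, 1), (M, 0), (M, 1)]"
  note gens = \<Phi>_def \<Lambda>_def \<Psi>_def \<Omega>_def \<Theta>_def
  have given: "is_cochain_given_by [L, L, L]
         ((lvar 0 - lvar 1) * (lvar 0 - lvar 2) * (lvar 1 - lvar 2)) \<Phi>"
       "is_cochain_given_by [L, L, Y, Y, M]
         ((lvar 0 - lvar 1) * (lvar 2 - lvar 3) * lvar 4) \<Lambda>"
       "is_cochain_given_by [L, Y, Y, M, M]
         ((lvar 1 - lvar 2) * (lvar 3 - lvar 4)) \<Psi>"
       "is_cochain_given_by [L, L, L, Y, Y, M]
         ((lvar 0 - lvar 1) * (lvar 0 - lvar 2) * (lvar 1 - lvar 2) * (lvar 3 - lvar 4)) \<Omega>"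
       "is_cochain_given_by [L, L, Y, Y, M, M]
         ((lvar 0 - lvar 1) * (lvar 2 - lvar 3) * (lvar 4 - lvar 5)) \<Theta>"
    using Phi_given_by Lambda_given_by Psi_given_by Omega_given_by Theta_given_by
    by (simp_all add: gens generator_def factor_def numeral_eq_Suc del: dual.simps)
  have cocycles: "\<Phi> \<in> SV.cocycles 3" "\<Lambda> \<in> SV.cocycles 5" "\<Psi> \<in> SV.cocycles 5"
    "\<Omega> \<in> SV.cocycles 6" "\<Theta> \<in> SV.cocycles 6"
    unfolding gens by (rule basis_generators(3); simp add: reps_def)+
  have classes: "(\<lambda>r. SV.cohomology_class q (generator r)) ` set (reps q) =
      (if q = 0 then {SV.cohomology_class 0 (\<lambda>as. if as = [] then 1 else 0)}
       else if q = 3 then {SV.cohomology_class 3 \<Phi>}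
       else if q = 5 then {SV.cohomology_class 5 \<Lambda>, SV.cohomology_class 5 \<Psi>}
       else if q = 6 then {SV.cohomology_class 6 \<Omega>, SV.cohomology_class 6 \<Theta>}
       else {})" for q
    by (auto simp: reps_def gens generator_Nil)
  have card: "card (set (reps q)) = (if q = 0 \<or> q = 3 then 1 else if q = 5 \<or> q = 6 then 2 else 0)" for q
    by (simp add: reps_def)
  have dim: "vectorspace class_ring (SV.cohomology q) \<and> vectorspace.fin_dim class_ring (SV.cohomology q) \<and>
      vectorspace.dim class_ring (SV.cohomology q) =
        (if q = 0 \<or> q = 3 then 1 else if q = 5 \<or> q = 6 then 2 else 0)" for q
    unfolding dim_cohomology(3) card using dim_cohomology(1,2) by blast
  show ?thesis
    by (rule conjI, rule allI, rule dim, rule exI[of _ \<Phi>], rule exI[of _ \<Lambda>],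
        rule exI[of _ \<Psi>], rule exI[of _ \<Omega>], rule exI[of _ \<Theta>], intro conjI allI)
      (rule given cocycles basis_generators(1)[unfolded classes])+
qed

end
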